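(* Let $f_h$ be the numerical solution of the one-dimensional isothermal dimensionless BGK equation $$\partial_t f+\xi\,\partial_x f=-\frac{1}{\epsilon\tau}\left(f-f^{(eq)}\right)$$ given by the discrete unified gas-kinetic scheme (DUGKS) on a uniform mesh with cell size $\Delta x$ and time step $\Delta t$, for smooth flow. Suppose that the relaxation time $\tau$ is constant and that, for small $\epsilon$, $\Delta t=O(\epsilon^{\alpha})$ and $\Delta x=O(\epsilon^{\beta})$ with $0.5<\alpha<1$ and $0.5<\beta<1$. Then the Chapman-Enskog expansion coefficients $f_h^{(k)}$ of $f_h$ obtained from DUGKS satisfy $$f_h^{(0)}=f_h^{(eq)},\qquad \sum_{j=1}^{k-1}\partial_{t_j} f_h^{(k-j-1)}+D_0 f_h^{(k-1)}=-\frac{1}{\tau}f_h^{(k)}\quad\text{for } 1\le k\le 2,$$ where $D_0=\partial_{t_0}+\xi\,\partial_x$ and the empty sum is zero. That is, $$f_h^{(0)}=f_h^{(eq)},\qquad D_0f_h^{(0)}=-\frac1\tau f_h^{(1)},\qquad \partial_{t_1}f_h^{(0)}+D_0f_h^{(1)}=-\frac1\tau f_h^{(2)}.$$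
   Context: **Kinetic equation.** $f=f(\epsilon;x,\xi,t)$ is the dimensionless distribution function of particles with velocity $\xi\in\mathbb{R}$ at position $x$ and time $t$. The parameter $\epsilon>0$ is proportional to the Knudsen number, and $\tau>0$ is the dimensionless relaxation time. The Maxwellian equilibrium is (with spatial dimension $D=1$) $$f^{(eq)}=\frac{\rho}{(2\pi R_0T)^{D/2}}\exp\left(-\frac{|\xi-u|^2}{2R_0T}\right),\qquad R_0=\tfrac12,$$ where $\rho=\int f\,d\xi$ and $\rho u=\int \xi f\,d\xi$. The flow is isothermal ($T$ is constant) and smooth (no shocks). The velocity variable is not discretized. **DUGKS.** The domain is divided into uniform cells of size $\Delta x$ centered at $x_j$, with interfaces $x_{j+1/2}$, and $t_n=n\Delta t$. Write $f_j^n=f_h(x_j,\xi,t_n)$ and $Q_j^n=Q_h(x_j,\xi,t_n)$, where $Q_h=-\frac1\tau\,(f_h-f_h^{(eq)})$. Here $f_h^{(eq)}$ is the Maxwellian above evaluated at the numerical hydrodynamic variables, i.e. at the moments $\rho_h,u_h$ of $f_h$. The scheme is $$\frac{f_j^{n+1}-f_j^n}{\Delta t}+\xi\,\frac{f_{j+1/2}^{n+1/2}-f_{j-1/2}^{n+1/2}}{\Delta x}=\frac{1}{2\epsilon}\left[Q_j^n+Q_j^{n+1}\right].$$ The interface value at the half time step, obtained by integrating the kinetic equation along characteristics over a half time step with linear interpolation, is $$f_{j+1/2}^{n+1/2}=\left(\tfrac12-\tfrac{\xi\Delta t}{2\Delta x}\right)\left[f_{j+1}^n+\tfrac{\Delta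 t}{4\epsilon}Q_{j+1}^n\right]+\left(\tfrac12+\tfrac{\xi\Delta t}{2\Delta x}\right)\left[f_j^n+\tfrac{\Delta t}{4\epsilon}Q_j^n\right]+\tfrac{\Delta t}{4\epsilon}Q_{j+1/2}^{n+1/2},$$ where $Q_{j+1/2}^{n+1/2}=Q_h(x_{j+1/2},\xi,t_n+\Delta t/2)$ is the collision term evaluated with the interface distribution $f_{j+1/2}^{n+1/2}$. **Modified equation.** $f_h$ is regarded as a smooth function of $(x,t)$. The modified equation of the scheme is the differential equation satisfied by $f_h$ that is obtained by formally Taylor expanding the scheme at $(x_j,t_n)$ in powers of $\Delta x,\Delta t$ and using the resulting equation itself repeatedly to rewrite the truncation terms. Collections of temporal and spatial derivatives of $f_h$ whose coefficients do not involve $\epsilon$ are treated as $O(1)$ with respect to $\epsilon$. **Chapman-Enskog expansion coefficients obtained from DUGKS.** Expand formally $$f_h=f_h^{(0)}+\epsilon f_h^{(1)}+\epsilon^2f_h^{(2)}+\cdots,\qquad \partial_t=\partial_{t_0}+\epsilon\,\partial_{t_1}+\epsilon^2\partial_{t_2}+\cdots.$$ It is assumed that $f_h$ depends on $(x,t)$ only through the hydrodynamic variables and their spatial gradients, and that all $f_h^{(k)}=O(1)$ and $f_h^{(eq)}=O(1)$. The symbol $\partial_{t_k}$ denotes the order-$\epsilon^k$ contribution to the time derivative from the spatial gradients of the hydrodynamic variables. These expansions are substituted into the modified equation multiplied by $\epsilon$, with $\Delta t$ and $\Delta x$ scaled with $\epsilon$ as in the claim. The equations at orders $\epsilon^0,\epsilon^1,\epsilon^2,\dots$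 (the "balance equations") determine the coefficients $f_h^{(k)}$. The scalings $\Delta t=O(\epsilon^\alpha)$, $\Delta x=O(\epsilon^\beta)$ mean that $\Delta t$, $\Delta x$ are of the order of $\epsilon^\alpha$, $\epsilon^\beta$ respectively. *)

theory Defs
  imports "HOL-Analysis.Analysis" "HOL-Library.Landau_Symbols"
begin

section \<open>Smooth functions and partial derivatives\<close>

text \<open>Meant for open sets \<open>S\<close>.\<close>

fun Ck_on :: "nat \<Rightarrow> 'a::euclidean_space set \<Rightarrow> ('a \<Rightarrow> real) \<Rightarrow> bool" where
  "Ck_on 0 S F \<longleftrightarrow> continuous_on S F"
| "Ck_on (Suc k) S F \<longleftrightarrow>
     (\<forall>z\<in>S. F differentiable (at z)) \<and>
     (\<forall>b\<in>Basis. Ck_on k S (\<lambda>z. frechet_derivative F (at z) b))"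

definition smooth_on :: "'a::euclidean_space set \<Rightarrow> ('a \<Rightarrow> real) \<Rightarrow> bool" where
  "smooth_on S F \<longleftrightarrow> (\<forall>k. Ck_on k S F)"

definition Dx :: "(real \<Rightarrow> real \<Rightarrow> real) \<Rightarrow> real \<Rightarrow> real \<Rightarrow> real" where
  "Dx F = (\<lambda>x t. deriv (\<lambda>y. F y t) x)"

definition Dt :: "(real \<Rightarrow> real \<Rightarrow> real) \<Rightarrow> real \<Rightarrow> real \<Rightarrow> real" where
  "Dt F = (\<lambda>x t. deriv (\<lambda>s. F x s) t)"


section \<open>The BGK collision term\<close>

definition mass_density :: "(real \<Rightarrow> real) \<Rightarrow> real" where
  "mass_density \<phi> = (LINT \<xi>|lborel. \<phi> \<xi>)"

definition bulk_velocity :: "(real \<Rightarrow> real) \<Rightarrow> real" where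
  "bulk_velocity \<phi> = (LINT \<xi>|lborel. \<xi> * \<phi> \<xi>) / mass_density \<phi>"

definition gas_constant :: real where
  "gas_constant = 1 / 2"

text \<open>The spatial dimension is 1, so the normalisation is a square root.\<close>

definition maxwellian :: "real \<Rightarrow> real \<Rightarrow> real \<Rightarrow> real \<Rightarrow> real" where
  "maxwellian T \<rho> u \<xi> =
     \<rho> / sqrt (2 * pi * gas_constant * T) * exp (- ((\<xi> - u)\<^sup>2) / (2 * gas_constant * T))"

definition equilibrium :: "real \<Rightarrow> (real \<Rightarrow> real) \<Rightarrow> real \<Rightarrow> real" where
  "equilibrium T \<phi> \<xi> = maxwellian T (mass_density \<phi>) (bulk_velocity \<phi>) \<xi>"

definition collision :: "real \<Rightarrow> real \<Rightarrow> (real \<Rightarrow> real) \<Rightarrow> real \<Rightarrow> real" where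
  "collision \<tau> T \<phi> \<xi> = - (1 / \<tau>) * (\<phi> \<xi> - equilibrium T \<phi> \<xi>)"


section \<open>The scheme\<close>

text \<open>Distribution functions take their arguments in the order \<open>x\<close>, \<open>\<xi>\<close>, \<open>t\<close>.

  \<open>F\<close> is the smooth function of \<open>(x, t)\<close> carrying the cell values, so the scheme is imposed
  with every point \<open>(x, t)\<close> in the role of \<open>(x\<^sub>j, t\<^sub>n)\<close>. \<open>G\<close> carries the interface values at the
  half time steps: \<open>G (x + h/2) \<xi> (t + dt/2)\<close> is the interface value between the cells centred
  at \<open>x\<close> and \<open>x + h\<close>. It is defined implicitly, since the last collision term is evaluated with
  the moments of \<open>G\<close> itself; \<open>G\<close> agrees with \<open>F\<close> at these points only up to truncation error.\<close>

definition dugks_interface ::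
  "real \<Rightarrow> real \<Rightarrow> real \<Rightarrow> real \<Rightarrow> real \<Rightarrow> real set
    \<Rightarrow> (real \<Rightarrow> real \<Rightarrow> real \<Rightarrow> real) \<Rightarrow> (real \<Rightarrow> real \<Rightarrow> real \<Rightarrow> real) \<Rightarrow> bool" where
  "dugks_interface \<tau> T \<epsilon> dt h I F G \<longleftrightarrow>
     (\<forall>x \<xi> t. t \<in> I \<longrightarrow> t + dt \<in> I \<longrightarrow>
        G (x + h / 2) \<xi> (t + dt / 2) =
          (1 / 2 - \<xi> * dt / (2 * h)) *
             (F (x + h) \<xi> t + dt / (4 * \<epsilon>) * collision \<tau> T (\<lambda>\<eta>. F (x + h) \<eta> t) \<xi>)
        + (1 / 2 + \<xi> * dt / (2 * h)) *
             (F x \<xi> t + dt / (4 * \<epsilon>) * collision \<tau> T (\<lambda>\<eta>. F x \<eta> t) \<xi>)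
        + dt / (4 * \<epsilon>) * collision \<tau> T (\<lambda>\<eta>. G (x + h / 2) \<eta> (t + dt / 2)) \<xi>)"

definition dugks_update ::
  "real \<Rightarrow> real \<Rightarrow> real \<Rightarrow> real \<Rightarrow> real \<Rightarrow> real set
    \<Rightarrow> (real \<Rightarrow> real \<Rightarrow> real \<Rightarrow> real) \<Rightarrow> (real \<Rightarrow> real \<Rightarrow> real \<Rightarrow> real) \<Rightarrow> bool" where
  "dugks_update \<tau> T \<epsilon> dt h I F G \<longleftrightarrow>
     (\<forall>x \<xi> t. t \<in> I \<longrightarrow> t + dt \<in> I \<longrightarrow>
        (F x \<xi> (t + dt) - F x \<xi> t) / dt
        + \<xi> * ((G (x + h / 2) \<xi> (t + dt / 2) - G (x - h / 2) \<xi> (t + dt / 2)) / h)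
        = 1 / (2 * \<epsilon>) *
            (collision \<tau> T (\<lambda>\<eta>. F x \<eta> t) \<xi> + collision \<tau> T (\<lambda>\<eta>. F x \<eta> (t + dt)) \<xi>))"

definition dugks_solution ::
  "real \<Rightarrow> real \<Rightarrow> real \<Rightarrow> real \<Rightarrow> real \<Rightarrow> real set
    \<Rightarrow> (real \<Rightarrow> real \<Rightarrow> real \<Rightarrow> real) \<Rightarrow> (real \<Rightarrow> real \<Rightarrow> real \<Rightarrow> real) \<Rightarrow> bool" where
  "dugks_solution \<tau> T \<epsilon> dt h I F G \<longleftrightarrow>
     dugks_interface \<tau> T \<epsilon> dt h I F G \<and> dugks_update \<tau> T \<epsilon> dt h I F G"


section \<open>Smooth flow\<close>

definition rho :: "(real \<Rightarrow> real \<Rightarrow> real \<Rightarrow> real) \<Rightarrow> real \<Rightarrow> real \<Rightarrow> real" where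
  "rho F x t = mass_density (\<lambda>\<xi>. F x \<xi> t)"

definition vel :: "(real \<Rightarrow> real \<Rightarrow> real \<Rightarrow> real) \<Rightarrow> real \<Rightarrow> real \<Rightarrow> real" where
  "vel F x t = bulk_velocity (\<lambda>\<xi>. F x \<xi> t)"

text \<open>The last conjunct says that all temporal and spatial derivatives are \<open>O(1)\<close> in \<open>\<epsilon>\<close>,
  locally uniformly in \<open>(x, t)\<close>. The weights \<open>\<bar>\<xi>\<bar> ^ p\<close> make the same true of all velocity
  moments of these derivatives.\<close>

definition smooth_flow ::
  "real \<Rightarrow> real set \<Rightarrow> (real \<Rightarrow> real \<Rightarrow> real \<Rightarrow> real \<Rightarrow> real) \<Rightarrow> bool" where
  "smooth_flow \<epsilon>\<^sub>0 I f \<longleftrightarrow>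
     (\<forall>\<epsilon>\<in>{0<..<\<epsilon>\<^sub>0}. \<forall>\<xi>. smooth_on (UNIV \<times> I) (\<lambda>(x, t). f \<epsilon> x \<xi> t)) \<and>
     (\<forall>\<epsilon>\<in>{0<..<\<epsilon>\<^sub>0}. \<forall>x. \<forall>t\<in>I.
        integrable lborel (\<lambda>\<xi>. f \<epsilon> x \<xi> t) \<and> integrable lborel (\<lambda>\<xi>. \<xi> * f \<epsilon> x \<xi> t) \<and>
        rho (f \<epsilon>) x t > 0) \<and>
     (\<forall>K a b p. compact K \<longrightarrow> K \<subseteq> UNIV \<times> I \<longrightarrow>
        (\<exists>C. \<forall>\<^sub>F \<epsilon> in at_right 0. \<forall>(x, t)\<in>K. \<forall>\<xi>.
           \<bar>\<xi>\<bar> ^ p * \<bar>(Dx ^^ a) ((Dt ^^ b) (\<lambda>x t. f \<epsilon> x \<xi> t)) x t\<bar> \<le> C))"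


section \<open>Chapman-Enskog expansion\<close>

text \<open>Hydrodynamic variables together with all their spatial gradients.\<close>

definition full_jet :: "(real \<Rightarrow> real) \<Rightarrow> (real \<Rightarrow> real) \<Rightarrow> real \<Rightarrow> nat \<Rightarrow> real \<times> real" where
  "full_jet \<rho> u x = (\<lambda>i. ((deriv ^^ i) \<rho> x, (deriv ^^ i) u x))"

text \<open>A finite family of gradients, \<open>ord i\<close> being the order of the \<open>i\<close>-th one. Since the
  index type is arbitrary, so is the number of gradients.\<close>

definition jet ::
  "('m::finite \<Rightarrow> nat) \<Rightarrow> (real \<Rightarrow> real) \<Rightarrow> (real \<Rightarrow> real) \<Rightarrow> real \<Rightarrow> (real \<times> real) ^ 'm" where
  "jet ord \<rho> u x = (\<chi> i. full_jet \<rho> u x (ord i))"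

abbreviation hjet ::
  "('m::finite \<Rightarrow> nat) \<Rightarrow> (real \<Rightarrow> real \<Rightarrow> real \<Rightarrow> real) \<Rightarrow> real \<Rightarrow> real \<Rightarrow> (real \<times> real) ^ 'm" where
  "hjet ord F x t \<equiv> jet ord (\<lambda>y. rho F y t) (\<lambda>y. vel F y t) x"

definition normal_form ::
  "real \<Rightarrow> real set \<Rightarrow> (real \<Rightarrow> real \<Rightarrow> real \<Rightarrow> real \<Rightarrow> real) \<Rightarrow> bool" where
  "normal_form \<epsilon>\<^sub>0 I f \<longleftrightarrow>
     (\<exists>\<Phi>. \<forall>\<epsilon>\<in>{0<..<\<epsilon>\<^sub>0}. \<forall>x \<xi>. \<forall>t\<in>I.
        f \<epsilon> x \<xi> t = \<Phi> \<epsilon> \<xi> (full_jet (\<lambda>y. rho (f \<epsilon>) y t) (\<lambda>y. vel (f \<epsilon>) y t) x))"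

text \<open>The coefficient \<open>f\<^sup>(\<^sup>k\<^sup>)\<close> is the function \<open>c k \<xi>\<close> of the gradients, and the
  order-\<open>\<epsilon>\<^sup>k\<close> contribution to the time derivative of the hydrodynamic variables is the pair
  \<open>\<Psi> k\<close> of functions of the gradients. The functions \<open>c k\<close> and \<open>\<Psi> k\<close> do not depend on \<open>\<epsilon>\<close>;
  the hydrodynamic variables to which they are applied are not expanded. The set \<open>U\<close> contains
  the gradients that occur. Both expansions may be differentiated termwise.

  The expansions in integer powers of \<open>\<epsilon>\<close> are carried exactly as far as the balance equations
  of orders \<open>\<epsilon>\<^sup>0\<close> to \<open>\<epsilon>\<^sup>2\<close> need them: \<open>f\<close> up to \<open>o(\<epsilon>\<^sup>2)\<close> and, since \<open>\<partial>\<^sub>t\<close> enters multiplied by \<open>\<epsilon>\<close>,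
  \<open>\<partial>\<^sub>t\<close> up to \<open>o(\<epsilon>)\<close>. Longer ones would be inconsistent with the scheme: when \<open>\<Delta>t\<close> and \<open>\<Delta>x\<close> are of
  order \<open>\<epsilon> powr a\<close> with \<open>1/2 < a < 1\<close>, the truncation errors contribute to \<open>\<partial>\<^sub>t\<close> at order
  \<open>\<epsilon> powr (2 * a)\<close>, and to \<open>f\<close> at order \<open>\<epsilon> powr (2 * a + 1)\<close>.\<close>

definition ce_expansion ::
  "real \<Rightarrow> real set \<Rightarrow> ((real \<times> real) ^ 'm::finite) set \<Rightarrow> ('m \<Rightarrow> nat)
    \<Rightarrow> (real \<Rightarrow> real \<Rightarrow> real \<Rightarrow> real \<Rightarrow> real)
    \<Rightarrow> (nat \<Rightarrow> real \<Rightarrow> (real \<times> real) ^ 'm \<Rightarrow> real)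
    \<Rightarrow> (nat \<Rightarrow> (real \<times> real) ^ 'm \<Rightarrow> real \<times> real) \<Rightarrow> bool" where
  "ce_expansion \<epsilon>\<^sub>0 I U ord f c \<Psi> \<longleftrightarrow>
     open U \<and>
     (\<forall>\<epsilon>\<in>{0<..<\<epsilon>\<^sub>0}. \<forall>x. \<forall>t\<in>I. hjet ord (f \<epsilon>) x t \<in> U) \<and>
     (\<forall>k\<le>2. \<forall>\<xi>. smooth_on U (c k \<xi>)) \<and>
     (\<forall>k\<le>1. smooth_on U (\<lambda>w. fst (\<Psi> k w)) \<and> smooth_on U (\<lambda>w. snd (\<Psi> k w))) \<and>
     (\<forall>x \<xi> a b. \<forall>t\<in>I.
        (\<lambda>\<epsilon>. (Dx ^^ a) ((Dt ^^ b) (\<lambda>x t. f \<epsilon> x \<xi> t)) x t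
            - (\<Sum>k\<le>2. \<epsilon> ^ k * (Dx ^^ a) ((Dt ^^ b) (\<lambda>x t. c k \<xi> (hjet ord (f \<epsilon>) x t))) x t))
        \<in> o[at_right 0](\<lambda>\<epsilon>. \<epsilon> ^ 2)) \<and>
     (\<forall>x i. \<forall>t\<in>I.
        (\<lambda>\<epsilon>. Dt ((Dx ^^ i) (rho (f \<epsilon>))) x t
            - (\<Sum>k\<le>1. \<epsilon> ^ k * (deriv ^^ i) (\<lambda>y. fst (\<Psi> k (hjet ord (f \<epsilon>) y t))) x))
        \<in> o[at_right 0](\<lambda>\<epsilon>. \<epsilon>) \<and>
        (\<lambda>\<epsilon>. Dt ((Dx ^^ i) (vel (f \<epsilon>))) x t
            - (\<Sum>k\<le>1. \<epsilon> ^ k * (deriv ^^ i) (\<lambda>y. snd (\<Psi> k (hjet ord (f \<epsilon>) y t))) x))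
        \<in> o[at_right 0](\<lambda>\<epsilon>. \<epsilon>))"

text \<open>For hydrodynamic fields \<open>\<rho>\<close>, \<open>u\<close> and a function \<open>\<phi>\<close> of their gradients: the values at
  \<open>x\<close> of \<open>\<partial>\<^sub>x \<phi>\<close> and of \<open>\<partial>\<^sub>t\<^sub>j \<phi>\<close>. The latter is the derivative of \<open>\<phi>\<close> when the fields
  \<open>\<rho>\<close>, \<open>u\<close> change at the rate \<open>\<Psi> j\<close>; by linearity of \<open>jet\<close> the gradients then change at
  the rate given by the gradients of \<open>\<Psi> j\<close>.

  Balancing orders of \<open>\<epsilon>\<close> means comparing these values for the same \<open>\<rho>\<close>, \<open>u\<close> and all small \<open>\<epsilon>\<close>,
  so it is done at a time at which the solutions for the different \<open>\<epsilon>\<close> share the hydrodynamic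
  fields \<open>\<rho>\<close>, \<open>u\<close>.\<close>

definition ce_dx ::
  "('m::finite \<Rightarrow> nat) \<Rightarrow> (real \<Rightarrow> real) \<Rightarrow> (real \<Rightarrow> real)
    \<Rightarrow> ((real \<times> real) ^ 'm \<Rightarrow> real) \<Rightarrow> real \<Rightarrow> real" where
  "ce_dx ord \<rho> u \<phi> x = deriv (\<lambda>y. \<phi> (jet ord \<rho> u y)) x"

definition ce_dt ::
  "('m::finite \<Rightarrow> nat) \<Rightarrow> (nat \<Rightarrow> (real \<times> real) ^ 'm \<Rightarrow> real \<times> real) \<Rightarrow> nat
    \<Rightarrow> (real \<Rightarrow> real) \<Rightarrow> (real \<Rightarrow> real) \<Rightarrow> ((real \<times> real) ^ 'm \<Rightarrow> real) \<Rightarrow> real \<Rightarrow> real" where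
  "ce_dt ord \<Psi> j \<rho> u \<phi> x =
     frechet_derivative \<phi> (at (jet ord \<rho> u x))
       (jet ord (\<lambda>y. fst (\<Psi> j (jet ord \<rho> u y))) (\<lambda>y. snd (\<Psi> j (jet ord \<rho> u y))) x)"

definition ce_D0 ::
  "('m::finite \<Rightarrow> nat) \<Rightarrow> (nat \<Rightarrow> (real \<times> real) ^ 'm \<Rightarrow> real \<times> real)
    \<Rightarrow> (real \<Rightarrow> real) \<Rightarrow> (real \<Rightarrow> real) \<Rightarrow> real \<Rightarrow> ((real \<times> real) ^ 'm \<Rightarrow> real) \<Rightarrow> real \<Rightarrow> real" where
  "ce_D0 ord \<Psi> \<rho> u \<xi> \<phi> x = ce_dt ord \<Psi> 0 \<rho> u \<phi> x + \<xi> * ce_dx ord \<rho> u \<phi> x"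

end

theory Submission
  imports Defs "HOL-Probability.Probability"
begin

text \<open>
The balance equations of orders \<open>\<epsilon>\<^sup>0\<close>, \<open>\<epsilon>\<^sup>1\<close>, \<open>\<epsilon>\<^sup>2\<close> do not see errors \<open>o(\<epsilon>)\<close> in the kinetic equation. The
theorem therefore reduces to the \<^emph>\<open>modified equation\<close>

  \<open>Q / \<epsilon> = \<partial>\<^sub>t f + \<xi> \<partial>\<^sub>x f + O(\<Delta>t\<^sup>2 + \<Delta>x\<^sup>2)\<close>,

where \<open>Q\<close> is the collision term of the cell values: with exponents larger than 1/2 the error is \<open>o(\<epsilon>)\<close>
(\<open>modified_equation_at\<close>). Inserting the expansions of \<open>f\<close> and of \<open>\<partial>\<^sub>t\<close>, with the chain rule along the
gradients of the hydrodynamic fields, turns it into a polynomial of degree 2 in \<open>\<epsilon>\<close> that is \<open>o(\<epsilon>\<^sup>2)\<close>; its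
three coefficients vanish (\<open>quadratic_smallo_zero\<close>), and they are the three balance equations.

That the scheme is second-order accurate is not a matter of a plain Taylor expansion, since
\<open>\<Delta>t / \<epsilon>\<close> is unbounded and multiplies the collision terms. The point is to show that \<open>Q\<close> is small,
together with its derivatives. This is done by bootstrapping.

First, the implicit equation for the interface value is solved: collisions conserve mass and momentum, so
the moments of the interface value, and with them its Maxwellian, are explicit (\<open>Gamma_eq\<close>). This shows
that the interface values, and hence the left-hand side \<open>L\<close> of the update, are bounded together with all
derivatives. The update reads \<open>Q(t) + Q(t + \<Delta>t) = 2 \<epsilon> L\<close>. Since \<open>Q\<close> is smooth in time, this can be solved
for \<open>Q(t)\<close> up to a second difference of \<open>Q\<close>, which is \<open>O(\<Delta>t\<^sup>2)\<close> (\<open>Q_eq\<close>). Therefore \<open>Q = O(\<epsilon>)\<close> with all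
derivatives (\<open>Q_order\<close>).

With this the interface values agree with the cell values to first order, so that
\<open>Q / \<epsilon>\<close> is the transport derivative \<open>W\<close> of the cell values up to first order in the steps (\<open>Q_W_order\<close>).
Taking moments gives the conservation laws to first order (\<open>moment_W_order\<close>). Finally, this information
makes the moments of the interface value, hence its Maxwellian, correct to second order; the terms with
\<open>\<Delta>t W\<close> coming from interpolation along characteristics and from the collision terms at both ends
cancel (\<open>Gamma_half\<close>), and the modified equation follows (\<open>modified_equation\<close>).

In order to differentiate these estimates freely, all of them are stated for \<^emph>\<open>families\<close>
\<open>\<phi> e z \<xi>\<close>, depending on the small parameter \<open>e\<close> (the Knudsen number), on the point
\<open>z = (x, t)\<close> and on the velocity, and \<open>of_order P r \<phi>\<close> says that \<open>\<phi>\<close> and all its derivatives are \<open>O(r)\<close>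
locally uniformly, with rapid decay in the velocity if \<open>P = UNIV\<close>. This class is stable under all operations
in the scheme: products, shifts, difference quotients, Taylor remainders, velocity moments and
Maxwellians.
\<close>

section \<open>Mixed partial derivatives\<close>

text \<open>The second difference of \<open>H\<close> over a small square is the square of the step times a value of
either mixed derivative, by two applications of the mean value theorem in either order.\<close>

lemma mixed_partials_eq:
  fixes H :: "real \<Rightarrow> real \<Rightarrow> real"
  assumes "0 < d"
    and Ha: "\<And>a b. \<bar>a\<bar> < d \<Longrightarrow> \<bar>b\<bar> < d \<Longrightarrow> ((\<lambda>a. H a b) has_real_derivative Ha a b) (at a)"
    and Hb: "\<And>a b. \<bar>a\<bar> < d \<Longrightarrow> \<bar>b\<bar> < d \<Longrightarrow> (H a has_real_derivative Hb a b) (at b)"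
    and Hab: "\<And>a b. \<bar>a\<bar> < d \<Longrightarrow> \<bar>b\<bar> < d \<Longrightarrow> (Ha a has_real_derivative Hab a b) (at b)"
    and Hba: "\<And>a b. \<bar>a\<bar> < d \<Longrightarrow> \<bar>b\<bar> < d \<Longrightarrow> ((\<lambda>a. Hb a b) has_real_derivative Hba a b) (at a)"
    and cont_ab: "((\<lambda>(a, b). Hab a b) \<longlongrightarrow> Hab 0 0) (nhds (0, 0))"
    and cont_ba: "((\<lambda>(a, b). Hba a b) \<longlongrightarrow> Hba 0 0) (nhds (0, 0))"
  shows "Hab 0 0 = Hba 0 0"
proof (rule ccontr)
  assume neq: "Hab 0 0 \<noteq> Hba 0 0"
  define e where "e = \<bar>Hab 0 0 - Hba 0 0\<bar> / 2"
  have "e > 0" using neq by (simp add: e_def)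
  have "eventually (\<lambda>z. (\<bar>Hab (fst z) (snd z) - Hab 0 0\<bar> < e \<and> \<bar>Hba (fst z) (snd z) - Hba 0 0\<bar> < e)) (nhds (0,0))"
    using tendstoD[OF cont_ab \<open>e > 0\<close>] tendstoD[OF cont_ba \<open>e > 0\<close>]
    by eventually_elim (auto simp: dist_real_def split: prod.splits)
  then obtain r where r: "r > 0"
    "\<And>z. dist z (0,0) < r \<Longrightarrow> \<bar>Hab (fst z) (snd z) - Hab 0 0\<bar> < e \<and> \<bar>Hba (fst z) (snd z) - Hba 0 0\<bar> < e"
    unfolding eventually_nhds_metric by blast
  \<comment> \<open>The square \<open>(0, q)\<^sup>2\<close> lies in the domain of the derivatives and in the ball where both mixed
    derivatives are within \<open>e\<close> of their values at the corner.\<close>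
  define q where "q = min d r / 4"
  have q: "0 < q" "q < d" "q \<le> r / 4" using \<open>0 < d\<close> r(1) by (auto simp: q_def)
  have small: "dist (a, b) (0, 0) < r" if "0 < a" "a < q" "0 < b" "b < q" for a b :: real
  proof -
    have "dist (a, b) (0, 0) \<le> \<bar>a\<bar> + \<bar>b\<bar>"
      using norm_Pair_le[of a b] by (simp add: dist_norm)
    then show ?thesis using that q r(1) by simp
  qed
  let ?D = "H q q - H q 0 - H 0 q + H 0 0"
  have "\<exists>a>0. a < q \<and> (H q q - H q 0) - (H 0 q - H 0 0) = (q - 0) * (Ha a q - Ha a 0)"
    by (rule MVT2) (use q in \<open>auto intro!: derivative_intros Ha\<close>)
  then obtain a where a: "0 < a" "a < q" "?D = q * (Ha a q - Ha a 0)" by auto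
  have "\<exists>b>0. b < q \<and> Ha a q - Ha a 0 = (q - 0) * Hab a b"
    by (rule MVT2) (use q a in \<open>auto intro!: derivative_intros Hab\<close>)
  then obtain b where b: "0 < b" "b < q" "?D = q * (q * Hab a b)" using a by auto
  have "\<exists>b>0. b < q \<and> (H q q - H 0 q) - (H q 0 - H 0 0) = (q - 0) * (Hb q b - Hb 0 b)"
    by (rule MVT2) (use q in \<open>auto intro!: derivative_intros Hb\<close>)
  then obtain b' where b': "0 < b'" "b' < q" "?D = q * (Hb q b' - Hb 0 b')" by auto
  have "\<exists>a>0. a < q \<and> Hb q b' - Hb 0 b' = (q - 0) * Hba a b'"
    by (rule MVT2) (use q b' in \<open>auto intro!: derivative_intros Hba\<close>)
  then obtain a' where a': "0 < a'" "a' < q" "?D = q * (q * Hba a' b')" using b' by auto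
  have "Hab a b = Hba a' b'" using b(3) a'(3) q by simp
  moreover have "\<bar>Hab a b - Hab 0 0\<bar> < e" using r(2)[OF small[of a b]] a b by auto
  moreover have "\<bar>Hba a' b' - Hba 0 0\<bar> < e" using r(2)[OF small[of a' b']] a' b' by auto
  ultimately show False unfolding e_def by (simp add: abs_if split: if_splits)
qed

section \<open>Families near a point, for small parameters\<close>

lemma integrable_inverse_square_weight: "integrable lborel (\<lambda>\<eta>::real. 1 / (1 + \<eta>\<^sup>2))"
  using integrable_inverse_1_plus_square by (simp add: set_integrable_def inverse_eq_divide)

locale germ =
  fixes z0 :: "'a::euclidean_space"
begin

text \<open>A property holds eventually in this filter when it holds for all small parameters and all points
of a neighbourhood of \<open>z0\<close> that does not shrink with the parameter. Estimates in this sense are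
locally uniform, and they survive displacements of the point that vanish with the parameter.\<close>

definition \<G> :: "(real \<times> 'a) filter" where
  "\<G> = at_right 0 \<times>\<^sub>F nhds z0"

lemma eventually_germ:
  "eventually P \<G> \<longleftrightarrow> (\<exists>\<delta>>0. \<forall>e z. 0 < e \<longrightarrow> e < \<delta> \<longrightarrow> dist z z0 < \<delta> \<longrightarrow> P (e, z))"
proof
  assume "eventually P \<G>"
  then obtain Pe Pz where e: "eventually Pe (at_right 0)" and z: "eventually Pz (nhds z0)"
    and P: "\<And>e z. Pe e \<Longrightarrow> Pz z \<Longrightarrow> P (e, z)"
    unfolding \<G>_def eventually_prod_filter by auto
  obtain d1 where d1: "d1 > 0" "\<And>e. 0 < e \<Longrightarrow> e < d1 \<Longrightarrow> Pe e"
    using e unfolding eventually_at_right_field by auto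
  obtain d2 where d2: "d2 > 0" "\<And>z. dist z z0 < d2 \<Longrightarrow> Pz z"
    using z unfolding eventually_nhds_metric by auto
  show "\<exists>\<delta>>0. \<forall>e z. 0 < e \<longrightarrow> e < \<delta> \<longrightarrow> dist z z0 < \<delta> \<longrightarrow> P (e, z)"
    by (rule exI[of _ "min d1 d2"]) (use d1 d2 P in auto)
next
  assume "\<exists>\<delta>>0. \<forall>e z. 0 < e \<longrightarrow> e < \<delta> \<longrightarrow> dist z z0 < \<delta> \<longrightarrow> P (e, z)"
  then obtain d where d: "d > 0" "\<And>e z. 0 < e \<Longrightarrow> e < d \<Longrightarrow> dist z z0 < d \<Longrightarrow> P (e, z)" by blast
  have "eventually (\<lambda>e. 0 < e \<and> e < d) (at_right 0)"
    using d(1) by (auto simp: eventually_at_right_field)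
  moreover have "eventually (\<lambda>z. dist z z0 < d) (nhds z0)"
    using d(1) by (auto simp: eventually_nhds_metric)
  ultimately show "eventually P \<G>"
    unfolding \<G>_def eventually_prod_filter using d(2) by blast
qed

lemma eventually_germ_param:
  assumes "eventually P (at_right 0)"
  shows "\<forall>\<^sub>F (e, z) in \<G>. P e"
  using assms unfolding eventually_germ eventually_at_right_field by auto

lemma eventually_germ_center:
  assumes "eventually P \<G>"
  shows "\<forall>\<^sub>F e in at_right 0. P (e, z0)"
  using assms unfolding eventually_germ eventually_at_right_field by auto

lemma eventually_germ_nhds:
  assumes "eventually P \<G>"
  shows "\<forall>\<^sub>F (e, z) in \<G>. \<forall>\<^sub>F z' in nhds z. P (e, z')"
proof -
  obtain d where d: "d > 0" "\<And>e z. 0 < e \<Longrightarrow> e < d \<Longrightarrow> dist z z0 < d \<Longrightarrow> P (e, z)"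
    using assms unfolding eventually_germ by blast
  have "\<forall>\<^sub>F z' in nhds z. P (e, z')" if "0 < e" "e < d" "dist z z0 < d" for e z
  proof -
    have "\<forall>\<^sub>F z' in nhds z. z' \<in> ball z0 d"
      by (rule eventually_nhds_in_open) (use that in \<open>auto simp: dist_commute\<close>)
    then show ?thesis
      by eventually_elim (use that d in \<open>auto simp: dist_commute\<close>)
  qed
  then show ?thesis unfolding eventually_germ using d(1) by auto
qed

text \<open>The points at which the scheme is evaluated, and the intermediate points of the mean value theorem,
differ from \<open>z\<close> by vanishing displacements, so whatever holds near \<open>z0\<close> holds at them.\<close>

lemma eventually_germ_segment:
  assumes "eventually P \<G>" "(p \<longlongrightarrow> 0) (at_right 0)"
  shows "\<forall>\<^sub>F (e, z) in \<G>. \<forall>y. \<bar>y\<bar> \<le> \<bar>p e\<bar> \<longrightarrow> P (e, z + y *\<^sub>R v)"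
proof -
  obtain d where d: "d > 0" "\<And>e z. 0 < e \<Longrightarrow> e < d \<Longrightarrow> dist z z0 < d \<Longrightarrow> P (e, z)"
    using assms(1) unfolding eventually_germ by blast
  have "((\<lambda>e. \<bar>p e\<bar> * norm v) \<longlongrightarrow> 0) (at_right 0)"
    by (rule tendsto_eq_intros assms(2) refl | simp)+
  from order_tendstoD(2)[OF this, of "d/2"]
  have "\<forall>\<^sub>F e in at_right 0. \<bar>p e\<bar> * norm v < d / 2" using d by simp
  then obtain d' where d': "d' > 0" "\<And>e. 0 < e \<Longrightarrow> e < d' \<Longrightarrow> \<bar>p e\<bar> * norm v < d / 2"
    unfolding eventually_at_right_field by auto
  show ?thesis unfolding eventually_germ
  proof (intro exI[of _ "min (d/2) d'"] conjI allI impI, goal_cases)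
    case 1 then show ?case using d d' by simp
  next
    case (2 e z)
    have "P (e, z + y *\<^sub>R v)" if "\<bar>y\<bar> \<le> \<bar>p e\<bar>" for y
    proof (rule d(2))
      have "dist (z + y *\<^sub>R v) z0 \<le> dist z z0 + \<bar>y\<bar> * norm v"
        by (simp add: dist_norm) (metis add.commute add_diff_eq norm_scaleR norm_triangle_ineq)
      also have "\<bar>y\<bar> * norm v \<le> \<bar>p e\<bar> * norm v" using that by (intro mult_right_mono) auto
      also have "\<bar>p e\<bar> * norm v < d / 2" using d' 2 by auto
      finally show "dist (z + y *\<^sub>R v) z0 < d" using 2 by auto
    qed (use 2 in auto)
    then show ?case by auto
  qed
qed

lemma eventually_germ_shift:
  assumes "eventually P \<G>" "(p \<longlongrightarrow> 0) (at_right 0)"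
  shows "\<forall>\<^sub>F (e, z) in \<G>. P (e, z + p e *\<^sub>R v)"
  using eventually_germ_segment[OF assms] by eventually_elim auto

section \<open>Orders of magnitude that include all derivatives\<close>

text \<open>Derivatives are taken along rays, so that the directions of space and of time are treated by the
same lemmas.\<close>

definition has_dd :: "'a \<Rightarrow> (real \<Rightarrow> 'a \<Rightarrow> real \<Rightarrow> real) \<Rightarrow> (real \<Rightarrow> 'a \<Rightarrow> real \<Rightarrow> real) \<Rightarrow> bool" where
  "has_dd v \<phi> \<psi> \<longleftrightarrow> (\<forall>\<^sub>F (e, z) in \<G>. \<forall>\<xi>.
     ((\<lambda>y. \<phi> e (z + y *\<^sub>R v) \<xi>) has_real_derivative \<psi> e z \<xi>) (at 0))"

definition dd :: "'a \<Rightarrow> (real \<Rightarrow> 'a \<Rightarrow> real \<Rightarrow> real) \<Rightarrow> real \<Rightarrow> 'a \<Rightarrow> real \<Rightarrow> real" where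
  "dd v \<phi> e z \<xi> = deriv (\<lambda>y. \<phi> e (z + y *\<^sub>R v) \<xi>) 0"

abbreviation fam_add (infixl "\<oplus>" 65) where "\<phi> \<oplus> \<psi> \<equiv> \<lambda>e (z::'a) \<xi>::real. \<phi> e z \<xi> + \<psi> e z \<xi> :: real"
abbreviation fam_diff (infixl "\<ominus>" 65) where "\<phi> \<ominus> \<psi> \<equiv> \<lambda>e (z::'a) \<xi>::real. \<phi> e z \<xi> - \<psi> e z \<xi> :: real"
abbreviation fam_mult (infixl "\<otimes>" 70) where "\<phi> \<otimes> \<psi> \<equiv> \<lambda>e (z::'a) \<xi>::real. \<phi> e z \<xi> * \<psi> e z \<xi> :: real"
abbreviation fam_scale (infixr "\<odot>" 75) where "a \<odot> \<phi> \<equiv> \<lambda>e (z::'a) \<xi>::real. a e * \<phi> e z \<xi> :: real"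
abbreviation xi where "xi \<phi> \<equiv> \<lambda>e (z::'a) \<xi>. \<xi> * \<phi> e z \<xi> :: real"

abbreviation weighted_le where
  "weighted_le p C r \<phi> \<equiv> (\<forall>\<^sub>F (e, z) in \<G>. \<forall>\<xi>. \<bar>\<xi>\<bar> ^ p * \<bar>\<phi> e z \<xi> :: real\<bar> \<le> C * \<bar>r e\<bar>)"

abbreviation near_measurable where
  "near_measurable \<phi> \<equiv> (\<forall>\<^sub>F (e, z) in \<G>. (\<phi> e z :: real \<Rightarrow> real) \<in> borel_measurable borel)"

abbreviation agree where
  "agree \<phi> \<psi> \<equiv> (\<forall>\<^sub>F (e, z) in \<G>. \<forall>\<xi>::real. \<phi> e z \<xi> = (\<psi> e z \<xi> :: real))"

text \<open>With \<open>P = UNIV\<close> the family decays faster than any power of the velocity, so that all its velocity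
moments exist. With \<open>P = {0}\<close> it is only bounded in the velocity, which is what hydrodynamic fields,
constant in the velocity, satisfy. Measurability is carried along for the moments.\<close>

definition wbound :: "nat set \<Rightarrow> (real \<Rightarrow> real) \<Rightarrow> (real \<Rightarrow> 'a \<Rightarrow> real \<Rightarrow> real) \<Rightarrow> bool" where
  "wbound P r \<phi> \<longleftrightarrow> (\<forall>p\<in>P. \<exists>C. weighted_le p C r \<phi>) \<and> near_measurable \<phi>"

text \<open>The family and its derivatives up to order \<open>k\<close> are of the order of \<open>r\<close>. Asking this of all derivatives
makes the class stable under differentiation, so that an estimate never has to be differentiated
separately.\<close>

primrec order_upto :: "nat set \<Rightarrow> (real \<Rightarrow> real) \<Rightarrow> nat \<Rightarrow> (real \<Rightarrow> 'a \<Rightarrow> real \<Rightarrow> real) \<Rightarrow> bool" where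
  "order_upto P r 0 \<phi> \<longleftrightarrow> wbound P r \<phi>"
| "order_upto P r (Suc k) \<phi> \<longleftrightarrow>
     wbound P r \<phi> \<and> (\<forall>v\<in>Basis. \<exists>\<psi>. has_dd v \<phi> \<psi> \<and> order_upto P r k \<psi>)"

definition of_order :: "nat set \<Rightarrow> (real \<Rightarrow> real) \<Rightarrow> (real \<Rightarrow> 'a \<Rightarrow> real \<Rightarrow> real) \<Rightarrow> bool" where
  "of_order P r \<phi> \<longleftrightarrow> (\<forall>k. order_upto P r k \<phi>)"

abbreviation "kin \<equiv> of_order UNIV"
abbreviation "hyd \<equiv> of_order {0}"

lemma has_dd_cong:
  assumes "has_dd v \<phi> \<phi>'"
    and "agree \<phi> \<psi>"
    and "agree \<phi>' \<psi>'"
  shows "has_dd v \<psi> \<psi>'"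
  using assms(1,3) eventually_germ_nhds[OF assms(2)] unfolding has_dd_def
proof eventually_elim
  case (elim ez)
  obtain e z where [simp]: "ez = (e, z)" by (cases ez)
  have ray: "((\<lambda>y. z + y *\<^sub>R v) \<longlongrightarrow> z) (nhds 0)"
    by (rule tendsto_eq_intros filterlim_ident refl | simp)+
  from elim have "\<forall>\<^sub>F z' in nhds z. \<forall>\<xi>. \<phi> e z' \<xi> = \<psi> e z' \<xi>" by simp
  from filterlim_iff[THEN iffD1, OF ray, rule_format, OF this]
  have "\<forall>\<^sub>F y in nhds 0. \<forall>\<xi>. \<phi> e (z + y *\<^sub>R v) \<xi> = \<psi> e (z + y *\<^sub>R v) \<xi>" .
  then have ev: "\<forall>\<^sub>F y in nhds 0. \<phi> e (z + y *\<^sub>R v) \<xi> = \<psi> e (z + y *\<^sub>R v) \<xi>" for \<xi>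
    by eventually_elim auto
  show ?case
    using elim DERIV_cong_ev[OF refl ev refl] by auto
qed

lemma has_dd_imp_dd:
  assumes "has_dd v \<phi> \<psi>"
  shows "agree (dd v \<phi>) \<psi>"
  using assms unfolding has_dd_def
  by eventually_elim (auto simp: dd_def intro!: DERIV_imp_deriv)

lemma wbound_cong:
  assumes "wbound P r \<phi>" and "agree \<phi> \<psi>"
  shows "wbound P r \<psi>"
  unfolding wbound_def
proof (intro conjI ballI)
  fix p assume "p \<in> P"
  then obtain C where "weighted_le p C r \<phi>"
    using assms unfolding wbound_def by blast
  then have "weighted_le p C r \<psi>"
    using assms(2) by eventually_elim auto
  then show "\<exists>C. weighted_le p C r \<psi>" by blast
next
  have "near_measurable \<phi>" using assms(1) by (simp add: wbound_def)
  with assms(2) show "near_measurable \<psi>"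
    by eventually_elim (auto simp: fun_eq_iff[symmetric])
qed

lemma order_upto_wbound: "order_upto P r k \<phi> \<Longrightarrow> wbound P r \<phi>"
  by (cases k) auto

lemma of_orderD: "of_order P r \<phi> \<Longrightarrow> order_upto P r k \<phi>"
  by (simp add: of_order_def)

lemma of_order_wbound: "of_order P r \<phi> \<Longrightarrow> wbound P r \<phi>"
  using of_orderD[of P r \<phi> 0] by simp

lemma order_upto_cong:
  assumes "order_upto P r k \<phi>" and "agree \<phi> \<psi>"
  shows "order_upto P r k \<psi>"
proof (cases k)
  case (Suc j)
  have refl_ev: "agree \<theta> \<theta>" for \<theta> :: "real \<Rightarrow> 'a \<Rightarrow> real \<Rightarrow> real" by (rule always_eventually) auto
  show ?thesis unfolding Suc order_upto.simps
  proof (intro conjI ballI)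
    show "wbound P r \<psi>" using assms Suc wbound_cong by auto
    fix v :: 'a assume "v \<in> Basis"
    then obtain \<theta> where "has_dd v \<phi> \<theta>" "order_upto P r j \<theta>" using assms(1) Suc by auto
    then show "\<exists>\<theta>. has_dd v \<psi> \<theta> \<and> order_upto P r j \<theta>"
      using has_dd_cong[OF _ assms(2) refl_ev] by blast
  qed
qed (use assms wbound_cong in auto)

lemma order_upto_Suc_imp: "order_upto P r (Suc k) \<phi> \<Longrightarrow> order_upto P r k \<phi>"
proof (induction k arbitrary: \<phi>)
  case (Suc k)
  then show ?case by (metis order_upto.simps(2))
qed auto

lemma of_order_cong:
  assumes "of_order P r \<phi>" and "agree \<phi> \<psi>"
  shows "of_order P r \<psi>"
  using assms order_upto_cong unfolding of_order_def by blast

lemma of_order_has_dd: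
  assumes "of_order P r \<phi>" "v \<in> Basis"
  shows "has_dd v \<phi> (dd v \<phi>)"
proof -
  have "order_upto P r (Suc 0) \<phi>" using assms(1) by (rule of_orderD)
  then obtain \<psi> where h: "has_dd v \<phi> \<psi>" using assms by auto
  show ?thesis
    by (rule has_dd_cong[OF h]) (use has_dd_imp_dd[OF h] in \<open>auto elim!: eventually_mono\<close>)
qed

lemma of_order_dd:
  assumes "of_order P r \<phi>" "v \<in> Basis"
  shows "of_order P r (dd v \<phi>)"
  unfolding of_order_def
proof
  fix k
  have "order_upto P r (Suc k) \<phi>" using assms(1) by (rule of_orderD)
  then obtain \<psi> where h: "has_dd v \<phi> \<psi>" "order_upto P r k \<psi>" using assms by auto
  show "order_upto P r k (dd v \<phi>)"
    by (rule order_upto_cong[OF h(2)]) (use has_dd_imp_dd[OF h(1)] in \<open>auto elim!: eventually_mono\<close>)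
qed

lemma of_order_dd_iter: "of_order P r \<phi> \<Longrightarrow> v \<in> Basis \<Longrightarrow> of_order P r ((dd v ^^ m) \<phi>)"
  by (induction m) (auto intro: of_order_dd)

text \<open>A class of bounded families that is closed under differentiation consists of families of that order.\<close>

lemma of_orderI:
  assumes "X \<phi>"
    and "\<And>\<phi>. X \<phi> \<Longrightarrow> wbound P r \<phi>"
    and "\<And>\<phi> v::'a. X \<phi> \<Longrightarrow> v \<in> Basis \<Longrightarrow> \<exists>\<psi>. has_dd v \<phi> \<psi> \<and> X \<psi>"
  shows "of_order P r \<phi>"
  unfolding of_order_def
proof
  fix k show "order_upto P r k \<phi>" using assms(1)
  proof (induction k arbitrary: \<phi>)
    case (Suc k)
    have "\<exists>\<psi>. has_dd v \<phi> \<psi> \<and> order_upto P r k \<psi>" if "v \<in> Basis" for v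
      using assms(3)[OF Suc.prems that] Suc.IH by blast
    then show ?case using assms(2) Suc.prems by simp
  qed (use assms(2) in auto)
qed

lemma wbound_add:
  assumes "wbound P r \<phi>" "wbound P r \<psi>"
  shows "wbound P r (\<phi> \<oplus> \<psi>)"
  unfolding wbound_def
proof (intro conjI ballI)
  fix p assume "p \<in> P"
  then obtain C D where "weighted_le p C r \<phi>"
     "weighted_le p D r \<psi>"
    using assms unfolding wbound_def by meson
  then have "weighted_le p (C + D) r (\<phi> \<oplus> \<psi>)"
  proof eventually_elim
    case (elim ez)
    obtain e z where [simp]: "ez = (e, z)" by (cases ez)
    have "\<bar>\<xi>\<bar> ^ p * \<bar>\<phi> e z \<xi> + \<psi> e z \<xi>\<bar> \<le> (C + D) * \<bar>r e\<bar>" for \<xi>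
    proof -
      have "\<bar>\<xi>\<bar> ^ p * \<bar>\<phi> e z \<xi> + \<psi> e z \<xi>\<bar> \<le> \<bar>\<xi>\<bar> ^ p * (\<bar>\<phi> e z \<xi>\<bar> + \<bar>\<psi> e z \<xi>\<bar>)"
        by (intro mult_left_mono abs_triangle_ineq) auto
      then show ?thesis using elim by (simp add: distrib_left distrib_right) (smt (verit))
    qed
    then show ?case by simp
  qed
  then show "\<exists>C. weighted_le p C r (\<phi> \<oplus> \<psi>)" by blast
next
  have "near_measurable \<phi>" 
    "near_measurable \<psi>" using assms by (auto simp add: wbound_def)
  then show "near_measurable (\<phi> \<oplus> \<psi>)"
    by eventually_elim auto
qed

lemma wbound_mult:
  assumes "wbound P r \<phi>" "wbound {0} r' \<psi>"
  shows "wbound P (\<lambda>e. r e * r' e) (\<phi> \<otimes> \<psi>)"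
  unfolding wbound_def
proof (intro conjI ballI)
  fix p assume "p \<in> P"
  then obtain C D where "weighted_le p C r \<phi>"
     "weighted_le 0 D r' \<psi>"
    using assms unfolding wbound_def by blast
  then have "weighted_le p (C * D) (\<lambda>e. r e * r' e) (\<phi> \<otimes> \<psi>)"
  proof eventually_elim
    case (elim ez)
    obtain e z where [simp]: "ez = (e, z)" by (cases ez)
    have "\<bar>\<xi>\<bar> ^ p * \<bar>\<phi> e z \<xi> * \<psi> e z \<xi>\<bar> \<le> (C * D) * \<bar>r e * r' e\<bar>" for \<xi>
    proof -
      have 1: "\<bar>\<xi>\<bar> ^ p * \<bar>\<phi> e z \<xi>\<bar> \<le> C * \<bar>r e\<bar>" "\<bar>\<psi> e z \<xi>\<bar> \<le> D * \<bar>r' e\<bar>" using elim by auto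
      have "(\<bar>\<xi>\<bar> ^ p * \<bar>\<phi> e z \<xi>\<bar>) * \<bar>\<psi> e z \<xi>\<bar> \<le> (C * \<bar>r e\<bar>) * (D * \<bar>r' e\<bar>)"
        by (rule mult_mono[OF 1]) (auto intro: order_trans[OF _ 1(1)])
      then show ?thesis by (simp add: abs_mult mult_ac)
    qed
    then show ?case by simp
  qed
  then show "\<exists>C. weighted_le p C (\<lambda>e. r e * r' e) (\<phi> \<otimes> \<psi>)" by blast
next
  have "near_measurable \<phi>" 
    "near_measurable \<psi>" using assms by (auto simp add: wbound_def)
  then show "near_measurable (\<phi> \<otimes> \<psi>)"
    by eventually_elim auto
qed

lemma wbound_param:
  assumes "\<forall>\<^sub>F e in at_right 0. \<bar>a e\<bar> \<le> B * \<bar>r e\<bar>"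
  shows "wbound {0} r (\<lambda>e z \<xi>. a e)"
  unfolding wbound_def using eventually_germ_param[OF assms] by (auto intro: always_eventually)

lemma wbound_weaken:
  assumes "wbound P r \<phi>" "r \<in> O[at_right 0](r')"
  shows "wbound P r' \<phi>"
  unfolding wbound_def
proof (intro conjI ballI)
  fix p assume "p \<in> P"
  then obtain C where C: "weighted_le p C r \<phi>"
    using assms unfolding wbound_def by blast
  obtain B where B: "\<forall>\<^sub>F e in at_right 0. \<bar>r e\<bar> \<le> B * \<bar>r' e\<bar>"
    using assms(2) by (auto elim!: landau_o.bigE)
  have "weighted_le p (\<bar>C\<bar> * B) r' \<phi>"
    using C eventually_germ_param[OF B]
  proof eventually_elim
    case (elim ez)
    obtain e z where [simp]: "ez = (e, z)" by (cases ez)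
    have "C * \<bar>r e\<bar> \<le> \<bar>C\<bar> * (B * \<bar>r' e\<bar>)"
      using elim by (intro mult_mono) auto
    then show ?case using elim by (auto simp: mult.assoc intro: order_trans)
  qed
  then show "\<exists>C. weighted_le p C r' \<phi>" by blast
qed (use assms in \<open>simp add: wbound_def\<close>)

lemma wbound_times_xi:
  assumes "wbound UNIV r \<phi>"
  shows "wbound UNIV r (xi \<phi>)"
  unfolding wbound_def
proof (intro conjI ballI)
  fix p :: nat
  obtain C where "weighted_le (Suc p) C r \<phi>"
    using assms unfolding wbound_def by blast
  then have "weighted_le p C r (xi \<phi>)"
    by eventually_elim (auto simp: abs_mult mult_ac)
  then show "\<exists>C. weighted_le p C r (xi \<phi>)" by blast
next
  have "near_measurable \<phi>" 
    using assms by (auto simp add: wbound_def)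
  then show "near_measurable (xi \<phi>)"
    by eventually_elim auto
qed

lemma has_dd_add:
  assumes "has_dd v \<phi> \<phi>'" "has_dd v \<psi> \<psi>'"
  shows "has_dd v (\<phi> \<oplus> \<psi>) (\<phi>' \<oplus> \<psi>')"
  using assms unfolding has_dd_def by eventually_elim (auto intro!: derivative_intros)

lemma has_dd_mult:
  assumes "has_dd v \<phi> \<phi>'" "has_dd v \<psi> \<psi>'"
  shows "has_dd v (\<phi> \<otimes> \<psi>) (\<phi>' \<otimes> \<psi> \<oplus> \<phi> \<otimes> \<psi>')"
  using assms unfolding has_dd_def
  by eventually_elim (auto intro!: derivative_eq_intros)

lemma has_dd_param: "has_dd v (\<lambda>e z \<xi>. a e \<xi>) (\<lambda>e z \<xi>. 0)"
  unfolding has_dd_def by (auto intro!: always_eventually)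

lemma has_dd_shift:
  assumes "has_dd v \<phi> \<phi>'" "(p \<longlongrightarrow> 0) (at_right 0)"
  shows "has_dd v (\<lambda>e z. \<phi> e (z + p e *\<^sub>R w)) (\<lambda>e z. \<phi>' e (z + p e *\<^sub>R w))"
  using eventually_germ_shift[OF assms(1)[unfolded has_dd_def] assms(2), of w] unfolding has_dd_def
  by eventually_elim (auto simp: algebra_simps)

lemma order_upto_add:
  "order_upto P r k \<phi> \<Longrightarrow> order_upto P r k \<psi> \<Longrightarrow> order_upto P r k (\<phi> \<oplus> \<psi>)"
proof (induction k arbitrary: \<phi> \<psi>)
  case (Suc k)
  show ?case unfolding order_upto.simps
  proof (intro conjI ballI)
    fix v :: 'a assume "v \<in> Basis"
    then obtain \<phi>' \<psi>' where "has_dd v \<phi> \<phi>'" "order_upto P r k \<phi>'" "has_dd v \<psi> \<psi>'" "order_upto P r k \<psi>'"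
      using Suc.prems by (auto, meson)
    then show "\<exists>\<theta>. has_dd v (\<phi> \<oplus> \<psi>) \<theta> \<and> order_upto P r k \<theta>"
      by (intro exI[of _ "\<lambda>e z \<xi>. \<phi>' e z \<xi> + \<psi>' e z \<xi>"] conjI has_dd_add Suc.IH)
  qed (use Suc.prems in \<open>auto intro: wbound_add\<close>)
qed (auto intro: wbound_add)

text \<open>In the product rule one factor always carries the velocity weights and the other one is bounded in the
velocity.\<close>

lemma order_upto_mult:
  "order_upto P r k \<phi> \<Longrightarrow> order_upto {0} r' k \<psi> \<Longrightarrow>
     order_upto P (\<lambda>e. r e * r' e) k (\<phi> \<otimes> \<psi>)"
proof (induction k arbitrary: \<phi> \<psi>)
  case (Suc k)
  show ?case unfolding order_upto.simps
  proof (intro conjI ballI)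
    fix v :: 'a assume "v \<in> Basis"
    then obtain \<phi>' \<psi>' where h: "has_dd v \<phi> \<phi>'" "order_upto P r k \<phi>'" "has_dd v \<psi> \<psi>'" "order_upto {0} r' k \<psi>'"
      using Suc.prems by (auto, meson)
    show "\<exists>\<theta>. has_dd v (\<phi> \<otimes> \<psi>) \<theta> \<and> order_upto P (\<lambda>e. r e * r' e) k \<theta>"
      by (rule exI, rule conjI, rule has_dd_mult[OF h(1,3)], rule order_upto_add; rule Suc.IH)
         (use h Suc.prems order_upto_Suc_imp in blast)+
  qed (use Suc.prems in \<open>auto intro: wbound_mult\<close>)
qed (auto intro: wbound_mult)

lemma of_order_add:
  "of_order P r \<phi> \<Longrightarrow> of_order P r \<psi> \<Longrightarrow> of_order P r (\<phi> \<oplus> \<psi>)"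
  by (auto simp: of_order_def intro: order_upto_add)

lemma of_order_mult:
  "of_order P r \<phi> \<Longrightarrow> hyd r' \<psi> \<Longrightarrow> of_order P (\<lambda>e. r e * r' e) (\<phi> \<otimes> \<psi>)"
  by (auto simp: of_order_def intro: order_upto_mult)

lemma of_order_param: "hyd a (\<lambda>e z \<xi>. a e)"
proof (rule of_orderI[where X = "\<lambda>\<phi>. \<exists>c. \<phi> = (\<lambda>e z \<xi>. c * a e)"])
  show "\<exists>c. (\<lambda>e (z::'a) (\<xi>::real). a e) = (\<lambda>e z \<xi>. c * a e)" by (rule exI[of _ 1]) simp
next
  fix \<phi> :: "real \<Rightarrow> 'a \<Rightarrow> real \<Rightarrow> real" assume "\<exists>c. \<phi> = (\<lambda>e z \<xi>. c * a e)"
  then obtain c where [simp]: "\<phi> = (\<lambda>e z \<xi>. c * a e)" by blast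
  show "wbound {0} a \<phi>" by (auto intro!: wbound_param[of _ "\<bar>c\<bar>"] simp: abs_mult)
  show "\<exists>\<psi>. has_dd v \<phi> \<psi> \<and> (\<exists>c. \<psi> = (\<lambda>e z \<xi>. c * a e))" for v
    by (rule exI[of _ "\<lambda>e z \<xi>. 0"]) (auto intro!: has_dd_param exI[of _ 0])
qed

lemma of_order_scale:
  "of_order P r \<phi> \<Longrightarrow> of_order P (\<lambda>e. a e * r e) (a \<odot> \<phi>)"
  using of_order_mult[OF _ of_order_param, of P r \<phi> a] by (simp add: mult.commute)

lemma of_order_weaken:
  assumes "of_order P r \<phi>" "r \<in> O[at_right 0](r')"
  shows "of_order P r' \<phi>"
proof (rule of_orderI[where X = "of_order P r"])
  fix \<phi> and v :: 'a assume \<phi>: "of_order P r \<phi>"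
  show "wbound P r' \<phi>"
    by (rule wbound_weaken[OF of_order_wbound[OF \<phi>] assms(2)])
  show "v \<in> Basis \<Longrightarrow> \<exists>\<psi>. has_dd v \<phi> \<psi> \<and> of_order P r \<psi>"
    using of_order_has_dd[OF \<phi>] of_order_dd[OF \<phi>] by blast
qed (rule assms)

lemma of_order_scale_weaken:
  assumes "of_order P r \<phi>" "(\<lambda>e. a e * r e) \<in> O[at_right 0](r')"
  shows "of_order P r' (a \<odot> \<phi>)"
  using of_order_weaken[OF of_order_scale[OF assms(1)] assms(2)] .

lemma of_order_cmult: "of_order P r \<phi> \<Longrightarrow> of_order P r ((\<lambda>_. c) \<odot> \<phi>)"
  by (rule of_order_scale_weaken) auto

lemma of_order_uminus: "of_order P r \<phi> \<Longrightarrow> of_order P r (\<lambda>e z \<xi>. - \<phi> e z \<xi>)"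
  using of_order_cmult[of P r \<phi> "-1"] by simp

lemma of_order_diff:
  "of_order P r \<phi> \<Longrightarrow> of_order P r \<psi> \<Longrightarrow> of_order P r (\<phi> \<ominus> \<psi>)"
  using of_order_add[OF _ of_order_uminus, of P r \<phi> \<psi>] by simp

lemma of_order_times_xi:
  assumes "kin r \<phi>" shows "kin r (xi \<phi>)"
proof (rule of_orderI[where X = "\<lambda>\<psi>. \<exists>\<phi>. kin r \<phi> \<and> \<psi> = (xi \<phi>)"])
  fix \<psi> and v :: 'a assume "\<exists>\<phi>. kin r \<phi> \<and> \<psi> = (xi \<phi>)" and v: "v \<in> Basis"
  then obtain \<phi> where \<phi>: "kin r \<phi>" and [simp]: "\<psi> = (xi \<phi>)" by blast
  have "has_dd v \<psi> (xi (dd v \<phi>))"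
    using has_dd_mult[OF has_dd_param of_order_has_dd[OF \<phi> v], of "\<lambda>e \<xi>. \<xi>"] by simp
  then show "\<exists>\<theta>. has_dd v \<psi> \<theta> \<and> (\<exists>\<phi>. kin r \<phi> \<and> \<theta> = (xi \<phi>))"
    using of_order_dd[OF \<phi> v] by blast
qed (use assms of_order_wbound wbound_times_xi in \<open>auto\<close>)

lemma wbound_shift:
  assumes "wbound P r \<phi>" "(p \<longlongrightarrow> 0) (at_right 0)"
  shows "wbound P r (\<lambda>e z. \<phi> e (z + p e *\<^sub>R w))"
  unfolding wbound_def
proof (intro conjI ballI)
  fix q assume "q \<in> P"
  then obtain C where "weighted_le q C r \<phi>"
    using assms unfolding wbound_def by blast
  from eventually_germ_shift[OF this assms(2)]
  show "\<exists>C. \<forall>\<^sub>F (e, z) in \<G>. \<forall>\<xi>. \<bar>\<xi>\<bar> ^ q * \<bar>\<phi> e (z + p e *\<^sub>R w) \<xi>\<bar> \<le> C * \<bar>r e\<bar>" by auto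
next
  have "near_measurable \<phi>" using assms(1) by (simp add: wbound_def)
  from eventually_germ_shift[OF this assms(2)]
  show "\<forall>\<^sub>F (e, z) in \<G>. \<phi> e (z + p e *\<^sub>R w) \<in> borel_measurable borel" by auto
qed

text \<open>Shifting commutes with differentiation, so the shifts of a class of families again form a class to
which the closure principle applies.\<close>

lemma of_order_shift:
  assumes "of_order P r \<phi>" and p: "(p \<longlongrightarrow> 0) (at_right 0)"
  shows "of_order P r (\<lambda>e z. \<phi> e (z + p e *\<^sub>R w))"
proof (rule of_orderI[where X = "\<lambda>\<psi>. \<exists>\<phi>. of_order P r \<phi> \<and> \<psi> = (\<lambda>e z. \<phi> e (z + p e *\<^sub>R w))"])
  fix \<psi> and v :: 'a assume "\<exists>\<phi>. of_order P r \<phi> \<and> \<psi> = (\<lambda>e z. \<phi> e (z + p e *\<^sub>R w))" and v: "v \<in> Basis"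
  then show "\<exists>\<theta>. has_dd v \<psi> \<theta> \<and> (\<exists>\<phi>. of_order P r \<phi> \<and> \<theta> = (\<lambda>e z. \<phi> e (z + p e *\<^sub>R w)))"
    using has_dd_shift[OF of_order_has_dd[OF _ v] p] of_order_dd[OF _ v] by blast
qed (use assms of_order_wbound wbound_shift in \<open>auto\<close>)

end

section \<open>Taylor expansion\<close>

lemma DERIV_ray:
  fixes f :: "'a::real_vector \<Rightarrow> real"
  assumes "((\<lambda>y. f (z + y0 *\<^sub>R v + y *\<^sub>R v)) has_real_derivative d) (at 0)"
  shows "((\<lambda>y. f (z + y *\<^sub>R v)) has_real_derivative d) (at y0)"
proof -
  have "(\<lambda>y. f (z + y0 *\<^sub>R v + y *\<^sub>R v)) = (\<lambda>y. f (z + (y + y0) *\<^sub>R v))"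
    by (simp add: algebra_simps)
  then show ?thesis using assms DERIV_shift[of "\<lambda>y. f (z + y *\<^sub>R v)" d 0 y0] by simp
qed

lemma Taylor_remainder_le:
  fixes D :: "nat \<Rightarrow> real \<Rightarrow> real"
  assumes "\<And>m y. m < n \<Longrightarrow> \<bar>y\<bar> \<le> \<bar>p\<bar> \<Longrightarrow> (D m has_real_derivative D (Suc m) y) (at y)"
    and "\<And>y. \<bar>y\<bar> \<le> \<bar>p\<bar> \<Longrightarrow> \<bar>D n y\<bar> \<le> B"
  shows "\<bar>D 0 p - (\<Sum>m<n. D m 0 / fact m * p ^ m)\<bar> \<le> B * \<bar>p\<bar> ^ n"
proof -
  obtain t where t: "\<bar>t\<bar> \<le> \<bar>p\<bar>" "D 0 p = (\<Sum>m<n. D m 0 / fact m * p ^ m) + D n t / fact n * p ^ n"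
    using Maclaurin_bi_le[of D "D 0" n p] assms(1) by auto
  have B: "\<bar>D n t\<bar> \<le> B" using assms(2) t(1) by simp
  have "\<bar>D n t / fact n\<bar> \<le> \<bar>D n t\<bar> / 1"
    unfolding abs_divide by (rule divide_left_mono) (auto simp: fact_ge_1)
  then have "\<bar>D n t / fact n * p ^ n\<bar> \<le> B * \<bar>p\<bar> ^ n"
    unfolding abs_mult power_abs[symmetric] using B by (intro mult_right_mono) auto
  then show ?thesis using t(2) by simp
qed

context germ
begin

lemma eventually_germ_box:
  assumes "eventually P \<G>" "v \<in> Basis"
  shows "\<exists>\<delta>>0. \<forall>e z y. 0 < e \<longrightarrow> e < \<delta> \<longrightarrow> dist z z0 < \<delta> \<longrightarrow> \<bar>y\<bar> < \<delta> \<longrightarrow> P (e, z + y *\<^sub>R v)"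
proof -
  obtain d where d: "d > 0" "\<And>e z. 0 < e \<Longrightarrow> e < d \<Longrightarrow> dist z z0 < d \<Longrightarrow> P (e, z)"
    using assms(1) unfolding eventually_germ by blast
  have "dist (z + y *\<^sub>R v) z0 < d" if "dist z z0 < d / 2" "\<bar>y\<bar> < d / 2" for z y
  proof -
    have "dist (z + y *\<^sub>R v) z0 \<le> dist (z + y *\<^sub>R v) z + dist z z0" by (rule dist_triangle)
    then show ?thesis using that assms(2) by (simp add: dist_norm)
  qed
  then show ?thesis using d by (intro exI[of _ "d/2"]) auto
qed

text \<open>The mean value theorem with the bound on the directional derivative, whose constant does not depend on
the parameter.\<close>

lemma of_order_lipschitz:
  assumes "of_order P r \<phi>" "0 \<in> P" "v \<in> Basis"
  shows "\<exists>C. \<exists>\<delta>>0. \<forall>e z y \<xi>. 0 < e \<longrightarrow> e < \<delta> \<longrightarrow> dist z z0 < \<delta> \<longrightarrow> \<bar>y\<bar> < \<delta> \<longrightarrow>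
           \<bar>\<phi> e (z + y *\<^sub>R v) \<xi> - \<phi> e z \<xi>\<bar> \<le> C * \<bar>r e\<bar> * \<bar>y\<bar>"
proof -
  obtain C where C: "weighted_le 0 C r (dd v \<phi>)"
    using of_order_wbound[OF of_order_dd[OF assms(1,3)]] assms(2) unfolding wbound_def by blast
  from eventually_germ_box[OF eventually_conj[OF C of_order_has_dd[OF assms(1,3), unfolded has_dd_def]] assms(3)]
  obtain d where d: "d > 0" and
    D: "\<And>e z y \<xi>. 0 < e \<Longrightarrow> e < d \<Longrightarrow> dist z z0 < d \<Longrightarrow> \<bar>y\<bar> < d \<Longrightarrow>
      \<bar>dd v \<phi> e (z + y *\<^sub>R v) \<xi>\<bar> \<le> C * \<bar>r e\<bar> \<and>
      ((\<lambda>y'. \<phi> e (z + y *\<^sub>R v + y' *\<^sub>R v) \<xi>) has_real_derivative dd v \<phi> e (z + y *\<^sub>R v) \<xi>) (at 0)"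
    by auto
  have "\<bar>\<phi> e (z + y *\<^sub>R v) \<xi> - \<phi> e z \<xi>\<bar> \<le> C * \<bar>r e\<bar> * \<bar>y\<bar>"
    if "0 < e" "e < d" "dist z z0 < d" "\<bar>y\<bar> < d" for e z y \<xi>
  proof -
    have "((\<lambda>y. \<phi> e (z + y *\<^sub>R v) \<xi>) has_real_derivative dd v \<phi> e (z + y' *\<^sub>R v) \<xi>) (at y')"
      "\<bar>dd v \<phi> e (z + y' *\<^sub>R v) \<xi>\<bar> \<le> C * \<bar>r e\<bar>" if "\<bar>y'\<bar> \<le> \<bar>y\<bar>" for y'
      using D[of e z y' \<xi>] that \<open>0 < e\<close> \<open>e < d\<close> \<open>dist z z0 < d\<close> \<open>\<bar>y\<bar> < d\<close> by (auto intro: DERIV_ray)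
    then show ?thesis
      using Taylor_remainder_le[of 1 y "\<lambda>m y. ((dd v ^^ m) \<phi>) e (z + y *\<^sub>R v) \<xi>" "C * \<bar>r e\<bar>"] by simp
  qed
  then show ?thesis using d by blast
qed

lemma of_order_tendsto_plane:
  assumes \<phi>: "of_order P r \<phi>" "0 \<in> P" and vw: "v \<in> Basis" "w \<in> Basis"
  shows "\<forall>\<^sub>F (e, z) in \<G>. \<forall>\<xi>.
    ((\<lambda>(a, b). \<phi> e (z + a *\<^sub>R v + b *\<^sub>R w) \<xi>) \<longlongrightarrow> \<phi> e z \<xi>) (nhds (0, 0))"
proof -
  obtain C1 d1 where d1: "d1 > 0" "\<And>e z y \<xi>. 0 < e \<Longrightarrow> e < d1 \<Longrightarrow> dist z z0 < d1 \<Longrightarrow> \<bar>y\<bar> < d1 \<Longrightarrow>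
      \<bar>\<phi> e (z + y *\<^sub>R v) \<xi> - \<phi> e z \<xi>\<bar> \<le> C1 * \<bar>r e\<bar> * \<bar>y\<bar>"
    using of_order_lipschitz[OF \<phi> vw(1)] by blast
  obtain C2 d2 where d2: "d2 > 0" "\<And>e z y \<xi>. 0 < e \<Longrightarrow> e < d2 \<Longrightarrow> dist z z0 < d2 \<Longrightarrow> \<bar>y\<bar> < d2 \<Longrightarrow>
      \<bar>\<phi> e (z + y *\<^sub>R w) \<xi> - \<phi> e z \<xi>\<bar> \<le> C2 * \<bar>r e\<bar> * \<bar>y\<bar>"
    using of_order_lipschitz[OF \<phi> vw(2)] by blast
  define d where "d = min d1 d2 / 2"
  have d: "d > 0" "d \<le> d1 / 2" "d \<le> d2 / 2" using d1(1) d2(1) by (auto simp: d_def)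
  have main: "((\<lambda>(a, b). \<phi> e (z + a *\<^sub>R v + b *\<^sub>R w) \<xi>) \<longlongrightarrow> \<phi> e z \<xi>) (nhds (0, 0))"
    if e: "0 < e" "e < d" "dist z z0 < d" for e z \<xi>
  proof (rule LIM_zero_cancel, rule Lim_null_comparison)
    have "\<forall>\<^sub>F x in nhds (0, 0). x \<in> ball (0,0) d"
      by (rule eventually_nhds_in_open) (use d in auto)
    then show "\<forall>\<^sub>F x in nhds (0, 0). norm ((case x of (a, b) \<Rightarrow> \<phi> e (z + a *\<^sub>R v + b *\<^sub>R w) \<xi>) - \<phi> e z \<xi>)
       \<le> C1 * \<bar>r e\<bar> * \<bar>fst x\<bar> + C2 * \<bar>r e\<bar> * \<bar>snd x\<bar>"
    proof eventually_elim
      case (elim x)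
      obtain a b where x: "x = (a, b)" by (cases x)
      have "norm x < d" using elim unfolding mem_ball dist_norm zero_prod_def[symmetric] by simp
      then have ab: "\<bar>a\<bar> < d" "\<bar>b\<bar> < d"
        using norm_fst_le[of a b] norm_snd_le[of b a] unfolding x by simp_all
      have "dist (z + a *\<^sub>R v) z0 \<le> dist (z + a *\<^sub>R v) z + dist z z0" by (rule dist_triangle)
      then have z': "dist (z + a *\<^sub>R v) z0 < d2" using ab vw(1) e d by (simp add: dist_norm)
      show ?case
        using d1(2)[of e z a \<xi>] d2(2)[of e "z + a *\<^sub>R v" b \<xi>] ab e d z' unfolding x
        by (simp, smt (verit))
    qed
    show "((\<lambda>x. C1 * \<bar>r e\<bar> * \<bar>fst x\<bar> + C2 * \<bar>r e\<bar> * \<bar>snd x\<bar>) \<longlongrightarrow> 0) (nhds (0, 0))"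
      by (rule tendsto_eq_intros filterlim_ident refl | simp)+
  qed
  show ?thesis unfolding eventually_germ using d(1) main by (intro exI[of _ d]) auto
qed

text \<open>Continuity of the mixed derivatives, needed for their equality, comes for free: they are themselves
families with bounded derivatives.\<close>

lemma dd_commute:
  assumes \<phi>: "of_order P r \<phi>" "0 \<in> P" and vw: "v \<in> Basis" "w \<in> Basis"
  shows "agree (dd v (dd w \<phi>)) (dd w (dd v \<phi>))"
proof -
  note dv = of_order_dd[OF \<phi>(1) vw(1)] and dw = of_order_dd[OF \<phi>(1) vw(2)]
  let ?P = "\<lambda>(e, z). \<forall>\<xi>.
     ((\<lambda>y. \<phi> e (z + y *\<^sub>R v) \<xi>) has_real_derivative dd v \<phi> e z \<xi>) (at 0) \<and>
     ((\<lambda>y. \<phi> e (z + y *\<^sub>R w) \<xi>) has_real_derivative dd w \<phi> e z \<xi>) (at 0) \<and>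
     ((\<lambda>y. dd v \<phi> e (z + y *\<^sub>R w) \<xi>) has_real_derivative dd w (dd v \<phi>) e z \<xi>) (at 0) \<and>
     ((\<lambda>y. dd w \<phi> e (z + y *\<^sub>R v) \<xi>) has_real_derivative dd v (dd w \<phi>) e z \<xi>) (at 0)"
  have "eventually ?P \<G>"
    using of_order_has_dd[OF \<phi>(1) vw(1), unfolded has_dd_def] of_order_has_dd[OF \<phi>(1) vw(2), unfolded has_dd_def]
      of_order_has_dd[OF dv vw(2), unfolded has_dd_def] of_order_has_dd[OF dw vw(1), unfolded has_dd_def]
    by eventually_elim auto
  then obtain d where d: "d > 0" "\<And>e z. 0 < e \<Longrightarrow> e < d \<Longrightarrow> dist z z0 < d \<Longrightarrow> ?P (e, z)"
    unfolding eventually_germ by blast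
  have "\<forall>\<^sub>F (e, z) in \<G>. e < d / 3 \<and> dist z z0 < d / 3 \<and> 0 < e"
    unfolding eventually_germ using d(1) by (intro exI[of _ "d/3"]) auto
  then show ?thesis
    using of_order_tendsto_plane[OF of_order_dd[OF dv vw(2)] \<phi>(2) vw] of_order_tendsto_plane[OF of_order_dd[OF dw vw(1)] \<phi>(2) vw]
  proof eventually_elim
    case (elim ez)
    obtain e z where ez[simp]: "ez = (e, z)" by (cases ez)
    have near: "dist (z + a *\<^sub>R v + b *\<^sub>R w) z0 < d" if "\<bar>a\<bar> < d / 3" "\<bar>b\<bar> < d / 3" for a b
    proof -
      have "dist (z + a *\<^sub>R v + b *\<^sub>R w) z0 \<le> norm (a *\<^sub>R v) + norm (b *\<^sub>R w) + dist z z0"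
        using dist_triangle[of "z + a *\<^sub>R v + b *\<^sub>R w" z0 z] norm_triangle_ineq[of "a *\<^sub>R v" "b *\<^sub>R w"]
        by (simp add: dist_norm algebra_simps)
      then show ?thesis using that vw elim by simp
    qed
    have swap: "z + a *\<^sub>R v + b *\<^sub>R w = (z + b *\<^sub>R w) + a *\<^sub>R v" for a b by (simp add: algebra_simps)
    have "dd w (dd v \<phi>) e z \<xi> = dd v (dd w \<phi>) e z \<xi>" for \<xi>
    proof -
      have "dd w (dd v \<phi>) e (z + 0 *\<^sub>R v + 0 *\<^sub>R w) \<xi> = dd v (dd w \<phi>) e (z + 0 *\<^sub>R v + 0 *\<^sub>R w) \<xi>"
      proof (rule mixed_partials_eq[where d = "d / 3" and H = "\<lambda>a b. \<phi> e (z + a *\<^sub>R v + b *\<^sub>R w) \<xi>"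
           and Ha = "\<lambda>a b. dd v \<phi> e (z + a *\<^sub>R v + b *\<^sub>R w) \<xi>" and Hb = "\<lambda>a b. dd w \<phi> e (z + a *\<^sub>R v + b *\<^sub>R w) \<xi>"
           and Hab = "\<lambda>a b. dd w (dd v \<phi>) e (z + a *\<^sub>R v + b *\<^sub>R w) \<xi>" and Hba = "\<lambda>a b. dd v (dd w \<phi>) e (z + a *\<^sub>R v + b *\<^sub>R w) \<xi>"])
        fix a b assume ab: "\<bar>a\<bar> < d / 3" "\<bar>b\<bar> < d / 3"
        have P: "?P (e, z + a *\<^sub>R v + b *\<^sub>R w)" using d(2) near[OF ab] elim d(1) by auto
        show "((\<lambda>a. \<phi> e (z + a *\<^sub>R v + b *\<^sub>R w) \<xi>) has_real_derivative dd v \<phi> e (z + a *\<^sub>R v + b *\<^sub>R w) \<xi>) (at a)"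
          using P unfolding swap by (auto intro: DERIV_ray)
        show "((\<lambda>a. dd w \<phi> e (z + a *\<^sub>R v + b *\<^sub>R w) \<xi>) has_real_derivative dd v (dd w \<phi>) e (z + a *\<^sub>R v + b *\<^sub>R w) \<xi>) (at a)"
          using P unfolding swap by (auto intro: DERIV_ray)
        show "((\<lambda>b. \<phi> e (z + a *\<^sub>R v + b *\<^sub>R w) \<xi>) has_real_derivative dd w \<phi> e (z + a *\<^sub>R v + b *\<^sub>R w) \<xi>) (at b)"
          using P by (auto intro: DERIV_ray)
        show "((\<lambda>b. dd v \<phi> e (z + a *\<^sub>R v + b *\<^sub>R w) \<xi>) has_real_derivative dd w (dd v \<phi>) e (z + a *\<^sub>R v + b *\<^sub>R w) \<xi>) (at b)"
          using P by (auto intro: DERIV_ray)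
      qed (use d elim in auto)
      then show ?thesis by simp
    qed
    then show ?case by simp
  qed
qed

lemma dd_cong:
  assumes "of_order P r \<phi>" "v \<in> Basis" and "agree \<phi> \<psi>"
  shows "agree (dd v \<phi>) (dd v \<psi>)"
proof -
  have "has_dd v \<psi> (dd v \<phi>)"
    by (rule has_dd_cong[OF of_order_has_dd[OF assms(1,2)] assms(3)]) (auto intro: always_eventually)
  from has_dd_imp_dd[OF this] show ?thesis by eventually_elim auto
qed

lemma dd_iter_commute:
  assumes \<phi>: "of_order P r \<phi>" "0 \<in> P" and vw: "v \<in> Basis" "w \<in> Basis"
  shows "\<forall>\<^sub>F (e, z) in \<G>. \<forall>\<xi>. dd w ((dd v ^^ m) \<phi>) e z \<xi> = (dd v ^^ m) (dd w \<phi>) e z \<xi>"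
proof (induction m)
  case (Suc m)
  have "\<forall>\<^sub>F (e, z) in \<G>. \<forall>\<xi>. dd v (dd w ((dd v ^^ m) \<phi>)) e z \<xi> = dd v ((dd v ^^ m) (dd w \<phi>)) e z \<xi>"
    by (rule dd_cong[OF of_order_dd[OF of_order_dd_iter[OF \<phi>(1) vw(1)] vw(2)] vw(1) Suc.IH])
  with dd_commute[OF of_order_dd_iter[OF \<phi>(1) vw(1)] \<phi>(2) vw, of m] show ?case
    by eventually_elim auto
qed (auto intro: always_eventually)

definition taylor_rem :: "'a \<Rightarrow> nat \<Rightarrow> (real \<Rightarrow> real) \<Rightarrow> (real \<Rightarrow> 'a \<Rightarrow> real \<Rightarrow> real) \<Rightarrow> real \<Rightarrow> 'a \<Rightarrow> real \<Rightarrow> real" where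
  "taylor_rem v n p \<phi> e z \<xi> =
     \<phi> e (z + p e *\<^sub>R v) \<xi> - (\<Sum>m<n. (dd v ^^ m) \<phi> e z \<xi> / fact m * p e ^ m)"

lemma wbound_taylor_rem:
  assumes \<phi>: "of_order P r \<phi>" and v: "v \<in> Basis" and p: "(p \<longlongrightarrow> 0) (at_right 0)"
  shows "wbound P (\<lambda>e. p e ^ n * r e) (taylor_rem v n p \<phi>)"
  unfolding wbound_def
proof (intro conjI ballI)
  fix q assume "q \<in> P"
  then obtain C where C: "weighted_le q C r ((dd v ^^ n) \<phi>)"
    using of_order_wbound[OF of_order_dd_iter[OF \<phi> v]] unfolding wbound_def by blast
  have "\<forall>m\<in>{..<n}. \<forall>\<^sub>F (e, z) in \<G>. \<forall>\<xi>. 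
     ((\<lambda>y. (dd v ^^ m) \<phi> e (z + y *\<^sub>R v) \<xi>) has_real_derivative (dd v ^^ Suc m) \<phi> e z \<xi>) (at 0)"
    using of_order_has_dd[OF of_order_dd_iter[OF \<phi> v] v] unfolding has_dd_def by simp
  then have "\<forall>\<^sub>F ez in \<G>. \<forall>m\<in>{..<n}. (\<lambda>(e, z). \<forall>\<xi>. 
     ((\<lambda>y. (dd v ^^ m) \<phi> e (z + y *\<^sub>R v) \<xi>) has_real_derivative (dd v ^^ Suc m) \<phi> e z \<xi>) (at 0)) ez"
    by (subst eventually_ball_finite_distrib) auto
  from eventually_germ_segment[OF eventually_conj[OF C this] p, of v]
  have "weighted_le q C (\<lambda>e. p e ^ n * r e) (taylor_rem v n p \<phi>)"
  proof eventually_elim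
    case (elim ez)
    obtain e z where [simp]: "ez = (e, z)" by (cases ez)
    have "\<bar>\<xi>\<bar> ^ q * \<bar>taylor_rem v n p \<phi> e z \<xi>\<bar> \<le> C * \<bar>p e ^ n * r e\<bar>" for \<xi>
    proof -
      have "\<bar>\<bar>\<xi>\<bar>^q * (dd v ^^ 0) \<phi> e (z + p e *\<^sub>R v) \<xi>
         - (\<Sum>m<n. \<bar>\<xi>\<bar>^q * (dd v ^^ m) \<phi> e (z + 0 *\<^sub>R v) \<xi> / fact m * p e ^ m)\<bar> \<le> (C * \<bar>r e\<bar>) * \<bar>p e\<bar> ^ n"
      proof (rule Taylor_remainder_le[where D = "\<lambda>m y. \<bar>\<xi>\<bar>^q * (dd v ^^ m) \<phi> e (z + y *\<^sub>R v) \<xi>"])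
        fix m y assume "m < n" "\<bar>y\<bar> \<le> \<bar>p e\<bar>"
        then have "((\<lambda>y'. (dd v ^^ m) \<phi> e (z + y *\<^sub>R v + y' *\<^sub>R v) \<xi>) has_real_derivative (dd v ^^ Suc m) \<phi> e (z + y *\<^sub>R v) \<xi>) (at 0)"
          using elim by auto
        from DERIV_cmult[OF DERIV_ray[OF this]]
        show "((\<lambda>y. \<bar>\<xi>\<bar>^q * (dd v ^^ m) \<phi> e (z + y *\<^sub>R v) \<xi>) has_real_derivative \<bar>\<xi>\<bar>^q * (dd v ^^ Suc m) \<phi> e (z + y *\<^sub>R v) \<xi>) (at y)" .
      qed (use elim in \<open>auto simp: abs_mult power_abs\<close>)
      also have "\<bar>\<xi>\<bar>^q * (dd v ^^ 0) \<phi> e (z + p e *\<^sub>R v) \<xi>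
         - (\<Sum>m<n. \<bar>\<xi>\<bar>^q * (dd v ^^ m) \<phi> e (z + 0 *\<^sub>R v) \<xi> / fact m * p e ^ m) = \<bar>\<xi>\<bar>^q * taylor_rem v n p \<phi> e z \<xi>"
        by (simp add: taylor_rem_def right_diff_distrib sum_distrib_left mult.assoc)
      finally show ?thesis by (simp add: abs_mult power_abs mult_ac)
    qed
    then show ?case by simp
  qed
  then show "\<exists>C. weighted_le q C (\<lambda>e. p e ^ n * r e) (taylor_rem v n p \<phi>)" by blast
next
  have "near_measurable ((dd v ^^ m) \<phi>)" for m
    using of_order_wbound[OF of_order_dd_iter[OF \<phi> v]] unfolding wbound_def by simp
  then have 1: "\<forall>\<^sub>F ez in \<G>. \<forall>m\<in>{..<n}. (\<lambda>(e, z). (dd v ^^ m) \<phi> e z \<in> borel_measurable borel) ez"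
    by (subst eventually_ball_finite_distrib) auto
  have "\<forall>\<^sub>F (e, z) in \<G>. \<phi> e (z + p e *\<^sub>R v) \<in> borel_measurable borel"
    using wbound_shift[OF of_order_wbound[OF \<phi>] p] by (simp add: wbound_def)
  with 1 show "near_measurable (taylor_rem v n p \<phi>)"
    unfolding taylor_rem_def[abs_def]
    by eventually_elim (auto intro!: borel_measurable_diff borel_measurable_sum borel_measurable_times borel_measurable_divide simp del: times_divide_eq_left)
qed

text \<open>A derivative of the remainder is the remainder of the derivative, because directional derivatives
commute. Hence the pointwise Lagrange estimate for all families of the class estimates all derivatives
of the remainder.\<close>

lemma of_order_taylor_rem:
  assumes \<phi>: "of_order P r \<phi>" and P: "0 \<in> P" and v: "v \<in> Basis" and p: "(p \<longlongrightarrow> 0) (at_right 0)"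
  shows "of_order P (\<lambda>e. p e ^ n * r e) (taylor_rem v n p \<phi>)"
proof (rule of_orderI[where X = "\<lambda>\<psi>. \<exists>\<phi>. of_order P r \<phi> \<and> (\<forall>\<^sub>F (e, z) in \<G>. \<forall>\<xi>. taylor_rem v n p \<phi> e z \<xi> = \<psi> e z \<xi>)"])
  fix \<psi> and w :: 'a
  assume "\<exists>\<phi>. of_order P r \<phi> \<and> (\<forall>\<^sub>F (e, z) in \<G>. \<forall>\<xi>. taylor_rem v n p \<phi> e z \<xi> = \<psi> e z \<xi>)"
  then obtain \<phi> where \<phi>: "of_order P r \<phi>" and \<psi>: "agree (taylor_rem v n p \<phi>) \<psi>" by blast
  show "wbound P (\<lambda>e. p e ^ n * r e) \<psi>"
    by (rule wbound_cong[OF wbound_taylor_rem[OF \<phi> v p] \<psi>])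
  assume w: "w \<in> Basis"
  have "\<forall>m\<in>{..<n}. \<forall>\<^sub>F (e, z) in \<G>. \<forall>\<xi>. 
     ((\<lambda>y. (dd v ^^ m) \<phi> e (z + y *\<^sub>R w) \<xi>) has_real_derivative dd w ((dd v ^^ m) \<phi>) e z \<xi>) (at 0)"
    using of_order_has_dd[OF of_order_dd_iter[OF \<phi> v] w] unfolding has_dd_def by simp
  then have 1: "\<forall>\<^sub>F ez in \<G>. \<forall>m\<in>{..<n}. (\<lambda>(e, z). \<forall>\<xi>. 
     ((\<lambda>y. (dd v ^^ m) \<phi> e (z + y *\<^sub>R w) \<xi>) has_real_derivative dd w ((dd v ^^ m) \<phi>) e z \<xi>) (at 0)) ez"
    by (subst eventually_ball_finite_distrib) auto
  have "\<forall>m\<in>{..<n}. \<forall>\<^sub>F (e, z) in \<G>. \<forall>\<xi>. dd w ((dd v ^^ m) \<phi>) e z \<xi> = (dd v ^^ m) (dd w \<phi>) e z \<xi>"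
    using dd_iter_commute[OF \<phi> P v w] by simp
  then have 2: "\<forall>\<^sub>F ez in \<G>. \<forall>m\<in>{..<n}. (\<lambda>(e, z). \<forall>\<xi>. dd w ((dd v ^^ m) \<phi>) e z \<xi> = (dd v ^^ m) (dd w \<phi>) e z \<xi>) ez"
    by (subst eventually_ball_finite_distrib) auto
  have "has_dd w (taylor_rem v n p \<phi>) (taylor_rem v n p (dd w \<phi>))"
    unfolding has_dd_def
    using 1 2 has_dd_shift[OF of_order_has_dd[OF \<phi> w] p, of v, unfolded has_dd_def]
    by eventually_elim
       (auto simp: taylor_rem_def algebra_simps intro!: derivative_eq_intros sum.cong)
  then have "has_dd w \<psi> (taylor_rem v n p (dd w \<phi>))"
    by (rule has_dd_cong[OF _ \<psi>]) (auto intro: always_eventually)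
  then show "\<exists>\<theta>. has_dd w \<psi> \<theta> \<and> (\<exists>\<phi>. of_order P r \<phi> \<and> (\<forall>\<^sub>F (e, z) in \<G>. \<forall>\<xi>. taylor_rem v n p \<phi> e z \<xi> = \<theta> e z \<xi>))"
    using of_order_dd[OF \<phi> w]
    by (intro exI[of _ "taylor_rem v n p (dd w \<phi>)"] conjI exI[of _ "dd w \<phi>"]) (auto intro: always_eventually)
next
  show "\<exists>\<phi>'. of_order P r \<phi>' \<and> (\<forall>\<^sub>F (e, z) in \<G>. \<forall>\<xi>. taylor_rem v n p \<phi>' e z \<xi> = taylor_rem v n p \<phi> e z \<xi>)"
    using \<phi> by (auto intro!: exI[of _ \<phi>] always_eventually)
qed

end

section \<open>Maxwellians\<close>

text \<open>Completing the square reduces Gaussian decay to exponential decay.\<close>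

lemma exp_minus_square_le:
  fixes T :: real
  assumes "0 < T"
  shows "exp (- y\<^sup>2 / T) \<le> exp (T / 4) * exp (- \<bar>y\<bar>)"
proof -
  have "0 \<le> (\<bar>y\<bar> - T / 2)\<^sup>2" by simp
  then have "\<bar>y\<bar> * T \<le> y\<^sup>2 + T\<^sup>2 / 4" by (simp add: power2_diff power2_eq_square algebra_simps)
  then have "- y\<^sup>2 / T \<le> T / 4 - \<bar>y\<bar>"
    using assms by (simp add: field_simps power2_eq_square)
  then show ?thesis by (simp add: exp_add[symmetric])
qed

lemma power_le_fact_exp: "0 \<le> x \<Longrightarrow> x ^ p \<le> fact p * exp (x::real)"
proof -
  assume x: "0 \<le> x"
  obtain t where t: "exp x = (\<Sum>m<Suc p. x ^ m / fact m) + exp t / fact (Suc p) * x ^ Suc p"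
    using Maclaurin_exp_le[of x "Suc p"] by blast
  have "x ^ p / fact p \<le> (\<Sum>m<Suc p. x ^ m / fact m)"
    by (rule member_le_sum) (use x in auto)
  also have "\<dots> \<le> exp x" unfolding t using x by (simp del: sum.lessThan_Suc)
  finally show ?thesis by (simp add: field_simps)
qed

text \<open>Uniformly in a bounded centre \<open>u\<close>, a Gaussian beats every polynomial. The factor \<open>1 + \<bar>\<xi> - u\<bar>\<close> covers
both the Gaussian and its derivative with respect to \<open>u\<close>.\<close>

lemma gaussian_decay:
  fixes T B :: real
  assumes "0 < T"
  shows "\<exists>C. \<forall>\<xi> u. \<bar>u\<bar> \<le> B \<longrightarrow> \<bar>\<xi>\<bar> ^ p * ((1 + \<bar>\<xi> - u\<bar>) * exp (- (\<xi> - u)\<^sup>2 / T)) \<le> C"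
proof (intro exI allI impI)
  fix \<xi> u :: real assume u: "\<bar>u\<bar> \<le> B"
  \<comment> \<open>Both \<open>\<bar>\<xi>\<bar>\<close> and \<open>1 + \<bar>\<xi> - u\<bar>\<close> are at most \<open>s\<close>.\<close>
  define s where "s = 1 + \<bar>\<xi> - u\<bar> + B"
  have B: "0 \<le> B" using u by linarith
  have "\<bar>\<xi>\<bar> ^ p * (1 + \<bar>\<xi> - u\<bar>) \<le> s ^ p * s"
    by (intro mult_mono power_mono) (use u B in \<open>auto simp: s_def\<close>)
  also have "\<dots> = s ^ Suc p" by simp
  also have "\<dots> \<le> fact (Suc p) * exp s" by (rule power_le_fact_exp) (use B in \<open>simp add: s_def\<close>)
  finally have poly: "\<bar>\<xi>\<bar> ^ p * (1 + \<bar>\<xi> - u\<bar>) \<le> fact (Suc p) * exp s" .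
  have "\<bar>\<xi>\<bar> ^ p * (1 + \<bar>\<xi> - u\<bar>) * exp (- (\<xi> - u)\<^sup>2 / T)
      \<le> (fact (Suc p) * exp s) * (exp (T / 4) * exp (- \<bar>\<xi> - u\<bar>))"
    by (rule mult_mono[OF poly exp_minus_square_le[OF assms]]) auto
  also have "\<dots> = fact (Suc p) * exp (T / 4) * exp (1 + B)"
    by (simp add: s_def exp_add exp_minus field_simps)
  finally show "\<bar>\<xi>\<bar> ^ p * ((1 + \<bar>\<xi> - u\<bar>) * exp (- (\<xi> - u)\<^sup>2 / T)) \<le> fact (Suc p) * exp (T / 4) * exp (1 + B)"
    by (simp add: mult.assoc)
qed

context germ
begin

lemma of_order_Taylor1:
  assumes "of_order P r \<phi>" "0 \<in> P" "v \<in> Basis" "(p \<longlongrightarrow> 0) (at_right 0)"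
  shows "of_order P (\<lambda>e. p e * r e) (\<lambda>e z \<xi>. \<phi> e (z + p e *\<^sub>R v) \<xi> - \<phi> e z \<xi>)"
  using of_order_taylor_rem[OF assms, of 1] by (simp add: taylor_rem_def[abs_def])

lemma of_order_Taylor2:
  assumes "of_order P r \<phi>" "0 \<in> P" "v \<in> Basis" "(p \<longlongrightarrow> 0) (at_right 0)"
  shows "of_order P (\<lambda>e. (p e)\<^sup>2 * r e)
    (\<lambda>e z \<xi>. \<phi> e (z + p e *\<^sub>R v) \<xi> - \<phi> e z \<xi> - p e * dd v \<phi> e z \<xi>)"
proof -
  have "of_order P (\<lambda>e. (p e)\<^sup>2 * r e) (taylor_rem v 2 p \<phi>)" by (rule of_order_taylor_rem[OF assms])
  then show ?thesis
    by (rule of_order_cong) (auto intro!: always_eventually simp: taylor_rem_def numeral_2_eq_2)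
qed

lemma of_order_Taylor3:
  assumes "of_order P r \<phi>" "0 \<in> P" "v \<in> Basis" "(p \<longlongrightarrow> 0) (at_right 0)"
  shows "of_order P (\<lambda>e. p e ^ 3 * r e)
    (\<lambda>e z \<xi>. \<phi> e (z + p e *\<^sub>R v) \<xi> - \<phi> e z \<xi> - p e * dd v \<phi> e z \<xi>
       - (p e)\<^sup>2 / 2 * dd v (dd v \<phi>) e z \<xi>)"
proof -
  have "of_order P (\<lambda>e. p e ^ 3 * r e) (taylor_rem v 3 p \<phi>)" by (rule of_order_taylor_rem[OF assms])
  then show ?thesis
    by (rule of_order_cong) (auto intro!: always_eventually simp: taylor_rem_def eval_nat_numeral)
qed

lemma order_upto_mult1:
  "order_upto P r k \<phi> \<Longrightarrow> order_upto {0} (\<lambda>_. 1) k \<psi> \<Longrightarrow> order_upto P r k (\<phi> \<otimes> \<psi>)"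
  using order_upto_mult[of P r k \<phi> "\<lambda>_. 1" \<psi>] by simp

lemma of_order_const: "hyd (\<lambda>_. 1) (\<lambda>e z \<xi>. c)"
  using of_order_cmult[OF of_order_param[of "\<lambda>_. 1"], of c] by simp

lemma order_upto_cmult: "order_upto P r k \<phi> \<Longrightarrow> order_upto P r k ((\<lambda>_. c) \<odot> \<phi>)"
  using order_upto_mult1[OF _ of_orderD[OF of_order_const], of P r k \<phi> c] by (simp add: mult.commute)

lemma order_upto_diff:
  "order_upto P r k \<phi> \<Longrightarrow> order_upto P r k \<psi> \<Longrightarrow> order_upto P r k (\<phi> \<ominus> \<psi>)"
  using order_upto_add[OF _ order_upto_cmult[where c = "-1"], of P r k \<phi> \<psi>] by simp

lemma order_upto_times_xi:
  "order_upto UNIV r k \<phi> \<Longrightarrow> order_upto UNIV r k (xi \<phi>)"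
proof (induction k arbitrary: \<phi>)
  case (Suc k)
  show ?case unfolding order_upto.simps
  proof (intro conjI ballI)
    show "wbound UNIV r (xi \<phi>)" using Suc.prems by (auto intro: wbound_times_xi)
    fix v :: 'a assume "v \<in> Basis"
    then obtain \<phi>' where \<phi>': "has_dd v \<phi> \<phi>'" "order_upto UNIV r k \<phi>'" using Suc.prems by auto
    have "has_dd v (xi \<phi>) (xi \<phi>')"
      using has_dd_mult[OF has_dd_param \<phi>'(1), of "\<lambda>e \<xi>. \<xi>"] by simp
    then show "\<exists>\<psi>. has_dd v (xi \<phi>) \<psi> \<and> order_upto UNIV r k \<psi>"
      using Suc.IH[OF \<phi>'(2)] by blast
  qed
qed (auto intro: wbound_times_xi)

text \<open>Up to sign, the derivative of \<open>1 / \<rho>\<close> is the derivative of \<open>\<rho>\<close> times two copies of \<open>1 / \<rho>\<close>, so a lower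
bound on \<open>\<rho>\<close> propagates through all orders of differentiation.\<close>

lemma of_order_inverse:
  assumes \<rho>: "hyd (\<lambda>_. 1) \<rho>" and "0 < c" and pos: "\<forall>\<^sub>F (e, z) in \<G>. \<forall>\<xi>. c \<le> \<rho> e z \<xi>"
  shows "hyd (\<lambda>_. 1) (\<lambda>e z \<xi>. 1 / \<rho> e z \<xi>)"
proof -
  have nz: "\<forall>\<^sub>F (e, z) in \<G>. \<forall>\<xi>. \<rho> e z \<xi> \<noteq> 0"
    using pos by eventually_elim (use \<open>0 < c\<close> in \<open>auto, metis not_less\<close>)
  have wb: "wbound {0} (\<lambda>_. 1) (\<lambda>e z \<xi>. 1 / \<rho> e z \<xi>)"
    unfolding wbound_def
  proof (intro conjI ballI)
    have "\<forall>\<^sub>F (e, z) in \<G>. \<forall>\<xi>. \<bar>\<xi>\<bar> ^ 0 * \<bar>1 / \<rho> e z \<xi>\<bar> \<le> 1 / c * \<bar>1\<bar>"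
      using pos
    proof eventually_elim
      case (elim ez)
      obtain e z where [simp]: "ez = (e, z)" by (cases ez)
      have "\<bar>1 / \<rho> e z \<xi>\<bar> \<le> 1 / c" for \<xi>
        using elim \<open>0 < c\<close> by (auto intro!: divide_left_mono simp: abs_if dest!: spec[of _ \<xi>])
      then show ?case by simp
    qed
    then show "\<exists>C. weighted_le p C (\<lambda>_. 1) (\<lambda>e z \<xi>. 1 / \<rho> e z \<xi>)" if "p \<in> {0}" for p
      using that by (intro exI[of _ "1 / c"]) simp
    have "near_measurable \<rho>" using of_order_wbound[OF \<rho>] by (simp add: wbound_def)
    then show "near_measurable (\<lambda>e z \<xi>. 1 / \<rho> e z \<xi>)"
      by eventually_elim auto
  qed
  have "order_upto {0} (\<lambda>_. 1) k (\<lambda>e z \<xi>. 1 / \<rho> e z \<xi>)" for k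
  proof (induction k)
    case (Suc k)
    show ?case unfolding order_upto.simps
    proof (intro conjI ballI wb)
      fix v :: 'a assume v: "v \<in> Basis"
      have "has_dd v (\<lambda>e z \<xi>. 1 / \<rho> e z \<xi>) (\<lambda>e z \<xi>. - 1 * (dd v \<rho> e z \<xi> * (1 / \<rho> e z \<xi> * (1 / \<rho> e z \<xi>))))"
        using of_order_has_dd[OF \<rho> v] nz unfolding has_dd_def
        by eventually_elim (auto intro!: derivative_eq_intros simp: power2_eq_square)
      moreover have "order_upto {0} (\<lambda>_. 1) k (\<lambda>e z \<xi>. - 1 * (dd v \<rho> e z \<xi> * (1 / \<rho> e z \<xi> * (1 / \<rho> e z \<xi>))))"
        by (intro order_upto_cmult order_upto_mult1 Suc of_orderD[OF of_order_dd[OF \<rho> v]])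
      ultimately show "\<exists>\<psi>. has_dd v (\<lambda>e z \<xi>. 1 / \<rho> e z \<xi>) \<psi> \<and> order_upto {0} (\<lambda>_. 1) k \<psi>" by blast
    qed
  qed (use wb in simp)
  then show ?thesis unfolding of_order_def by blast
qed

definition gauss :: "real \<Rightarrow> (real \<Rightarrow> 'a \<Rightarrow> real \<Rightarrow> real) \<Rightarrow> real \<Rightarrow> 'a \<Rightarrow> real \<Rightarrow> real" where
  "gauss T u e z \<xi> = exp (- (\<xi> - u e z \<xi>)\<^sup>2 / T)"

lemma has_dd_gauss:
  assumes "has_dd v u u'" "T \<noteq> 0"
  shows "has_dd v (gauss T u) ((\<lambda>_. 2 / T) \<odot> (xi (gauss T u \<otimes> u') \<ominus> gauss T u \<otimes> (u \<otimes> u')))"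
  using assms(1) unfolding has_dd_def
  by eventually_elim (use assms(2) in \<open>auto simp: gauss_def intro!: derivative_eq_intros, auto simp: field_simps\<close>)

lemma measurable_gauss:
  assumes "hyd r u"
  shows "near_measurable (gauss T u)"
proof -
  have "near_measurable u" using of_order_wbound[OF assms] by (simp add: wbound_def)
  then show ?thesis unfolding gauss_def[abs_def] by eventually_elim auto
qed

text \<open>Differentiating a Gaussian multiplies it by a polynomial in the velocity with bounded coefficients,
and the weights absorb the powers of the velocity.\<close>

lemma of_order_gauss:
  assumes u: "hyd (\<lambda>_. 1) u" and T: "0 < T"
  shows "kin (\<lambda>_. 1) (gauss T u)"
proof -
  obtain B where B: "weighted_le 0 B (\<lambda>_. 1) u"
    using of_order_wbound[OF u] unfolding wbound_def by blast
  have wb: "wbound UNIV (\<lambda>_. 1) (gauss T u)"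
    unfolding wbound_def
  proof (intro conjI ballI measurable_gauss[OF u])
    fix p
    obtain C where C: "\<And>\<xi> u. \<bar>u\<bar> \<le> B \<Longrightarrow> \<bar>\<xi>\<bar> ^ p * ((1 + \<bar>\<xi> - u\<bar>) * exp (- (\<xi> - u)\<^sup>2 / T)) \<le> C"
      using gaussian_decay[OF T] by blast
    have C': "\<bar>\<xi>\<bar> ^ p * exp (- (\<xi> - u)\<^sup>2 / T) \<le> C" if "\<bar>u\<bar> \<le> B" for \<xi> u
    proof (rule order_trans[OF _ C[OF that, of \<xi>]])
      show "\<bar>\<xi>\<bar> ^ p * exp (- (\<xi> - u)\<^sup>2 / T) \<le> \<bar>\<xi>\<bar> ^ p * ((1 + \<bar>\<xi> - u\<bar>) * exp (- (\<xi> - u)\<^sup>2 / T))"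
        by (intro mult_left_mono) (auto simp: distrib_right)
    qed
    have "weighted_le p C (\<lambda>_. 1) (gauss T u)"
      using B by eventually_elim (use C' in \<open>auto simp: gauss_def\<close>)
    then show "\<exists>C. weighted_le p C (\<lambda>_. 1) (gauss T u)" by blast
  qed
  have "order_upto UNIV (\<lambda>_. 1) k (gauss T u)" for k
  proof (induction k)
    case (Suc k)
    show ?case unfolding order_upto.simps
    proof (intro conjI ballI wb)
      fix v :: 'a assume v: "v \<in> Basis"
      have "order_upto UNIV (\<lambda>_. 1) k ((\<lambda>_. 2 / T) \<odot> (xi (gauss T u \<otimes> dd v u) \<ominus> gauss T u \<otimes> (u \<otimes> dd v u)))"
        by (intro order_upto_cmult order_upto_diff order_upto_times_xi order_upto_mult1 Suc of_orderD[OF of_order_dd[OF u v]] of_orderD[OF u])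
      then show "\<exists>\<psi>. has_dd v (gauss T u) \<psi> \<and> order_upto UNIV (\<lambda>_. 1) k \<psi>"
        using has_dd_gauss[OF of_order_has_dd[OF u v] less_imp_neq[OF T, symmetric]] by blast
    qed
  qed (use wb in simp)
  then show ?thesis unfolding of_order_def by blast
qed

lemma gauss_diff_le:
  fixes T :: real
  assumes "0 < T"
    and C: "\<And>\<xi> u. \<bar>u\<bar> \<le> B \<Longrightarrow> \<bar>\<xi>\<bar> ^ p * ((1 + \<bar>\<xi> - u\<bar>) * exp (- (\<xi> - u)\<^sup>2 / T)) \<le> C"
    and u: "\<bar>u1\<bar> \<le> B" "\<bar>u2\<bar> \<le> B"
  shows "\<bar>\<xi>\<bar> ^ p * \<bar>exp (- (\<xi> - u1)\<^sup>2 / T) - exp (- (\<xi> - u2)\<^sup>2 / T)\<bar> \<le> 2 * C / T * \<bar>u1 - u2\<bar>"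
proof -
  have "norm (\<bar>\<xi>\<bar> ^ p * exp (- (\<xi> - u1)\<^sup>2 / T) - \<bar>\<xi>\<bar> ^ p * exp (- (\<xi> - u2)\<^sup>2 / T)) \<le> 2 * C / T * norm (u1 - u2)"
  proof (rule field_differentiable_bound[where S = "{-B..B}" and f' = "\<lambda>u. 2 / T * (\<bar>\<xi>\<bar> ^ p * (exp (- (\<xi> - u)\<^sup>2 / T) * (\<xi> - u)))"])
    fix u assume "u \<in> {-B..B}"
    then have "\<bar>u\<bar> \<le> B" by auto
    show "((\<lambda>u. \<bar>\<xi>\<bar> ^ p * exp (- (\<xi> - u)\<^sup>2 / T)) has_field_derivative 2 / T * (\<bar>\<xi>\<bar> ^ p * (exp (- (\<xi> - u)\<^sup>2 / T) * (\<xi> - u)))) (at u within {-B..B})"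
      using assms(1) by (auto intro!: derivative_eq_intros simp: field_simps)
    have "\<bar>\<xi>\<bar> ^ p * (\<bar>\<xi> - u\<bar> * exp (- (\<xi> - u)\<^sup>2 / T)) \<le> \<bar>\<xi>\<bar> ^ p * ((1 + \<bar>\<xi> - u\<bar>) * exp (- (\<xi> - u)\<^sup>2 / T))"
      by (intro mult_left_mono mult_right_mono) auto
    also have "\<dots> \<le> C" by (rule C) fact
    finally have "2 / T * (\<bar>\<xi>\<bar> ^ p * (\<bar>\<xi> - u\<bar> * exp (- (\<xi> - u)\<^sup>2 / T))) \<le> 2 / T * C"
      by (rule mult_left_mono) (use assms(1) in simp)
    moreover have "norm (2 / T * (\<bar>\<xi>\<bar> ^ p * (exp (- (\<xi> - u)\<^sup>2 / T) * (\<xi> - u))))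
        = 2 / T * (\<bar>\<xi>\<bar> ^ p * (\<bar>\<xi> - u\<bar> * exp (- (\<xi> - u)\<^sup>2 / T)))"
      using assms(1) by (simp add: abs_mult mult_ac)
    ultimately show "norm (2 / T * (\<bar>\<xi>\<bar> ^ p * (exp (- (\<xi> - u)\<^sup>2 / T) * (\<xi> - u)))) \<le> 2 * C / T"
      by simp
  qed (use u in auto)
  then show ?thesis by (simp add: abs_mult right_diff_distrib[symmetric])
qed

text \<open>Gaussians depend smoothly on their centre: the derivative of the difference is a combination of the
difference itself and of \<open>u1 - u2\<close> and its derivatives, so the order of \<open>u1 - u2\<close> is inherited by
induction.\<close>

lemma of_order_gauss_diff:
  assumes u1: "hyd (\<lambda>_. 1) u1" and u2: "hyd (\<lambda>_. 1) u2" and T: "0 < T"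
    and du: "hyd r (u1 \<ominus> u2)"
  shows "kin r (gauss T u1 \<ominus> gauss T u2)"
proof -
  let ?g1 = "gauss T u1" and ?g2 = "gauss T u2"
  have T0: "T \<noteq> 0" using T by simp
  obtain B1 where B1: "weighted_le 0 B1 (\<lambda>_. 1) u1"
    using of_order_wbound[OF u1] unfolding wbound_def by blast
  obtain B2 where B2: "weighted_le 0 B2 (\<lambda>_. 1) u2"
    using of_order_wbound[OF u2] unfolding wbound_def by blast
  define B where "B = max B1 B2"
  obtain D where D: "weighted_le 0 D r (u1 \<ominus> u2)"
    using of_order_wbound[OF du] unfolding wbound_def by blast
  have wb: "wbound UNIV r (?g1 \<ominus> ?g2)"
    unfolding wbound_def
  proof (intro conjI ballI)
    show "near_measurable (?g1 \<ominus> ?g2)"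
      using measurable_gauss[OF u1, of T] measurable_gauss[OF u2, of T] by eventually_elim auto
    fix p
    obtain C where C: "\<And>\<xi> u. \<bar>u\<bar> \<le> B \<Longrightarrow> \<bar>\<xi>\<bar> ^ p * ((1 + \<bar>\<xi> - u\<bar>) * exp (- (\<xi> - u)\<^sup>2 / T)) \<le> C"
      using gaussian_decay[OF T] by blast
    have "weighted_le p (2 * \<bar>C\<bar> / T * D) r (?g1 \<ominus> ?g2)"
      using B1 B2 D
    proof eventually_elim
      case (elim ez)
      obtain e z where [simp]: "ez = (e, z)" by (cases ez)
      have "\<bar>\<xi>\<bar> ^ p * \<bar>?g1 e z \<xi> - ?g2 e z \<xi>\<bar> \<le> (2 * \<bar>C\<bar> / T * D) * \<bar>r e\<bar>" for \<xi>
      proof -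
        have b: "\<bar>u1 e z \<xi>\<bar> \<le> B" "\<bar>u2 e z \<xi>\<bar> \<le> B" "\<bar>u1 e z \<xi> - u2 e z \<xi>\<bar> \<le> D * \<bar>r e\<bar>"
          using elim by (auto simp: B_def intro: order_trans[OF _ max.cobounded1] order_trans[OF _ max.cobounded2])
        have "\<bar>\<xi>\<bar> ^ p * \<bar>?g1 e z \<xi> - ?g2 e z \<xi>\<bar> \<le> 2 * C / T * \<bar>u1 e z \<xi> - u2 e z \<xi>\<bar>"
          unfolding gauss_def by (rule gauss_diff_le[OF T C b(1,2)])
        also have "\<dots> \<le> 2 * \<bar>C\<bar> / T * (D * \<bar>r e\<bar>)"
          by (rule mult_mono) (use b(3) T in \<open>auto intro!: divide_right_mono\<close>)
        finally show ?thesis by (simp add: mult.assoc)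
      qed
      then show ?case by simp
    qed
    then show "\<exists>C. weighted_le p C r (?g1 \<ominus> ?g2)" by blast
  qed
  have g2: "order_upto UNIV (\<lambda>_. 1) k ?g2" for k by (rule of_orderD[OF of_order_gauss[OF u2 T]])
  have "order_upto UNIV r k (?g1 \<ominus> ?g2)" for k
  proof (induction k)
    case (Suc k)
    show ?case unfolding order_upto.simps
    proof (intro conjI ballI wb)
      fix v :: 'a assume v: "v \<in> Basis"
      let ?d1 = "dd v u1" and ?d2 = "dd v u2"
      let ?\<Delta> = "\<lambda>e z \<xi>. ?g1 e z \<xi> - ?g2 e z \<xi>" and ?\<delta> = "\<lambda>e z \<xi>. u1 e z \<xi> - u2 e z \<xi>"
      have ddu: "agree (dd v ?\<delta>) (?d1 \<ominus> ?d2)"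
        using has_dd_imp_dd[OF has_dd_add[OF of_order_has_dd[OF u1 v] of_order_has_dd[OF of_order_uminus[OF u2] v]]]
          has_dd_imp_dd[OF has_dd_mult[OF has_dd_param[of v "\<lambda>_ _. -1"] of_order_has_dd[OF u2 v]]]
        by eventually_elim auto
      let ?\<Delta>' = "\<lambda>e z \<xi>. 2 / T * (\<xi> * (?\<Delta> e z \<xi> * ?d1 e z \<xi> + ?g2 e z \<xi> * dd v ?\<delta> e z \<xi>)
          - (?\<Delta> e z \<xi> * (u1 e z \<xi> * ?d1 e z \<xi>)
             + ?g2 e z \<xi> * (dd v ?\<delta> e z \<xi> * u1 e z \<xi> + ?\<delta> e z \<xi> * ?d2 e z \<xi>)))"
      have "has_dd v ?\<Delta> ?\<Delta>'"
        using has_dd_gauss[OF of_order_has_dd[OF u1 v] T0] has_dd_gauss[OF of_order_has_dd[OF u2 v] T0] ddu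
        unfolding has_dd_def
        by eventually_elim (use T in \<open>auto intro!: derivative_eq_intros, auto simp: algebra_simps, auto simp: field_simps\<close>)
      moreover have "order_upto UNIV r k ?\<Delta>'"
      proof -
        note d\<delta> = of_orderD[OF of_order_dd[OF du v], of k] and \<delta> = of_orderD[OF du, of k]
        have 1: "order_upto UNIV r k (?g2 \<otimes> dd v ?\<delta>)"
          using order_upto_mult[OF g2 d\<delta>] by simp
        have "order_upto {0} r k (dd v ?\<delta> \<otimes> u1 \<oplus> ?\<delta> \<otimes> ?d2)"
          by (rule order_upto_add[OF order_upto_mult1[OF d\<delta> of_orderD[OF u1]] order_upto_mult1[OF \<delta> of_orderD[OF of_order_dd[OF u2 v]]]])
        from order_upto_mult[OF g2 this]
        have 2: "order_upto UNIV r k (?g2 \<otimes> (dd v ?\<delta> \<otimes> u1 \<oplus> ?\<delta> \<otimes> ?d2))"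
          by simp
        show ?thesis
          by (intro order_upto_cmult order_upto_diff[OF order_upto_times_xi[OF order_upto_add[OF _ 1]] order_upto_add[OF _ 2]]
              order_upto_mult1[OF Suc] of_orderD[OF of_order_dd[OF u1 v]] order_upto_mult1[OF of_orderD[OF u1]])
      qed
      ultimately show "\<exists>\<psi>. has_dd v ?\<Delta> \<psi> \<and> order_upto UNIV r k \<psi>" by blast
    qed
  qed (use wb in simp)
  then show ?thesis unfolding of_order_def by blast
qed

lemma of_order_mult1:
  "of_order P r \<phi> \<Longrightarrow> hyd (\<lambda>_. 1) \<psi> \<Longrightarrow> of_order P r (\<phi> \<otimes> \<psi>)"
  using of_order_mult[of P r \<phi> "\<lambda>_. 1" \<psi>] by simp

lemma of_order_1mult:
  "of_order P (\<lambda>_. 1) \<phi> \<Longrightarrow> hyd r \<psi> \<Longrightarrow> of_order P r (\<phi> \<otimes> \<psi>)"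
  using of_order_mult[of P "\<lambda>_. 1" \<phi> r \<psi>] by simp

text \<open>The second argument is the momentum \<open>\<rho> u\<close> rather than the velocity, because the momentum is linear in
the distribution function.\<close>

definition maxwell :: "real \<Rightarrow> (real \<Rightarrow> 'a \<Rightarrow> real \<Rightarrow> real) \<Rightarrow> (real \<Rightarrow> 'a \<Rightarrow> real \<Rightarrow> real) \<Rightarrow> real \<Rightarrow> 'a \<Rightarrow> real \<Rightarrow> real" where
  "maxwell T \<rho> m e z \<xi> = maxwellian T (\<rho> e z \<xi>) (m e z \<xi> / \<rho> e z \<xi>) \<xi>"

lemma maxwell_eq_gauss:
  "maxwell T \<rho> m e z \<xi> = 1 / sqrt (pi * T) * (gauss T (\<lambda>e z \<xi>. m e z \<xi> * (1 / \<rho> e z \<xi>)) e z \<xi> * \<rho> e z \<xi>)"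
  by (simp add: maxwell_def maxwellian_def gauss_def gas_constant_def)

lemma of_order_maxwell:
  assumes \<rho>: "hyd (\<lambda>_. 1) \<rho>" and m: "hyd (\<lambda>_. 1) m" and "0 < T"
    and c: "0 < c" "\<forall>\<^sub>F (e, z) in \<G>. \<forall>\<xi>. c \<le> \<rho> e z \<xi>"
  shows "kin (\<lambda>_. 1) (maxwell T \<rho> m)"
  unfolding maxwell_eq_gauss[abs_def]
  by (intro of_order_cmult of_order_mult1[OF _ \<rho>] of_order_gauss of_order_mult1[OF m] of_order_inverse[OF \<rho> c] assms(3))

lemma of_order_maxwell_diff:
  assumes \<rho>1: "hyd (\<lambda>_. 1) \<rho>1" and m1: "hyd (\<lambda>_. 1) m1"
    and \<rho>2: "hyd (\<lambda>_. 1) \<rho>2" and m2: "hyd (\<lambda>_. 1) m2"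
    and T: "0 < T" and c: "0 < c"
    and c1: "\<forall>\<^sub>F (e, z) in \<G>. \<forall>\<xi>. c \<le> \<rho>1 e z \<xi>" and c2: "\<forall>\<^sub>F (e, z) in \<G>. \<forall>\<xi>. c \<le> \<rho>2 e z \<xi>"
    and d\<rho>: "hyd r (\<rho>1 \<ominus> \<rho>2)" and dm: "hyd r (m1 \<ominus> m2)"
  shows "kin r (maxwell T \<rho>1 m1 \<ominus> maxwell T \<rho>2 m2)"
proof -
  let ?u1 = "\<lambda>e z \<xi>. m1 e z \<xi> * (1 / \<rho>1 e z \<xi>)" and ?u2 = "\<lambda>e z \<xi>. m2 e z \<xi> * (1 / \<rho>2 e z \<xi>)"
  note i1 = of_order_inverse[OF \<rho>1 c c1] and i2 = of_order_inverse[OF \<rho>2 c c2]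
  have u1: "hyd (\<lambda>_. 1) ?u1" and u2: "hyd (\<lambda>_. 1) ?u2"
    by (intro of_order_mult1 m1 m2 i1 i2)+
  have "hyd r (\<lambda>e z \<xi>. (m1 e z \<xi> - m2 e z \<xi>) * (1 / \<rho>1 e z \<xi>) -
      (\<rho>1 e z \<xi> - \<rho>2 e z \<xi>) * (m2 e z \<xi> * (1 / \<rho>1 e z \<xi> * (1 / \<rho>2 e z \<xi>))))"
    by (intro of_order_diff of_order_mult1[OF dm] of_order_mult1[OF d\<rho>] of_order_mult1 i1 i2 m2)
  moreover have "\<forall>\<^sub>F (e, z) in \<G>. \<forall>\<xi>. (m1 e z \<xi> - m2 e z \<xi>) * (1 / \<rho>1 e z \<xi>) -
      (\<rho>1 e z \<xi> - \<rho>2 e z \<xi>) * (m2 e z \<xi> * (1 / \<rho>1 e z \<xi> * (1 / \<rho>2 e z \<xi>))) = ?u1 e z \<xi> - ?u2 e z \<xi>"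
    using c1 c2
  proof eventually_elim
    case (elim ez)
    obtain e z where [simp]: "ez = (e, z)" by (cases ez)
    have "\<rho>1 e z \<xi> \<noteq> 0 \<and> \<rho>2 e z \<xi> \<noteq> 0" for \<xi>
      using elim c by (auto dest!: spec[of _ \<xi>])
    then show ?case by (simp add: field_simps)
  qed
  ultimately have "hyd r (?u1 \<ominus> ?u2)" by (rule of_order_cong)
  from of_order_gauss_diff[OF u1 u2 T this]
  have "kin r ((\<lambda>_. 1 / sqrt (pi * T)) \<odot> ((gauss T ?u1 \<ominus> gauss T ?u2) \<otimes> \<rho>1 \<oplus> gauss T ?u2 \<otimes> (\<rho>1 \<ominus> \<rho>2)))"
    by (intro of_order_cmult of_order_add of_order_mult1[OF _ \<rho>1] of_order_1mult[OF of_order_gauss[OF u2 T] d\<rho>])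
  then show ?thesis
    by (rule of_order_cong) (auto intro!: always_eventually simp: maxwell_eq_gauss algebra_simps)
qed

section \<open>Velocity moments\<close>

definition moment :: "(real \<Rightarrow> 'a \<Rightarrow> real \<Rightarrow> real) \<Rightarrow> real \<Rightarrow> 'a \<Rightarrow> real \<Rightarrow> real" where
  "moment \<phi> e z \<xi> = (LINT \<eta>|lborel. \<phi> e z \<eta>)"

lemma of_order_integrable_weight:
  assumes "kin r \<phi>"
  shows "\<exists>C. \<forall>\<^sub>F (e, z) in \<G>. \<forall>\<xi>. \<bar>\<phi> e z \<xi>\<bar> \<le> C * \<bar>r e\<bar> * (1 / (1 + \<xi>\<^sup>2))"
proof -
  have "\<forall>p. \<exists>C. weighted_le p C r \<phi>"
    using of_order_wbound[OF assms] unfolding wbound_def by blast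
  then obtain C0 C2 where "weighted_le 0 C0 r \<phi>"
    "weighted_le 2 C2 r \<phi>" by blast
  then have "\<forall>\<^sub>F (e, z) in \<G>. \<forall>\<xi>. \<bar>\<phi> e z \<xi>\<bar> \<le> (C0 + C2) * \<bar>r e\<bar> * (1 / (1 + \<xi>\<^sup>2))"
  proof eventually_elim
    case (elim ez)
    obtain e z where [simp]: "ez = (e, z)" by (cases ez)
    have "\<bar>\<phi> e z \<xi>\<bar> \<le> (C0 + C2) * \<bar>r e\<bar> * (1 / (1 + \<xi>\<^sup>2))" for \<xi>
    proof -
      have "(1 + \<xi>\<^sup>2) * \<bar>\<phi> e z \<xi>\<bar> \<le> (C0 + C2) * \<bar>r e\<bar>"
        using elim by (simp add: distrib_right add_mono)
      moreover have "0 < 1 + \<xi>\<^sup>2" by (simp add: add_pos_nonneg)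
      ultimately show ?thesis by (simp add: field_simps)
    qed
    then show ?case by simp
  qed
  then show ?thesis by blast
qed

lemma of_order_integrable:
  assumes "kin r \<phi>"
  shows "\<forall>\<^sub>F (e, z) in \<G>. integrable lborel (\<phi> e z)"
proof -
  obtain C where C: "\<forall>\<^sub>F (e, z) in \<G>. \<forall>\<xi>. \<bar>\<phi> e z \<xi>\<bar> \<le> C * \<bar>r e\<bar> * (1 / (1 + \<xi>\<^sup>2))"
    using of_order_integrable_weight[OF assms] by blast
  have "near_measurable \<phi>"
    using of_order_wbound[OF assms] by (simp add: wbound_def)
  with C show ?thesis
  proof eventually_elim
    case (elim ez)
    obtain e z where [simp]: "ez = (e, z)" by (cases ez)
    have "integrable lborel (\<phi> e z)"
    proof (rule Bochner_Integration.integrable_bound)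
      show "integrable lborel (\<lambda>\<xi>. C * \<bar>r e\<bar> * (1 / (1 + \<xi>\<^sup>2)))"
        by (intro integrable_mult_right integrable_inverse_square_weight)
      show "AE \<xi> in lborel. norm (\<phi> e z \<xi>) \<le> norm (C * \<bar>r e\<bar> * (1 / (1 + \<xi>\<^sup>2)))"
      proof (intro always_eventually allI)
        fix \<xi>
        have "norm (\<phi> e z \<xi>) \<le> C * \<bar>r e\<bar> * (1 / (1 + \<xi>\<^sup>2))" using elim by simp
        also have "\<dots> \<le> norm \<dots>" unfolding real_norm_def by (rule abs_ge_self)
        finally show "norm (\<phi> e z \<xi>) \<le> norm (C * \<bar>r e\<bar> * (1 / (1 + \<xi>\<^sup>2)))" .
      qed
    qed (use elim in simp)
    then show ?case by simp
  qed
qed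

lemma wbound_moment:
  assumes "kin r \<phi>"
  shows "wbound {0} r (moment \<phi>)"
  unfolding wbound_def
proof (intro conjI ballI)
  show "near_measurable (moment \<phi>)"
    unfolding moment_def[abs_def] by (rule always_eventually) auto
  obtain C where C: "\<forall>\<^sub>F (e, z) in \<G>. \<forall>\<xi>. \<bar>\<phi> e z \<xi>\<bar> \<le> C * \<bar>r e\<bar> * (1 / (1 + \<xi>\<^sup>2))"
    using of_order_integrable_weight[OF assms] by blast
  let ?K = "LINT \<eta>|lborel. 1 / (1 + \<eta>\<^sup>2::real)"
  have "weighted_le 0 (C * ?K) r (moment \<phi>)"
    using C of_order_integrable[OF assms]
  proof eventually_elim
    case (elim ez)
    obtain e z where [simp]: "ez = (e, z)" by (cases ez)
    have "\<bar>LINT \<eta>|lborel. \<phi> e z \<eta>\<bar> \<le> (LINT \<eta>|lborel. C * \<bar>r e\<bar> * (1 / (1 + \<eta>\<^sup>2)))"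
      by (rule Bochner_Integration.integral_abs_bound_integral) (use elim in \<open>auto intro!: integrable_mult_right integrable_inverse_square_weight simp del: times_divide_eq_right\<close>)
    also have "\<dots> = C * \<bar>r e\<bar> * ?K" by (rule integral_mult_right_zero)
    finally show ?case by (simp add: moment_def mult_ac)
  qed
  then show "\<exists>C. weighted_le p C r (moment \<phi>)" if "p \<in> {0}" for p
    using that by (intro exI[of _ "C * ?K"]) simp
qed

text \<open>Differentiation under the integral sign: the bound on the second derivative dominates the second-order
remainder by a multiple of \<open>y\<^sup>2 / (1 + \<eta>\<^sup>2)\<close>.\<close>

lemma has_dd_moment:
  assumes \<phi>: "kin r \<phi>" and v: "v \<in> Basis"
  shows "has_dd v (moment \<phi>) (moment (dd v \<phi>))"
proof -
  note dv = of_order_dd[OF \<phi> v]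
  obtain C where C: "\<forall>\<^sub>F (e, z) in \<G>. \<forall>\<xi>. \<bar>dd v (dd v \<phi>) e z \<xi>\<bar> \<le> C * \<bar>r e\<bar> * (1 / (1 + \<xi>\<^sup>2))"
    using of_order_integrable_weight[OF of_order_dd[OF dv v]] by blast
  let ?P = "\<lambda>(e, z). (\<forall>\<xi>. \<bar>dd v (dd v \<phi>) e z \<xi>\<bar> \<le> C * \<bar>r e\<bar> * (1 / (1 + \<xi>\<^sup>2)) \<and>
    ((\<lambda>y. \<phi> e (z + y *\<^sub>R v) \<xi>) has_real_derivative dd v \<phi> e z \<xi>) (at 0) \<and>
    ((\<lambda>y. dd v \<phi> e (z + y *\<^sub>R v) \<xi>) has_real_derivative dd v (dd v \<phi>) e z \<xi>) (at 0)) \<and>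
    integrable lborel (\<phi> e z) \<and> integrable lborel (dd v \<phi> e z)"
  have "eventually ?P \<G>"
    using C of_order_has_dd[OF \<phi> v, unfolded has_dd_def] of_order_has_dd[OF dv v, unfolded has_dd_def]
      of_order_integrable[OF \<phi>] of_order_integrable[OF dv]
    by eventually_elim auto
  from eventually_germ_box[OF this v] obtain d where d: "0 < d" and
    P: "\<And>e z y. 0 < e \<Longrightarrow> e < d \<Longrightarrow> dist z z0 < d \<Longrightarrow> \<bar>y\<bar> < d \<Longrightarrow> ?P (e, z + y *\<^sub>R v)" by blast
  let ?w = "\<lambda>\<eta>::real. 1 / (1 + \<eta>\<^sup>2)"
  let ?K = "LINT \<eta>|lborel. ?w \<eta>"
  have "((\<lambda>y. LINT \<eta>|lborel. \<phi> e (z + y *\<^sub>R v) \<eta>) has_real_derivative (LINT \<eta>|lborel. dd v \<phi> e z \<eta>)) (at 0)"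
    if e: "0 < e" "e < d" and z: "dist z z0 < d" for e z
    unfolding has_field_derivative_iff
  proof (rule LIM_zero_cancel, rule Lim_null_comparison)
    have int0: "integrable lborel (\<phi> e z)" "integrable lborel (dd v \<phi> e z)"
      using P[OF e z, of 0] d by auto
    have "\<forall>\<^sub>F y in at 0. y \<noteq> 0 \<and> \<bar>y\<bar> < d"
      unfolding eventually_at by (rule exI[of _ d]) (use d in auto)
    then show "\<forall>\<^sub>F y in at 0. norm (((LINT \<eta>|lborel. \<phi> e (z + y *\<^sub>R v) \<eta>) - (LINT \<eta>|lborel. \<phi> e (z + 0 *\<^sub>R v) \<eta>)) / (y - 0)
        - (LINT \<eta>|lborel. dd v \<phi> e z \<eta>)) \<le> \<bar>y\<bar> * (C * \<bar>r e\<bar> * ?K)"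
    proof eventually_elim
      case (elim y)
      have inty: "integrable lborel (\<phi> e (z + y *\<^sub>R v))"
        using P[OF e z, of y] elim by auto
      have rem: "\<bar>\<phi> e (z + y *\<^sub>R v) \<eta> - \<phi> e z \<eta> - y * dd v \<phi> e z \<eta>\<bar> \<le> C * \<bar>r e\<bar> * ?w \<eta> * y\<^sup>2" for \<eta>
      proof -
        have "\<bar>(dd v ^^ 0) \<phi> e (z + y *\<^sub>R v) \<eta> - (\<Sum>m<2. (dd v ^^ m) \<phi> e (z + 0 *\<^sub>R v) \<eta> / fact m * y ^ m)\<bar>
             \<le> (C * \<bar>r e\<bar> * ?w \<eta>) * \<bar>y\<bar> ^ 2"
        proof (rule Taylor_remainder_le[where D = "\<lambda>m y. (dd v ^^ m) \<phi> e (z + y *\<^sub>R v) \<eta>"])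
          fix m y' assume m: "m < (2::nat)" and y': "\<bar>y'\<bar> \<le> \<bar>y\<bar>"
          from m have m01: "m = 0 \<or> m = 1" by auto
          have P': "?P (e, z + y' *\<^sub>R v)" by (rule P[OF e z]) (use elim y' in linarith)
          have "((\<lambda>y. \<phi> e (z + y *\<^sub>R v) \<eta>) has_real_derivative dd v \<phi> e (z + y' *\<^sub>R v) \<eta>) (at y')"
            by (rule DERIV_ray) (use P' in simp)
          moreover have "((\<lambda>y. dd v \<phi> e (z + y *\<^sub>R v) \<eta>) has_real_derivative dd v (dd v \<phi>) e (z + y' *\<^sub>R v) \<eta>) (at y')"
            by (rule DERIV_ray) (use P' in simp)
          ultimately show "((\<lambda>y. (dd v ^^ m) \<phi> e (z + y *\<^sub>R v) \<eta>) has_real_derivative (dd v ^^ Suc m) \<phi> e (z + y' *\<^sub>R v) \<eta>) (at y')"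
            using m01 by auto
        next
          fix y' assume y': "\<bar>y'\<bar> \<le> \<bar>y\<bar>"
          have "?P (e, z + y' *\<^sub>R v)" by (rule P[OF e z]) (use elim y' in linarith)
          then show "\<bar>(dd v ^^ 2) \<phi> e (z + y' *\<^sub>R v) \<eta>\<bar> \<le> C * \<bar>r e\<bar> * ?w \<eta>"
            by (simp add: numeral_2_eq_2)
        qed
        then show ?thesis by (simp add: numeral_2_eq_2 algebra_simps)
      qed
      have "(LINT \<eta>|lborel. \<phi> e (z + y *\<^sub>R v) \<eta> - \<phi> e z \<eta> - y * dd v \<phi> e z \<eta>)
          = (LINT \<eta>|lborel. \<phi> e (z + y *\<^sub>R v) \<eta>) - (LINT \<eta>|lborel. \<phi> e z \<eta>) - y * (LINT \<eta>|lborel. dd v \<phi> e z \<eta>)"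
        using int0 inty by simp
      moreover have "\<bar>LINT \<eta>|lborel. \<phi> e (z + y *\<^sub>R v) \<eta> - \<phi> e z \<eta> - y * dd v \<phi> e z \<eta>\<bar>
          \<le> (LINT \<eta>|lborel. y\<^sup>2 * (C * \<bar>r e\<bar>) * ?w \<eta>)"
        by (rule Bochner_Integration.integral_abs_bound_integral)
           (use int0 inty rem in \<open>auto intro!: integrable_mult_right integrable_inverse_square_weight simp: mult_ac simp del: times_divide_eq_right\<close>)
      ultimately have "\<bar>(LINT \<eta>|lborel. \<phi> e (z + y *\<^sub>R v) \<eta>) - (LINT \<eta>|lborel. \<phi> e z \<eta>) - y * (LINT \<eta>|lborel. dd v \<phi> e z \<eta>)\<bar>
          \<le> y\<^sup>2 * (C * \<bar>r e\<bar>) * ?K"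
        by (simp only: integral_mult_right_zero)
      then have "\<bar>(LINT \<eta>|lborel. \<phi> e (z + y *\<^sub>R v) \<eta>) - (LINT \<eta>|lborel. \<phi> e z \<eta>) - y * (LINT \<eta>|lborel. dd v \<phi> e z \<eta>)\<bar> / \<bar>y\<bar>
          \<le> (y\<^sup>2 * (C * \<bar>r e\<bar>) * ?K) / \<bar>y\<bar>"
        by (rule divide_right_mono) simp
      moreover have "(y\<^sup>2 * (C * \<bar>r e\<bar>) * ?K) / \<bar>y\<bar> = \<bar>y\<bar> * (C * \<bar>r e\<bar> * ?K)"
        using elim by (simp add: power2_eq_square abs_if)
      ultimately show ?case using elim by (simp add: abs_divide[symmetric] diff_divide_distrib)
    qed
    show "((\<lambda>y. \<bar>y\<bar> * (C * \<bar>r e\<bar> * ?K)) \<longlongrightarrow> 0) (at 0)"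
      by (rule tendsto_eq_intros filterlim_ident refl | simp)+
  qed
  then show ?thesis unfolding has_dd_def moment_def eventually_germ using d by auto
qed

lemma of_order_moment:
  assumes "kin r \<phi>"
  shows "hyd r (moment \<phi>)"
proof (rule of_orderI[where X = "\<lambda>\<psi>. \<exists>\<phi>. kin r \<phi> \<and> \<psi> = moment \<phi>"])
  show "\<exists>\<phi>'. kin r \<phi>' \<and> moment \<phi> = moment \<phi>'" using assms by blast
next
  fix \<psi> and v :: 'a assume "\<exists>\<phi>. kin r \<phi> \<and> \<psi> = moment \<phi>"
  then obtain \<phi> where \<phi>: "kin r \<phi>" and [simp]: "\<psi> = moment \<phi>" by blast
  show "wbound {0} r \<psi>" using wbound_moment[OF \<phi>] by simp
  assume v: "v \<in> Basis"
  show "\<exists>\<theta>. has_dd v \<psi> \<theta> \<and> (\<exists>\<phi>. kin r \<phi> \<and> \<theta> = moment \<phi>)"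
    using has_dd_moment[OF \<phi> v] of_order_dd[OF \<phi> v] by auto
qed

end

section \<open>Conservation by collisions\<close>

lemma maxwellian_eq_normal_density:
  "0 < T \<Longrightarrow> maxwellian T \<rho> u \<xi> = \<rho> * normal_density u (sqrt (T / 2)) \<xi>"
  by (simp add: maxwellian_def normal_density_def gas_constant_def)

lemma maxwellian_moments:
  assumes "0 < T"
  shows "integrable lborel (maxwellian T \<rho> u)" "(LINT \<xi>|lborel. maxwellian T \<rho> u \<xi>) = \<rho>"
    "integrable lborel (\<lambda>\<xi>. \<xi> * maxwellian T \<rho> u \<xi>)" "(LINT \<xi>|lborel. \<xi> * maxwellian T \<rho> u \<xi>) = \<rho> * u"
proof -
  have \<sigma>: "0 < sqrt (T / 2)" using assms by simp
  have eq: "maxwellian T \<rho> u = (\<lambda>\<xi>. \<rho> * normal_density u (sqrt (T / 2)) \<xi>)"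
    using maxwellian_eq_normal_density[OF assms] by auto
  have eq': "(\<lambda>\<xi>. \<xi> * maxwellian T \<rho> u \<xi>) = (\<lambda>\<xi>. \<rho> * (normal_density u (sqrt (T / 2)) \<xi> * \<xi>))"
    unfolding eq by (simp add: mult_ac)
  show "integrable lborel (maxwellian T \<rho> u)" "(LINT \<xi>|lborel. maxwellian T \<rho> u \<xi>) = \<rho>"
    unfolding eq using \<sigma> by auto
  show "integrable lborel (\<lambda>\<xi>. \<xi> * maxwellian T \<rho> u \<xi>)" "(LINT \<xi>|lborel. \<xi> * maxwellian T \<rho> u \<xi>) = \<rho> * u"
    unfolding eq' using integrable_normal_moment_nz_1[OF \<sigma>] integral_normal_moment_nz_1[OF \<sigma>] by auto
qed

lemma equilibrium_moments:
  assumes "0 < T" "mass_density \<phi> \<noteq> 0"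
  shows "integrable lborel (equilibrium T \<phi>)" "(LINT \<xi>|lborel. equilibrium T \<phi> \<xi>) = mass_density \<phi>"
    "integrable lborel (\<lambda>\<xi>. \<xi> * equilibrium T \<phi> \<xi>)"
    "(LINT \<xi>|lborel. \<xi> * equilibrium T \<phi> \<xi>) = (LINT \<xi>|lborel. \<xi> * \<phi> \<xi>)"
  using maxwellian_moments[OF assms(1), of "mass_density \<phi>" "bulk_velocity \<phi>"] assms(2)
  by (simp_all add: equilibrium_def[abs_def] bulk_velocity_def)

lemma collision_moments:
  assumes "0 < T" "mass_density \<phi> \<noteq> 0" "integrable lborel \<phi>" "integrable lborel (\<lambda>\<xi>. \<xi> * \<phi> \<xi>)"
  shows "(LINT \<xi>|lborel. collision \<tau> T \<phi> \<xi>) = 0" "(LINT \<xi>|lborel. \<xi> * collision \<tau> T \<phi> \<xi>) = 0"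
proof -
  note e = equilibrium_moments[OF assms(1,2)]
  show "(LINT \<xi>|lborel. collision \<tau> T \<phi> \<xi>) = 0"
    unfolding collision_def using e assms by (simp add: mass_density_def)
  have eq: "(\<lambda>\<xi>. \<xi> * collision \<tau> T \<phi> \<xi>) = (\<lambda>\<xi>. - (1 / \<tau>) * (\<xi> * \<phi> \<xi> - \<xi> * equilibrium T \<phi> \<xi>))"
    by (auto simp: collision_def right_diff_distrib)
  show "(LINT \<xi>|lborel. \<xi> * collision \<tau> T \<phi> \<xi>) = 0"
    unfolding eq using e assms by simp
qed

text \<open>The interface value \<open>G\<close> is defined through a collision term with its own moments. Collisions conserve
mass and momentum, so these moments are those of the explicit part \<open>K\<close>, and the equation for \<open>G\<close>
becomes linear.\<close>

lemma implicit_equilibrium: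
  assumes T: "0 < T" and \<tau>: "0 < \<tau>" and a: "0 \<le> a"
    and K: "integrable lborel K" "integrable lborel (\<lambda>\<xi>. \<xi> * K \<xi>)" "(LINT \<xi>|lborel. K \<xi>) \<noteq> 0"
    and G: "\<And>\<xi>. G \<xi> = K \<xi> + a * collision \<tau> T G \<xi>"
  shows "(1 + a / \<tau>) * G \<xi> = K \<xi> + a / \<tau> * maxwellian T (LINT \<xi>|lborel. K \<xi>) ((LINT \<xi>|lborel. \<xi> * K \<xi>) / (LINT \<xi>|lborel. K \<xi>)) \<xi>"
proof -
  define b where "b = a / \<tau>"
  have b: "0 \<le> b" "1 + b \<noteq> 0" using \<tau> a by (auto simp: b_def add_nonneg_eq_0_iff)
  define E where "E = equilibrium T G"
  have G': "G = (\<lambda>\<xi>. 1 / (1 + b) * (K \<xi> + b * E \<xi>))"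
  proof
    fix \<xi> have "(1 + b) * G \<xi> = K \<xi> + b * E \<xi>"
      using G[of \<xi>] by (simp add: collision_def b_def E_def algebra_simps)
    then show "G \<xi> = 1 / (1 + b) * (K \<xi> + b * E \<xi>)" using b(2) by (simp add: field_simps)
  qed
  have xiG: "(\<lambda>\<xi>. \<xi> * G \<xi>) = (\<lambda>\<xi>. 1 / (1 + b) * (\<xi> * K \<xi> + b * (\<xi> * E \<xi>)))"
    by (subst G') (auto simp: distrib_left mult_ac)
  have E: "integrable lborel E" "(LINT \<xi>|lborel. E \<xi>) = mass_density G"
     "integrable lborel (\<lambda>\<xi>. \<xi> * E \<xi>)" "(LINT \<xi>|lborel. \<xi> * E \<xi>) = mass_density G * bulk_velocity G"
    unfolding E_def equilibrium_def[abs_def] by (rule maxwellian_moments[OF T])+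
  have "mass_density G = 1 / (1 + b) * ((LINT \<xi>|lborel. K \<xi>) + b * mass_density G)"
    by (subst (1) mass_density_def, subst (1) G') (use K E in simp)
  then have m: "mass_density G = (LINT \<xi>|lborel. K \<xi>)" using b(2) by (simp add: field_simps)
  then have "mass_density G * bulk_velocity G = (LINT \<xi>|lborel. \<xi> * G \<xi>)"
    using K by (simp add: bulk_velocity_def)
  also have "\<dots> = 1 / (1 + b) * ((LINT \<xi>|lborel. \<xi> * K \<xi>) + b * (mass_density G * bulk_velocity G))"
    unfolding xiG using K E by simp
  finally have "mass_density G * bulk_velocity G = (LINT \<xi>|lborel. \<xi> * K \<xi>)" using b(2) by (simp add: field_simps)
  then have u: "bulk_velocity G = (LINT \<xi>|lborel. \<xi> * K \<xi>) / (LINT \<xi>|lborel. K \<xi>)" using m K by (simp add: field_simps)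
  have "maxwellian T (LINT \<xi>|lborel. K \<xi>) ((LINT \<xi>|lborel. \<xi> * K \<xi>) / (LINT \<xi>|lborel. K \<xi>)) \<xi> = E \<xi>"
    by (simp add: E_def equilibrium_def m u)
  then show ?thesis
    unfolding b_def[symmetric] using b(2) by (subst G') simp
qed

section \<open>Difference quotients\<close>

context germ
begin

definition diff_quot :: "'a \<Rightarrow> (real \<Rightarrow> real) \<Rightarrow> (real \<Rightarrow> 'a \<Rightarrow> real \<Rightarrow> real) \<Rightarrow> real \<Rightarrow> 'a \<Rightarrow> real \<Rightarrow> real" where
  "diff_quot v p \<phi> e z \<xi> = 1 / p e * (\<phi> e (z + p e *\<^sub>R v) \<xi> - \<phi> e z \<xi>)"

lemma of_order_diff_quot:
  assumes "of_order P r \<phi>" "0 \<in> P" "v \<in> Basis" "(p \<longlongrightarrow> 0) (at_right 0)"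
  shows "of_order P r (diff_quot v p \<phi>)"
  unfolding diff_quot_def[abs_def]
  by (rule of_order_scale_weaken[OF of_order_Taylor1[OF assms]]) (auto intro!: bigoI[of _ 1] always_eventually)

lemma of_order_diff_quot2:
  assumes "of_order P r \<phi>" "0 \<in> P" "v \<in> Basis" "(p \<longlongrightarrow> 0) (at_right 0)" and nz: "\<forall>\<^sub>F e in at_right 0. p e \<noteq> 0"
  shows "of_order P (\<lambda>e. p e * r e) (diff_quot v p \<phi> \<ominus> dd v \<phi>)"
proof (rule of_order_cong[OF of_order_scale_weaken[OF of_order_Taylor2[OF assms(1-4)], of "\<lambda>e. 1 / p e"]])
  show "(\<lambda>e. 1 / p e * ((p e)\<^sup>2 * r e)) \<in> O[at_right 0](\<lambda>e. p e * r e)"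
    by (intro bigoI[of _ 1] always_eventually) (auto simp: power2_eq_square)
  show "\<forall>\<^sub>F (e, z) in \<G>. \<forall>\<xi>. 1 / p e * (\<phi> e (z + p e *\<^sub>R v) \<xi> - \<phi> e z \<xi> - p e * dd v \<phi> e z \<xi>) =
      diff_quot v p \<phi> e z \<xi> - dd v \<phi> e z \<xi>"
    using eventually_germ_param[OF nz] by eventually_elim (auto simp: diff_quot_def field_simps)
qed

lemma of_order_diff_quot3:
  assumes "of_order P r \<phi>" "0 \<in> P" "v \<in> Basis" "(p \<longlongrightarrow> 0) (at_right 0)" and nz: "\<forall>\<^sub>F e in at_right 0. p e \<noteq> 0"
  shows "of_order P (\<lambda>e. (p e)\<^sup>2 * r e)
    (diff_quot v p \<phi> \<ominus> dd v \<phi> \<ominus> (\<lambda>e. p e / 2) \<odot> dd v (dd v \<phi>))"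
proof (rule of_order_cong[OF of_order_scale_weaken[OF of_order_Taylor3[OF assms(1-4)], of "\<lambda>e. 1 / p e"]])
  show "(\<lambda>e. 1 / p e * (p e ^ 3 * r e)) \<in> O[at_right 0](\<lambda>e. (p e)\<^sup>2 * r e)"
    by (intro bigoI[of _ 1] always_eventually) (auto simp: power2_eq_square power3_eq_cube)
  show "\<forall>\<^sub>F (e, z) in \<G>. \<forall>\<xi>. 1 / p e * (\<phi> e (z + p e *\<^sub>R v) \<xi> - \<phi> e z \<xi> - p e * dd v \<phi> e z \<xi>
         - (p e)\<^sup>2 / 2 * dd v (dd v \<phi>) e z \<xi>) =
      diff_quot v p \<phi> e z \<xi> - dd v \<phi> e z \<xi> - p e / 2 * dd v (dd v \<phi>) e z \<xi>"
    using eventually_germ_param[OF nz] by eventually_elim (auto simp: diff_quot_def field_simps power2_eq_square)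
qed

lemma moment_diff:
  assumes "kin r \<phi>" "kin r' \<psi>"
  shows "agree (moment (\<phi> \<ominus> \<psi>)) (moment \<phi> \<ominus> moment \<psi>)"
  using of_order_integrable[OF assms(1)] of_order_integrable[OF assms(2)]
  by eventually_elim (auto simp: moment_def)

lemma moment_cmult: "moment (a \<odot> \<phi>) e z \<xi> = a e * moment \<phi> e z \<xi>"
  by (simp add: moment_def)

end

section \<open>The scheme near a point\<close>

text \<open>The scheme near one point \<open>z0 = (x, t)\<close>, for all small parameters at once. \<open>\<Gamma> e z\<close> is the interface
value between the cells centred at \<open>z\<close> and at \<open>z + (h e, 0)\<close>, half a time step later. The steps are
positive and vanish with the parameter; their sizes enter through \<open>e = O(dt)\<close> and \<open>(dt + h)\<^sup>2 = o(e)\<close>.\<close>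

locale dugks_germ = germ z0 for z0 :: "real \<times> real" +
  fixes \<tau> T c :: real and dt h :: "real \<Rightarrow> real"
    and F \<Gamma> :: "real \<Rightarrow> real \<times> real \<Rightarrow> real \<Rightarrow> real"
  assumes \<tau>_pos: "0 < \<tau>" and T_pos: "0 < T" and c_pos: "0 < c"
    and F_order: "kin (\<lambda>_. 1) F"
    and rho_ge: "\<forall>\<^sub>F (e, z) in \<G>. \<forall>\<xi>. c \<le> moment F e z \<xi>"
    and steps_pos: "\<forall>\<^sub>F e in at_right 0. 0 < dt e \<and> 0 < h e"
    and dt_lim: "(dt \<longlongrightarrow> 0) (at_right 0)" and h_lim: "(h \<longlongrightarrow> 0) (at_right 0)"
    and eps_dt: "(\<lambda>e. e) \<in> O[at_right 0](dt)"
    and kappa_sq: "(\<lambda>e. (dt e + h e)\<^sup>2) \<in> o[at_right 0](\<lambda>e. e)"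
    and interface: "\<forall>\<^sub>F (e, z) in \<G>. \<forall>\<xi>. \<Gamma> e z \<xi> =
          (1 / 2 - \<xi> * dt e / (2 * h e)) *
             (F e (z + h e *\<^sub>R (1, 0)) \<xi> + dt e / (4 * e) * collision \<tau> T (F e (z + h e *\<^sub>R (1, 0))) \<xi>)
        + (1 / 2 + \<xi> * dt e / (2 * h e)) *
             (F e z \<xi> + dt e / (4 * e) * collision \<tau> T (F e z) \<xi>)
        + dt e / (4 * e) * collision \<tau> T (\<Gamma> e z) \<xi>"
    and update: "\<forall>\<^sub>F (e, z) in \<G>. \<forall>\<xi>.
        (F e (z + dt e *\<^sub>R (0, 1)) \<xi> - F e z \<xi>) / dt e
        + \<xi> * ((\<Gamma> e z \<xi> - \<Gamma> e (z + (- h e) *\<^sub>R (1, 0)) \<xi>) / h e)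
        = 1 / (2 * e) * (collision \<tau> T (F e z) \<xi> + collision \<tau> T (F e (z + dt e *\<^sub>R (0, 1))) \<xi>)"
begin

\<comment> \<open>Shifts keep the form \<open>z + p *\<^sub>R v\<close>, to which the lemmas on families apply.\<close>
declare scaleR_Pair [simp del]

abbreviation ex :: "real \<times> real" where "ex \<equiv> (1, 0)"
abbreviation et :: "real \<times> real" where "et \<equiv> (0, 1)"

lemma basis: "ex \<in> Basis" "et \<in> Basis"
  by (auto simp: Basis_prod_def)

text \<open>All truncation errors are measured in powers of \<open>\<kappa>\<close>. The ratio \<open>b\<close> tends to infinity, and \<open>w\<close> is the
factor by which the implicit collision term damps the explicit part of the interface value.\<close>

definition "\<kappa> e = dt e + h e"
definition "a e = dt e / (4 * e)"
definition "b e = a e / \<tau>"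
definition "w e = 1 / (1 + b e)"

text \<open>\<open>Q\<close> is the collision term of the cell values and \<open>W\<close> their transport derivative; the modified equation
compares \<open>Q\<close> with \<open>e W\<close>.\<close>

definition "M = maxwell T (moment F) (moment (xi F))"
definition "Q e z \<xi> = 1 / \<tau> * (M e z \<xi> - F e z \<xi>)"
definition "W e z \<xi> = dd et F e z \<xi> + \<xi> * dd ex F e z \<xi>"

text \<open>Linear interpolation at the foot of the characteristic that reaches the interface.\<close>

definition upwind :: "(real \<Rightarrow> real \<times> real \<Rightarrow> real \<Rightarrow> real) \<Rightarrow> real \<Rightarrow> real \<times> real \<Rightarrow> real \<Rightarrow> real" where
  "upwind \<phi> e z \<xi> = (1 / 2 - \<xi> * dt e / (2 * h e)) * \<phi> e (z + h e *\<^sub>R ex) \<xi>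
     + (1 / 2 + \<xi> * dt e / (2 * h e)) * \<phi> e z \<xi>"

text \<open>The mass and momentum of the interface value. Of the collision term in the interpolated data, only
the second velocity moment contributes, through the flux of momentum.\<close>

definition "\<rho>\<^sub>\<Gamma> = moment (upwind F)"
definition "m\<^sub>\<Gamma> e z \<xi> = moment (upwind (xi F)) e z \<xi>
   - a e * dt e / 2 * diff_quot ex h (moment (xi (xi Q))) e z \<xi>"
definition "M\<^sub>\<Gamma> = maxwell T \<rho>\<^sub>\<Gamma> m\<^sub>\<Gamma>"
text \<open>The left-hand side of the update: difference quotient in time plus flux difference.\<close>

definition "L e z \<xi> = diff_quot et dt F e z \<xi> + \<xi> * diff_quot ex (\<lambda>e. - h e) \<Gamma> e z \<xi>"
definition "\<Delta> \<phi> e z \<xi> = \<phi> e (z + dt e *\<^sub>R et) \<xi> - \<phi> e z \<xi>" for \<phi> :: "real \<Rightarrow> real \<times> real \<Rightarrow> real \<Rightarrow> real"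

lemma collision_F: "collision \<tau> T (F e z) \<xi> = Q e z \<xi>"
  by (simp add: collision_def Q_def M_def maxwell_def moment_def equilibrium_def mass_density_def
      bulk_velocity_def divide_simps)

lemma pos: "\<forall>\<^sub>F e in at_right 0. 0 < e \<and> 0 < dt e \<and> 0 < h e \<and> 0 < \<kappa> e \<and> 0 < a e \<and> 0 < b e"
  using steps_pos eventually_at_right_less[of 0]
  by eventually_elim (use \<tau>_pos in \<open>auto simp: \<kappa>_def a_def b_def\<close>)

lemmas pos_germ = eventually_germ_param[OF pos]

lemma h_neg_lim: "((\<lambda>e. - h e) \<longlongrightarrow> 0) (at_right 0)"
  using tendsto_minus[OF h_lim] by simp

lemma h_half_lim: "((\<lambda>e. h e / 2) \<longlongrightarrow> 0) (at_right 0)"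
  using tendsto_divide[OF h_lim tendsto_const, of 2] by simp

lemma dt_half_lim: "((\<lambda>e. dt e / 2) \<longlongrightarrow> 0) (at_right 0)"
  using tendsto_divide[OF dt_lim tendsto_const, of 2] by simp

lemma kappa_lim: "(\<kappa> \<longlongrightarrow> 0) (at_right 0)"
  unfolding \<kappa>_def[abs_def] using tendsto_add[OF dt_lim h_lim] by simp

lemma dt_O: "dt \<in> O[at_right 0](\<kappa>)"
  by (rule bigoI[of _ 1]) (use pos in \<open>eventually_elim, auto simp: \<kappa>_def\<close>)

lemma h_O: "h \<in> O[at_right 0](\<kappa>)"
  by (rule bigoI[of _ 1]) (use pos in \<open>eventually_elim, auto simp: \<kappa>_def\<close>)

lemma eps_O: "(\<lambda>e. e) \<in> O[at_right 0](\<kappa>)"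
  using landau_o.big_trans[OF eps_dt dt_O] .

lemma kappa_O1: "\<kappa> \<in> O[at_right 0](\<lambda>_. 1)"
  using order_tendstoD(2)[OF kappa_lim zero_less_one] pos
  by (intro bigoI[of _ 1]; eventually_elim) auto

lemma kappa_sq_O: "(\<lambda>e. \<kappa> e * \<kappa> e) \<in> O[at_right 0](\<lambda>e. e)"
  using landau_o.small_imp_big[OF kappa_sq] by (simp add: \<kappa>_def power2_eq_square)

lemma w_O: "w \<in> O[at_right 0](\<lambda>_. 1)"
  by (rule bigoI[of _ 1]) (use pos in \<open>eventually_elim, auto simp: w_def\<close>)

lemma wb_O: "(\<lambda>e. w e * b e) \<in> O[at_right 0](\<lambda>_. 1)"
  by (rule bigoI[of _ 1]) (use pos in \<open>eventually_elim, auto simp: w_def field_simps\<close>)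

lemma wa_O: "(\<lambda>e. w e * a e) \<in> O[at_right 0](\<lambda>_. 1)"
proof -
  have "(\<lambda>e. \<tau> * (w e * b e)) \<in> O[at_right 0](\<lambda>_. 1)" using wb_O by simp
  moreover have "\<tau> * (w e * b e) = w e * a e" for e using \<tau>_pos by (simp add: b_def)
  ultimately show ?thesis by simp
qed

lemma a_eps_O: "(\<lambda>e. a e * e) \<in> O[at_right 0](\<kappa>)"
  by (rule landau_o.big_trans[OF _ dt_O], rule bigoI[of _ 1]) (use pos in \<open>eventually_elim, auto simp: a_def\<close>)

lemma dt_O1: "dt \<in> O[at_right 0](\<lambda>_. 1)" and h_O1: "h \<in> O[at_right 0](\<lambda>_. 1)"
  using landau_o.big_trans[OF dt_O kappa_O1] landau_o.big_trans[OF h_O kappa_O1] .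

section \<open>The scheme in terms of smooth families\<close>

lemma xi_order: "kin r \<phi> \<Longrightarrow> kin r (xi \<phi>)"
  by (rule of_order_times_xi)

lemma M_order: "kin (\<lambda>_. 1) M"
  unfolding M_def by (intro of_order_maxwell[OF _ _ T_pos c_pos rho_ge] of_order_moment xi_order F_order)

lemma Q_order1: "kin (\<lambda>_. 1) Q"
  unfolding Q_def[abs_def] by (intro of_order_cmult of_order_diff M_order F_order)

lemma Ft_order: "kin (\<lambda>_. 1) (dd et F)" and Fx_order: "kin (\<lambda>_. 1) (dd ex F)"
  by (intro of_order_dd F_order basis)+

lemma W_order: "kin (\<lambda>_. 1) W"
  unfolding W_def[abs_def] by (intro of_order_add xi_order Ft_order Fx_order)

lemma Q_conserves: "\<forall>\<^sub>F (e, z) in \<G>. \<forall>\<xi>. moment Q e z \<xi> = 0 \<and> moment (xi Q) e z \<xi> = 0"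
  using rho_ge of_order_integrable[OF F_order] of_order_integrable[OF xi_order[OF F_order]]
proof eventually_elim
  case (elim ez)
  obtain e z where [simp]: "ez = (e, z)" by (cases ez)
  have "mass_density (F e z) \<noteq> 0" using elim c_pos by (auto simp: moment_def mass_density_def)
  from collision_moments[OF T_pos this, of \<tau>] elim show ?case
    by (simp add: moment_def collision_F)
qed

lemma upwind_eq:
  "agree (\<phi> \<oplus> ((\<lambda>e. h e / 2) \<odot> diff_quot ex h \<phi> \<ominus> (\<lambda>e. dt e / 2) \<odot> xi (diff_quot ex h \<phi>))) (upwind \<phi>)"
  using pos_germ by eventually_elim (auto simp: upwind_def diff_quot_def field_simps)

lemma upwind_diff_order:
  assumes "kin r \<phi>"
  shows "kin (\<lambda>e. \<kappa> e * r e) (upwind \<phi> \<ominus> \<phi>)"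
proof -
  have D: "kin r (diff_quot ex h \<phi>)"
    by (rule of_order_diff_quot[OF assms _ basis(1) h_lim]) simp
  have "kin (\<lambda>e. \<kappa> e * r e) (\<lambda>e z \<xi>. h e / 2 * diff_quot ex h \<phi> e z \<xi> - dt e / 2 * (\<xi> * diff_quot ex h \<phi> e z \<xi>))"
    by (intro of_order_diff of_order_scale_weaken[OF D] of_order_scale_weaken[OF xi_order[OF D]] landau_o.big.mult)
       (use h_O dt_O in auto)
  then show ?thesis
    by (rule of_order_cong) (use upwind_eq[of \<phi>] in \<open>eventually_elim, auto simp: algebra_simps\<close>)
qed

lemma upwind_order:
  assumes "kin r \<phi>"
  shows "kin r (upwind \<phi>)"
proof -
  have "kin r (upwind \<phi> \<ominus> \<phi> \<oplus> \<phi>)"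
    by (intro of_order_add assms of_order_weaken[OF upwind_diff_order[OF assms]])
       (use landau_o.big.mult[OF kappa_O1, of r r] in simp)
  then show ?thesis by simp
qed

lemma upwind_xi: "upwind (xi \<phi>) e z \<xi> = \<xi> * upwind \<phi> e z \<xi>"
  by (simp add: upwind_def algebra_simps)

lemma moment_upwind:
  assumes "kin r \<phi>"
  shows "\<forall>\<^sub>F (e, z) in \<G>. \<forall>\<xi>. moment (upwind \<phi>) e z \<xi> =
    (moment \<phi> e (z + h e *\<^sub>R ex) \<xi> + moment \<phi> e z \<xi>) / 2
    - dt e / 2 * diff_quot ex h (moment (xi \<phi>)) e z \<xi>"
  using of_order_integrable[OF assms] of_order_integrable[OF xi_order[OF assms]]
     eventually_germ_shift[OF of_order_integrable[OF assms] h_lim, of ex]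
     eventually_germ_shift[OF of_order_integrable[OF xi_order[OF assms]] h_lim, of ex] pos_germ
proof eventually_elim
  case (elim ez)
  obtain e z where [simp]: "ez = (e, z)" by (cases ez)
  let ?z = "z + h e *\<^sub>R ex"
  have eq: "upwind \<phi> e z = (\<lambda>\<xi>. 1 / 2 * \<phi> e ?z \<xi> + 1 / 2 * \<phi> e z \<xi>
      - dt e / (2 * h e) * (\<xi> * \<phi> e ?z \<xi>) + dt e / (2 * h e) * (\<xi> * \<phi> e z \<xi>))"
    by (rule ext) (simp add: upwind_def algebra_simps)
  have "(LINT \<xi>|lborel. upwind \<phi> e z \<xi>) = 1 / 2 * (LINT \<xi>|lborel. \<phi> e ?z \<xi>) + 1 / 2 * (LINT \<xi>|lborel. \<phi> e z \<xi>)
      - dt e / (2 * h e) * (LINT \<xi>|lborel. \<xi> * \<phi> e ?z \<xi>) + dt e / (2 * h e) * (LINT \<xi>|lborel. \<xi> * \<phi> e z \<xi>)"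
    unfolding eq using elim by simp
  then show ?case using elim by (simp add: moment_def diff_quot_def) (simp add: field_simps)
qed

text \<open>Interpolation at the foot of the characteristic multiplies by the velocity at most once, so the mass
and momentum of \<open>Q\<close>, which vanish, hide all but its second moment.\<close>

lemma upwind_Q_moments:
  "\<forall>\<^sub>F (e, z) in \<G>. \<forall>\<xi>. moment (upwind Q) e z \<xi> = 0 \<and>
     moment (upwind (xi Q)) e z \<xi> = - (dt e / 2 * diff_quot ex h (moment (xi (xi Q))) e z \<xi>)"
  using moment_upwind[OF Q_order1] moment_upwind[OF xi_order[OF Q_order1]]
    Q_conserves eventually_germ_shift[OF Q_conserves h_lim, of ex]
  by eventually_elim (auto simp: diff_quot_def[of _ _ "moment (xi Q)"])

lemma rhoG_diff_order: "hyd \<kappa> (\<rho>\<^sub>\<Gamma> \<ominus> moment F)"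
  using of_order_cong[OF of_order_moment[OF upwind_diff_order[OF F_order]] moment_diff[OF upwind_order[OF F_order] F_order]]
  by (simp add: \<rho>\<^sub>\<Gamma>_def)

lemma rhoG_order: "hyd (\<lambda>_. 1) \<rho>\<^sub>\<Gamma>"
  unfolding \<rho>\<^sub>\<Gamma>_def by (intro of_order_moment upwind_order F_order)

lemma rhoG_ge: "\<forall>\<^sub>F (e, z) in \<G>. \<forall>\<xi>. c / 2 \<le> \<rho>\<^sub>\<Gamma> e z \<xi>"
proof -
  obtain C where C: "weighted_le 0 C \<kappa> (\<rho>\<^sub>\<Gamma> \<ominus> moment F)"
    using of_order_wbound[OF rhoG_diff_order] unfolding wbound_def by blast
  have "((\<lambda>e. C * \<bar>\<kappa> e\<bar>) \<longlongrightarrow> C * \<bar>0\<bar>) (at_right 0)"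
    by (intro tendsto_intros kappa_lim)
  then have "\<forall>\<^sub>F e in at_right 0. C * \<bar>\<kappa> e\<bar> < c / 2"
    by (rule order_tendstoD) (use c_pos in simp)
  from C eventually_germ_param[OF this] rho_ge show ?thesis
    by eventually_elim (auto, smt (verit) field_sum_of_halves)
qed

lemma xxQ_order: "kin r Q \<Longrightarrow> hyd r (diff_quot ex h (moment (xi (xi Q))))"
  by (intro of_order_diff_quot of_order_moment xi_order basis h_lim) auto

text \<open>The flux of momentum caused by the collision term has the coefficient \<open>dt\<^sup>2 / (8 e)\<close>, which is bounded
because \<open>dt\<^sup>2 = O(e)\<close>.\<close>

lemma a_dt_O: "(\<lambda>e. a e * dt e / 2) \<in> O[at_right 0](\<lambda>_. 1)"
proof -
  have "(\<lambda>e. dt e * dt e) \<in> O[at_right 0](\<lambda>e. \<kappa> e * \<kappa> e)" by (intro landau_o.big.mult dt_O)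
  from landau_o.big_trans[OF this kappa_sq_O] obtain C where
    "\<forall>\<^sub>F e in at_right 0. norm (dt e * dt e) \<le> C * norm e" by (auto elim: landau_o.bigE)
  with pos show ?thesis
    by (intro bigoI[of _ "C / 8"]; eventually_elim) (auto simp: a_def field_simps)
qed

lemma mG_order: "hyd (\<lambda>_. 1) m\<^sub>\<Gamma>"
  unfolding m\<^sub>\<Gamma>_def[abs_def]
  by (intro of_order_diff of_order_moment upwind_order xi_order F_order of_order_scale_weaken[OF xxQ_order[OF Q_order1]])
     (use a_dt_O in simp)

lemma MG_order: "kin (\<lambda>_. 1) M\<^sub>\<Gamma>"
  unfolding M\<^sub>\<Gamma>_def by (rule of_order_maxwell[OF rhoG_order mG_order T_pos _ rhoG_ge]) (use c_pos in simp)

text \<open>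
The interpolated data \<open>F + a Q\<close> form the explicit part; its mass and momentum are \<open>\<rho>\<^sub>\<Gamma>\<close> and \<open>m\<^sub>\<Gamma>\<close>, so the
implicit collision term relaxes to \<open>M\<^sub>\<Gamma>\<close>.\<close>

lemma Gamma_eq:
  "agree ((\<lambda>e. 1 + b e) \<odot> \<Gamma>) (upwind F \<oplus> a \<odot> upwind Q \<oplus> b \<odot> M\<^sub>\<Gamma>)"
  using interface pos_germ upwind_Q_moments rhoG_ge
    of_order_integrable[OF upwind_order[OF F_order]] of_order_integrable[OF upwind_order[OF xi_order[OF F_order]]]
    of_order_integrable[OF upwind_order[OF Q_order1]] of_order_integrable[OF upwind_order[OF xi_order[OF Q_order1]]]
proof eventually_elim
  case (elim ez)
  obtain e z where [simp]: "ez = (e, z)" by (cases ez)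
  define K where "K = (\<lambda>\<xi>. upwind F e z \<xi> + a e * upwind Q e z \<xi>)"
  have xK: "(\<lambda>\<xi>. \<xi> * K \<xi>) = (\<lambda>\<xi>. upwind (xi F) e z \<xi> + a e * upwind (xi Q) e z \<xi>)"
    unfolding K_def upwind_xi by (simp add: algebra_simps)
  have G: "\<Gamma> e z \<xi> = K \<xi> + a e * collision \<tau> T (\<Gamma> e z) \<xi>" for \<xi>
  proof -
    have "\<Gamma> e z \<xi> = (1 / 2 - \<xi> * dt e / (2 * h e)) * (F e (z + h e *\<^sub>R ex) \<xi> + a e * Q e (z + h e *\<^sub>R ex) \<xi>)
        + (1 / 2 + \<xi> * dt e / (2 * h e)) * (F e z \<xi> + a e * Q e z \<xi>) + a e * collision \<tau> T (\<Gamma> e z) \<xi>"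
      using elim unfolding collision_F a_def by auto
    then show ?thesis by (simp only: K_def upwind_def algebra_simps)
  qed
  have iK: "integrable lborel K" "integrable lborel (\<lambda>\<xi>. \<xi> * K \<xi>)"
    using elim unfolding xK unfolding K_def by auto
  have rho: "(LINT \<xi>|lborel. K \<xi>) = \<rho>\<^sub>\<Gamma> e z \<xi>" for \<xi>
    using elim unfolding K_def by (auto simp: \<rho>\<^sub>\<Gamma>_def moment_def)
  have m: "(LINT \<xi>|lborel. \<xi> * K \<xi>) = m\<^sub>\<Gamma> e z \<xi>" for \<xi>
  proof -
    have "(LINT \<eta>|lborel. upwind (xi Q) e z \<eta>) = - (dt e / 2 * diff_quot ex h (moment (xi (xi Q))) e z \<xi>)"
      using elim by (auto simp: moment_def)
    then show ?thesis using elim unfolding xK by (simp add: m\<^sub>\<Gamma>_def moment_def)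
  qed
  have "\<rho>\<^sub>\<Gamma> e z 0 \<noteq> 0" using elim c_pos by (auto dest!: spec[of _ 0])
  then have "(LINT \<xi>|lborel. K \<xi>) \<noteq> 0" using rho[of 0] by simp
  from implicit_equilibrium[OF T_pos \<tau>_pos _ iK this G] elim
  have "(1 + b e) * \<Gamma> e z \<xi> = K \<xi> + b e * M\<^sub>\<Gamma> e z \<xi>" for \<xi>
    unfolding M\<^sub>\<Gamma>_def maxwell_def rho[of \<xi>, symmetric] m[of \<xi>, symmetric] b_def by simp
  then show ?case by (simp add: K_def)
qed

text \<open>Up to the collision term this is a convex combination, with \<open>w + w b = 1\<close>; moreover \<open>w a\<close> is bounded
although \<open>a\<close> is not.\<close>

lemma Gamma_expand:
  "agree \<Gamma> (w \<odot> upwind F \<oplus> (\<lambda>e. w e * a e) \<odot> upwind Q \<oplus> (\<lambda>e. w e * b e) \<odot> M\<^sub>\<Gamma>)"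
  using Gamma_eq pos_germ
proof eventually_elim
  case (elim ez)
  obtain e z where [simp]: "ez = (e, z)" by (cases ez)
  have "1 + b e \<noteq> 0" using elim by auto
  then have "\<Gamma> e z \<xi> = w e * ((1 + b e) * \<Gamma> e z \<xi>)" for \<xi> by (simp add: w_def)
  moreover have "(1 + b e) * \<Gamma> e z \<xi> = upwind F e z \<xi> + a e * upwind Q e z \<xi> + b e * M\<^sub>\<Gamma> e z \<xi>" for \<xi>
    using elim by simp
  ultimately show ?case by (simp add: distrib_left mult.assoc)
qed

lemma Gamma_order: "kin (\<lambda>_. 1) \<Gamma>"
proof -
  have "kin (\<lambda>_. 1) (\<lambda>e z \<xi>. w e * upwind F e z \<xi> + w e * a e * upwind Q e z \<xi> + w e * b e * M\<^sub>\<Gamma> e z \<xi>)"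
    by (intro of_order_add of_order_scale_weaken[OF upwind_order[OF F_order]]
        of_order_scale_weaken[OF upwind_order[OF Q_order1]] of_order_scale_weaken[OF MG_order])
       (use w_O wa_O wb_O in simp_all)
  then show ?thesis by (rule of_order_cong) (use Gamma_expand in \<open>eventually_elim, auto\<close>)
qed

lemma L_order: "kin (\<lambda>_. 1) L"
  unfolding L_def[abs_def]
  by (intro of_order_add xi_order of_order_diff_quot F_order Gamma_order basis dt_lim h_neg_lim) auto

lemma scheme_eq: "\<forall>\<^sub>F (e, z) in \<G>. \<forall>\<xi>. Q e z \<xi> + Q e (z + dt e *\<^sub>R et) \<xi> = 2 * e * L e z \<xi>"
  using update pos_germ
proof eventually_elim
  case (elim ez)
  obtain e z where [simp]: "ez = (e, z)" by (cases ez)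
  have "L e z \<xi> = 1 / (2 * e) * (Q e z \<xi> + Q e (z + dt e *\<^sub>R et) \<xi>)" for \<xi>
  proof -
    have "L e z \<xi> = (F e (z + dt e *\<^sub>R (0, 1)) \<xi> - F e z \<xi>) / dt e
        + \<xi> * ((\<Gamma> e z \<xi> - \<Gamma> e (z + (- h e) *\<^sub>R (1, 0)) \<xi>) / h e)"
      using elim by (simp add: L_def diff_quot_def divide_simps) (simp add: algebra_simps)
    also have "\<dots> = 1 / (2 * e) * (Q e z \<xi> + Q e (z + dt e *\<^sub>R et) \<xi>)"
      using elim unfolding collision_F by auto
    finally show ?thesis .
  qed
  then show ?case using elim by simp
qed

text \<open>The scheme controls only the sum of two consecutive values of \<open>Q\<close>. In terms of the forward difference
\<open>\<Delta>\<close> in time it reads \<open>(2 + \<Delta>) Q = 2 e L\<close>, and multiplication by \<open>1 - \<Delta> / 2\<close> gives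
\<open>(2 - \<Delta>\<^sup>2 / 2) Q\<close>: smoothness in time excludes the mode of alternating sign.\<close>

lemma Q_eq: "agree Q ((\<lambda>e. e) \<odot> (L \<ominus> (\<lambda>_. 1 / 2) \<odot> \<Delta> L) \<oplus> (\<lambda>_. 1 / 4) \<odot> \<Delta> (\<Delta> Q))"
  using scheme_eq eventually_germ_shift[OF scheme_eq dt_lim, of et]
proof eventually_elim
  case (elim ez)
  obtain e z where [simp]: "ez = (e, z)" by (cases ez)
  show ?case
  proof (simp, intro allI)
    fix \<xi>
    have 1: "Q e z \<xi> + Q e (z + dt e *\<^sub>R et) \<xi> = 2 * e * L e z \<xi>"
      "Q e (z + dt e *\<^sub>R et) \<xi> + Q e (z + dt e *\<^sub>R et + dt e *\<^sub>R et) \<xi> = 2 * e * L e (z + dt e *\<^sub>R et) \<xi>"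
      using elim by auto
    have "e * (L e z \<xi> - \<Delta> L e z \<xi> / 2) = 3 / 4 * (2 * e * L e z \<xi>) - 1 / 4 * (2 * e * L e (z + dt e *\<^sub>R et) \<xi>)"
      by (simp add: \<Delta>_def field_simps)
    then show "Q e z \<xi> = e * (L e z \<xi> - \<Delta> L e z \<xi> / 2) + \<Delta> (\<Delta> Q) e z \<xi> / 4"
      unfolding 1[symmetric] by (simp add: \<Delta>_def field_simps)
  qed
qed

lemma \<Delta>_order: "kin r \<phi> \<Longrightarrow> kin (\<lambda>e. dt e * r e) (\<Delta> \<phi>)"
  unfolding \<Delta>_def[abs_def] by (rule of_order_Taylor1[OF _ _ basis(2) dt_lim]) auto

lemma dt_mult_O: "f \<in> O[at_right 0](g) \<Longrightarrow> (\<lambda>e. dt e * f e) \<in> O[at_right 0](\<lambda>e. \<kappa> e * g e)"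
  by (rule landau_o.big.mult[OF dt_O])

text \<open>The cell values are close to equilibrium: \<open>\<Delta>\<^sup>2 Q\<close> is of order \<open>dt\<^sup>2\<close> because \<open>Q\<close> is smooth, and this is
\<open>O(e)\<close>.\<close>

lemma Q_order: "kin (\<lambda>e. e) Q"
proof -
  have 1: "kin (\<lambda>_. 1) (L \<ominus> (\<lambda>_. 1 / 2) \<odot> \<Delta> L)"
    by (intro of_order_diff of_order_cmult L_order of_order_weaken[OF \<Delta>_order[OF L_order]]) (use dt_O1 in simp)
  have "(\<lambda>e. dt e * (dt e * 1)) \<in> O[at_right 0](\<lambda>e. e)"
    using landau_o.big_trans[OF dt_mult_O[OF dt_O] kappa_sq_O] by simp
  then have "kin (\<lambda>e. e) (\<lambda>e z \<xi>. e * (L e z \<xi> - 1 / 2 * \<Delta> L e z \<xi>) + 1 / 4 * \<Delta> (\<Delta> Q) e z \<xi>)"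
    by (intro of_order_add of_order_cmult of_order_scale_weaken[OF 1] of_order_weaken[OF \<Delta>_order[OF \<Delta>_order[OF Q_order1]]]) auto
  then show ?thesis by (rule of_order_cong) (use Q_eq in \<open>eventually_elim, auto\<close>)
qed

section \<open>First-order consistency\<close>

lemma of_order_scale1:
  assumes "f \<in> O[at_right 0](\<lambda>_. 1)" "of_order P r \<phi>"
  shows "of_order P r (f \<odot> \<phi>)"
  by (rule of_order_scale_weaken[OF assms(2)]) (use landau_o.big.mult[OF assms(1), of r r] in simp)

lemma kk_O: "(\<lambda>e. \<kappa> e * \<kappa> e) \<in> O[at_right 0](\<kappa>)"
  using landau_o.big.mult[OF kappa_O1, of \<kappa> \<kappa>] by simp

lemma a_dt_eps_O: "(\<lambda>e. a e * dt e / 2 * e) \<in> O[at_right 0](\<lambda>e. \<kappa> e * \<kappa> e)"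
proof -
  have "(\<lambda>e. 1 / 2 * (a e * e * dt e)) \<in> O[at_right 0](\<lambda>e. \<kappa> e * \<kappa> e)"
    using landau_o.big.mult[OF a_eps_O dt_O] by simp
  then show ?thesis by (simp add: mult_ac)
qed

lemma rho_order: "hyd (\<lambda>_. 1) (moment F)" and m_order: "hyd (\<lambda>_. 1) (moment (xi F))"
  by (intro of_order_moment xi_order F_order)+

lemma mG_diff_order: "hyd \<kappa> (m\<^sub>\<Gamma> \<ominus> moment (xi F))"
proof -
  have "hyd \<kappa> (moment (upwind (xi F)) \<ominus> moment (xi F))"
    using of_order_cong[OF of_order_moment[OF upwind_diff_order[OF xi_order[OF F_order]]]
        moment_diff[OF upwind_order[OF xi_order[OF F_order]] xi_order[OF F_order]]] by simp
  moreover have "hyd \<kappa> ((\<lambda>e. a e * dt e / 2) \<odot> diff_quot ex h (moment (xi (xi Q))))"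
    by (rule of_order_scale_weaken[OF xxQ_order[OF Q_order] landau_o.big_trans[OF a_dt_eps_O kk_O]])
  ultimately have "hyd \<kappa> (moment (upwind (xi F)) \<ominus> moment (xi F) \<ominus> (\<lambda>e. a e * dt e / 2) \<odot> diff_quot ex h (moment (xi (xi Q))))" by (rule of_order_diff)
  then show ?thesis by (rule of_order_cong) (auto intro!: always_eventually simp: m\<^sub>\<Gamma>_def)
qed

lemma half_le_rho: "\<forall>\<^sub>F (e, z) in \<G>. \<forall>\<xi>. c / 2 \<le> moment F e z \<xi>"
  using rho_ge by eventually_elim (use c_pos in \<open>auto, smt (verit)\<close>)

lemma half_c_pos: "0 < c / 2" using c_pos by simp

lemma MG_diff_order: "kin \<kappa> (M\<^sub>\<Gamma> \<ominus> M)"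
  unfolding M\<^sub>\<Gamma>_def M_def
  by (rule of_order_maxwell_diff[OF rhoG_order mG_order rho_order m_order T_pos half_c_pos rhoG_ge half_le_rho
        rhoG_diff_order mG_diff_order])

lemma M_eq: "M e z \<xi> = F e z \<xi> + \<tau> * Q e z \<xi>"
  using \<tau>_pos by (simp add: Q_def)

lemma w_sum: "\<forall>\<^sub>F (e, z) in \<G>. w e + w e * b e = 1"
  using pos_germ by eventually_elim (auto simp: w_def field_simps)

text \<open>Since \<open>M = F + \<tau> Q\<close> and \<open>w + w b = 1\<close>, the interface value differs from \<open>F\<close> by interpolation errors and
multiples of \<open>Q\<close> only.\<close>

lemma Gamma_diff_order: "kin \<kappa> (\<Gamma> \<ominus> F)"
proof -
  have 1: "kin \<kappa> (upwind F \<ominus> F)" using upwind_diff_order[OF F_order] by simp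
  have 2: "kin \<kappa> Q" by (rule of_order_weaken[OF Q_order eps_O])
  have "kin \<kappa> (\<lambda>e z \<xi>. w e * (upwind F e z \<xi> - F e z \<xi>) + (w e * a e) * upwind Q e z \<xi>
      + (w e * b e) * (M\<^sub>\<Gamma> e z \<xi> - M e z \<xi>) + (w e * b e) * (\<tau> * Q e z \<xi>))" (is "kin _ ?X")
    by (intro of_order_add of_order_scale1[OF w_O 1] of_order_scale1[OF wa_O upwind_order[OF 2]]
        of_order_scale1[OF wb_O MG_diff_order] of_order_scale1[OF wb_O of_order_cmult[OF 2]])
  then show ?thesis
  proof (rule of_order_cong)
    show "agree ?X (\<Gamma> \<ominus> F)"
      using Gamma_expand w_sum
    proof eventually_elim
      case (elim ez)
      obtain e z where [simp]: "ez = (e, z)" by (cases ez)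
      have "F e z \<xi> = w e * F e z \<xi> + w e * b e * F e z \<xi>" for \<xi>
        using elim by (simp flip: distrib_right)
      then show ?case using elim by (simp add: M_eq algebra_simps)
    qed
  qed
qed

lemma back_quot: "kin r \<phi> \<Longrightarrow> kin r (diff_quot ex (\<lambda>e. - h e) \<phi>)"
  by (rule of_order_diff_quot[OF _ _ basis(1) h_neg_lim]) auto

lemma h_neg_O: "(\<lambda>e. - h e) \<in> O[at_right 0](\<kappa>)" using h_O by simp
lemma h_half_O: "(\<lambda>e. h e / 2) \<in> O[at_right 0](\<kappa>)" using h_O by simp
lemma dt_half_O: "(\<lambda>e. dt e / 2) \<in> O[at_right 0](\<kappa>)" using dt_O by simp

lemma h_neg_nz: "\<forall>\<^sub>F e in at_right 0. - h e \<noteq> 0" and h_nz: "\<forall>\<^sub>F e in at_right 0. h e \<noteq> 0"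
  and dt_nz: "\<forall>\<^sub>F e in at_right 0. dt e \<noteq> 0"
  using pos by (eventually_elim, simp)+

lemma back_quot2:
  "kin (\<lambda>_. 1) \<phi> \<Longrightarrow> kin \<kappa> (\<lambda>e z \<xi>. diff_quot ex (\<lambda>e. - h e) \<phi> e z \<xi> - dd ex \<phi> e z \<xi>)"
  by (rule of_order_weaken[OF of_order_diff_quot2[OF _ _ basis(1) h_neg_lim h_neg_nz]]) (use h_O in auto)

lemma L_W_order: "kin \<kappa> (L \<ominus> W)"
proof -
  have 1: "kin \<kappa> (diff_quot et dt F \<ominus> dd et F)"
    by (rule of_order_weaken[OF of_order_diff_quot2[OF F_order _ basis(2) dt_lim dt_nz]]) (use dt_O in auto)
  have "kin \<kappa> (\<lambda>e z \<xi>. (diff_quot et dt F e z \<xi> - dd et F e z \<xi>)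
      + \<xi> * diff_quot ex (\<lambda>e. - h e) (\<Gamma> \<ominus> F) e z \<xi>
      + \<xi> * (diff_quot ex (\<lambda>e. - h e) F e z \<xi> - dd ex F e z \<xi>))"
    by (intro of_order_add 1 xi_order back_quot Gamma_diff_order back_quot2 F_order)
  then show ?thesis
    by (rule of_order_cong) (auto intro!: always_eventually simp: L_def W_def diff_quot_def algebra_simps diff_divide_distrib)
qed

text \<open>First-order consistency. Knowing \<open>Q = O(e)\<close> improves the remainder \<open>\<Delta>\<^sup>2 Q\<close> in \<open>Q_eq\<close> by a factor \<open>e\<close>.\<close>

lemma Q_W_order: "kin (\<lambda>e. e * \<kappa> e) (Q \<ominus> (\<lambda>e. e) \<odot> W)"
proof -
  have 1: "kin \<kappa> (L \<ominus> W \<ominus> (\<lambda>_. 1 / 2) \<odot> \<Delta> L)"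
    by (intro of_order_diff of_order_cmult L_W_order of_order_weaken[OF \<Delta>_order[OF L_order]]) (use dt_O in simp)
  have "(\<lambda>e. dt e * (dt e * e)) \<in> O[at_right 0](\<lambda>e. \<kappa> e * (1 * e))"
    by (intro landau_o.big.mult dt_O dt_O1) simp
  then have "(\<lambda>e. dt e * (dt e * e)) \<in> O[at_right 0](\<lambda>e. e * \<kappa> e)" by (simp add: mult_ac)
  then have "kin (\<lambda>e. e * \<kappa> e) (\<lambda>e z \<xi>. e * ((L e z \<xi> - W e z \<xi>) - 1 / 2 * \<Delta> L e z \<xi>) + 1 / 4 * \<Delta> (\<Delta> Q) e z \<xi>)"
    by (intro of_order_add of_order_scale[OF 1] of_order_cmult of_order_weaken[OF \<Delta>_order[OF \<Delta>_order[OF Q_order]]])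
  then show ?thesis
    by (rule of_order_cong) (use Q_eq in \<open>eventually_elim, auto simp: algebra_simps\<close>)
qed

text \<open>Conservation of mass and momentum up to \<open>O(\<kappa>)\<close>: integrate the first-order modified equation, using
that the moments of \<open>Q\<close> vanish.\<close>

lemma moment_W_order: "hyd \<kappa> (moment W)" "hyd \<kappa> (moment (xi W))"
proof -
  have O: "(\<lambda>e. - (1 / e) * (e * \<kappa> e)) \<in> O[at_right 0](\<kappa>)"
    by (intro bigoI[of _ 1] always_eventually) auto
  have 0: "kin (\<lambda>e. e * \<kappa> e) (xi Q \<ominus> (\<lambda>e. e) \<odot> xi W)"
    using xi_order[OF Q_W_order] by (rule of_order_cong) (auto intro!: always_eventually simp: algebra_simps)
  show "hyd \<kappa> (moment W)"
    by (rule of_order_cong[OF of_order_scale_weaken[OF of_order_moment[OF Q_W_order] O]])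
       (use moment_diff[OF Q_order of_order_scale[OF W_order, of "\<lambda>e. e"]] Q_conserves pos_germ in
         \<open>eventually_elim, auto simp: moment_cmult[where a = "\<lambda>e. e"]\<close>)
  show "hyd \<kappa> (moment (xi W))"
    by (rule of_order_cong[OF of_order_scale_weaken[OF of_order_moment[OF 0] O]])
       (use moment_diff[OF xi_order[OF Q_order] of_order_scale[OF xi_order[OF W_order], of "\<lambda>e. e"]] Q_conserves pos_germ in
         \<open>eventually_elim, auto simp: moment_cmult[where a = "\<lambda>e. e"]\<close>)
qed

section \<open>Second-order consistency\<close>

abbreviation k2 :: "real \<Rightarrow> real" where "k2 \<equiv> \<lambda>e. \<kappa> e * \<kappa> e"

lemma half_sq_O: "p \<in> O[at_right 0](\<kappa>) \<Longrightarrow> (\<lambda>e. (p e)\<^sup>2 * 1) \<in> O[at_right 0](k2)"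
  using landau_o.big.mult[of p "at_right 0" \<kappa> p \<kappa>] by (simp add: power2_eq_square)

lemma kappa_mult_order: "p \<in> O[at_right 0](\<kappa>) \<Longrightarrow> of_order P \<kappa> \<phi> \<Longrightarrow> of_order P k2 (p \<odot> \<phi>)"
  by (rule of_order_scale_weaken) (auto intro: landau_o.big.mult)

text \<open>The cell values carried to the interface and to the half time step, exactly.\<close>

definition Fh :: "real \<Rightarrow> real \<times> real \<Rightarrow> real \<Rightarrow> real" where
  "Fh e z \<xi> = F e (z + (h e / 2) *\<^sub>R ex + (dt e / 2) *\<^sub>R et) \<xi>"

lemma half_shift: "of_order P r \<phi> \<Longrightarrow> of_order P r (\<lambda>e z \<xi>. \<phi> e (z + (h e / 2) *\<^sub>R ex + (dt e / 2) *\<^sub>R et) \<xi>)"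
  using of_order_shift[OF of_order_shift[OF _ dt_half_lim, of P r \<phi> et] h_half_lim, of ex] by simp

lemma Fh_order: "kin (\<lambda>_. 1) Fh"
  unfolding Fh_def[abs_def] by (rule half_shift[OF F_order])

lemma Fh_expand: "kin k2 (\<lambda>e z \<xi>. Fh e z \<xi> - F e z \<xi> - h e / 2 * dd ex F e z \<xi> - dt e / 2 * dd et F e z \<xi>)"
proof -
  have 1: "kin k2 (\<lambda>e z \<xi>. F e (z + (h e / 2) *\<^sub>R ex + (dt e / 2) *\<^sub>R et) \<xi> - F e (z + (h e / 2) *\<^sub>R ex) \<xi>
      - dt e / 2 * dd et F e (z + (h e / 2) *\<^sub>R ex) \<xi>)"
    using of_order_shift[OF of_order_weaken[OF of_order_Taylor2[OF F_order _ basis(2) dt_half_lim] half_sq_O[OF dt_half_O]] h_half_lim, of ex]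
    by simp
  have 2: "kin \<kappa> (\<lambda>e z \<xi>. dd et F e (z + (h e / 2) *\<^sub>R ex) \<xi> - dd et F e z \<xi>)"
    by (rule of_order_weaken[OF of_order_Taylor1[OF Ft_order _ basis(1) h_half_lim]]) (use h_O in auto)
  have 3: "kin k2 (\<lambda>e z \<xi>. F e (z + (h e / 2) *\<^sub>R ex) \<xi> - F e z \<xi> - h e / 2 * dd ex F e z \<xi>)"
    by (rule of_order_weaken[OF of_order_Taylor2[OF F_order _ basis(1) h_half_lim] half_sq_O[OF h_half_O]]) simp
  show ?thesis
    by (rule of_order_cong[OF of_order_add[OF of_order_add[OF 1 kappa_mult_order[OF dt_half_O 2]] 3]])
       (auto intro!: always_eventually simp: Fh_def algebra_simps)
qed

text \<open>The interpolated data are transported along the characteristic instead of being advanced in time, hence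
the difference \<open>dt / 2\<close> times the transport derivative.\<close>

lemma upwind_F_expand: "kin k2 (upwind F \<ominus> Fh \<ominus> (\<lambda>e. - (dt e / 2)) \<odot> W)"
proof -
  have D: "kin \<kappa> (diff_quot ex h F \<ominus> dd ex F)"
    by (rule of_order_weaken[OF of_order_diff_quot2[OF F_order _ basis(1) h_lim h_nz]]) (use h_O in auto)
  show ?thesis
    by (rule of_order_cong[OF of_order_diff[OF of_order_diff[OF kappa_mult_order[OF h_half_O D]
            kappa_mult_order[OF dt_half_O xi_order[OF D]]] Fh_expand]])
       (use upwind_eq[of F] in \<open>eventually_elim, auto simp: W_def algebra_simps\<close>)
qed

text \<open>A difference by \<open>dt / 2\<close> times \<open>\<omega>\<close> is invisible to the moments up to \<open>O(\<kappa>\<^sup>2)\<close> if the moment of \<open>\<omega>\<close> is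
already \<open>O(\<kappa>)\<close>. It is applied to \<open>\<omega> = W\<close> and to \<open>\<omega> = \<xi> W\<close>, by the conservation laws.\<close>

lemma moment_half_order:
  assumes "kin (\<lambda>_. 1) \<phi>" "kin (\<lambda>_. 1) \<psi>" "kin (\<lambda>_. 1) \<omega>" "hyd \<kappa> (moment \<omega>)"
    and E: "kin k2 (\<phi> \<ominus> \<psi> \<ominus> (\<lambda>e. - (dt e / 2)) \<odot> \<omega>)"
  shows "hyd k2 (moment \<phi> \<ominus> moment \<psi>)"
proof -
  have O: "(\<lambda>e. - (dt e / 2)) \<in> O[at_right 0](\<kappa>)" using dt_O by simp
  have "hyd k2 (moment (\<phi> \<ominus> \<psi> \<ominus> (\<lambda>e. - (dt e / 2)) \<odot> \<omega>) \<oplus> (\<lambda>e. - (dt e / 2)) \<odot> moment \<omega>)" (is "hyd _ ?X")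
    by (intro of_order_add of_order_moment E kappa_mult_order[OF O assms(4)])
  then show ?thesis
  proof (rule of_order_cong)
    show "agree ?X (moment \<phi> \<ominus> moment \<psi>)"
      using moment_diff[OF of_order_diff[OF assms(1,2)] of_order_scale[OF assms(3), of "\<lambda>e. - (dt e / 2)"]]
        moment_diff[OF assms(1,2)]
      unfolding moment_cmult[of "\<lambda>e. - (dt e / 2)" \<omega>]
      by eventually_elim auto
  qed
qed

lemma rhoG_half: "hyd k2 (\<rho>\<^sub>\<Gamma> \<ominus> moment Fh)"
  unfolding \<rho>\<^sub>\<Gamma>_def
  by (rule moment_half_order[OF upwind_order[OF F_order] Fh_order W_order moment_W_order(1) upwind_F_expand])

lemma mG_half: "hyd k2 (m\<^sub>\<Gamma> \<ominus> moment (xi Fh))"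
proof -
  have "kin k2 (upwind (xi F) \<ominus> xi Fh \<ominus> (\<lambda>e. - (dt e / 2)) \<odot> xi W)"
    by (rule of_order_cong[OF xi_order[OF upwind_F_expand]])
       (auto intro!: always_eventually simp: upwind_xi algebra_simps)
  from moment_half_order[OF upwind_order[OF xi_order[OF F_order]] xi_order[OF Fh_order] xi_order[OF W_order] moment_W_order(2) this]
  have "hyd k2 (moment (upwind (xi F)) \<ominus> moment (xi Fh) \<ominus> (\<lambda>e. a e * dt e / 2) \<odot> diff_quot ex h (moment (xi (xi Q))))"
    by (rule of_order_diff) (rule of_order_scale_weaken[OF xxQ_order[OF Q_order] a_dt_eps_O])
  then show ?thesis by (rule of_order_cong) (auto intro!: always_eventually simp: m\<^sub>\<Gamma>_def)
qed

lemma rho_half_ge: "\<forall>\<^sub>F (e, z) in \<G>. \<forall>\<xi>. c / 2 \<le> moment Fh e z \<xi>"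
  using eventually_germ_shift[OF eventually_germ_shift[OF half_le_rho dt_half_lim, of et] h_half_lim, of ex]
  by eventually_elim (auto simp: moment_def Fh_def)

lemma maxwell_half: "maxwell T (moment Fh) (moment (xi Fh)) e z \<xi> =
    Fh e z \<xi> + \<tau> * Q e (z + (h e / 2) *\<^sub>R ex + (dt e / 2) *\<^sub>R et) \<xi>"
proof -
  have "maxwell T (moment Fh) (moment (xi Fh)) e z \<xi> = M e (z + (h e / 2) *\<^sub>R ex + (dt e / 2) *\<^sub>R et) \<xi>"
    by (simp add: maxwell_def M_def moment_def Fh_def)
  then show ?thesis by (simp only: M_eq Fh_def)
qed

lemma MG_half: "kin k2 (M\<^sub>\<Gamma> \<ominus> maxwell T (moment Fh) (moment (xi Fh)))"
  unfolding M\<^sub>\<Gamma>_def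
  by (rule of_order_maxwell_diff[OF rhoG_order mG_order of_order_moment[OF Fh_order] of_order_moment[OF xi_order[OF Fh_order]]
       T_pos half_c_pos rhoG_ge rho_half_ge rhoG_half mG_half])

lemma eps_kappa_O: "(\<lambda>e. e * \<kappa> e) \<in> O[at_right 0](k2)"
  by (intro landau_o.big.mult eps_O) simp

lemma Q_half: "kin k2 (\<lambda>e z \<xi>. Q e (z + (h e / 2) *\<^sub>R ex + (dt e / 2) *\<^sub>R et) \<xi> - Q e z \<xi>)"
proof -
  have "kin k2 (\<lambda>e z \<xi>. Q e (z + (h e / 2) *\<^sub>R ex + (dt e / 2) *\<^sub>R et) \<xi> - Q e (z + (h e / 2) *\<^sub>R ex) \<xi>)"
    using of_order_shift[OF of_order_weaken[OF of_order_Taylor1[OF Q_order _ basis(2) dt_half_lim] landau_o.big.mult[OF dt_half_O eps_O]] h_half_lim, of ex]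
    by simp
  moreover have "kin k2 (\<lambda>e z \<xi>. Q e (z + (h e / 2) *\<^sub>R ex) \<xi> - Q e z \<xi>)"
    by (rule of_order_weaken[OF of_order_Taylor1[OF Q_order _ basis(1) h_half_lim] landau_o.big.mult[OF h_half_O eps_O]]) simp
  ultimately have "kin k2 (\<lambda>e z \<xi>. (Q e (z + (h e / 2) *\<^sub>R ex + (dt e / 2) *\<^sub>R et) \<xi> - Q e (z + (h e / 2) *\<^sub>R ex) \<xi>)
     + (Q e (z + (h e / 2) *\<^sub>R ex) \<xi> - Q e z \<xi>))" by (rule of_order_add)
  then show ?thesis by simp
qed

lemma MG_expand: "kin k2 (\<lambda>e z \<xi>. M\<^sub>\<Gamma> e z \<xi> - Fh e z \<xi> - \<tau> * (e * W e z \<xi>))"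
  by (rule of_order_cong[OF of_order_add[OF of_order_add[OF MG_half of_order_cmult[OF Q_half, of \<tau>]]
        of_order_cmult[OF of_order_weaken[OF Q_W_order eps_kappa_O], of \<tau>]]])
     (auto intro!: always_eventually simp: maxwell_half algebra_simps)

text \<open>Second-order accuracy of the interface value. Relative to \<open>Fh\<close>, the interpolated data contribute
\<open>- (dt / 2) W\<close>, their collision term \<open>a e W = (dt / 4) W\<close>, and the deviation of the interface Maxwellian
from \<open>Fh\<close> contributes \<open>b \<tau> e W = (dt / 4) W\<close>. The three terms cancel.\<close>

lemma Gamma_half: "kin k2 (\<Gamma> \<ominus> Fh)"
proof -
  have "(\<lambda>e. \<kappa> e * (a e * e)) \<in> O[at_right 0](k2)" by (intro landau_o.big.mult a_eps_O) simp
  then have O: "(\<lambda>e. a e * (\<kappa> e * e)) \<in> O[at_right 0](k2)" "(\<lambda>e. a e * (e * \<kappa> e)) \<in> O[at_right 0](k2)"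
    by (simp_all add: mult_ac)
  let ?X1 = "\<lambda>e z \<xi>. upwind F e z \<xi> - Fh e z \<xi> - (- (dt e / 2)) * W e z \<xi>"
  let ?X2 = "\<lambda>e z \<xi>. a e * (upwind Q e z \<xi> - Q e z \<xi>)" and ?X3 = "\<lambda>e z \<xi>. a e * (Q e z \<xi> - e * W e z \<xi>)"
  let ?X4 = "\<lambda>e z \<xi>. M\<^sub>\<Gamma> e z \<xi> - Fh e z \<xi> - \<tau> * (e * W e z \<xi>)"
  have "kin k2 (w \<odot> (?X1 \<oplus> ?X2 \<oplus> ?X3) \<oplus> (\<lambda>e. w e * b e) \<odot> ?X4)"
    by (rule of_order_add[OF of_order_scale1[OF w_O of_order_add[OF of_order_add[OF upwind_F_expand
          of_order_scale_weaken[OF upwind_diff_order[OF Q_order] O(1)]] of_order_scale_weaken[OF Q_W_order O(2)]]]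
          of_order_scale1[OF wb_O MG_expand]])
  then show ?thesis
  proof (rule of_order_cong)
    show "agree (w \<odot> (?X1 \<oplus> ?X2 \<oplus> ?X3) \<oplus> (\<lambda>e. w e * b e) \<odot> ?X4) (\<Gamma> \<ominus> Fh)"
      using Gamma_expand w_sum pos_germ
    proof eventually_elim
      case (elim ez)
      obtain e z where [simp]: "ez = (e, z)" by (cases ez)
      have ae: "a e * e = dt e / 4" using elim by (simp add: a_def)
      have be: "b e * (\<tau> * e) = dt e / 4" using elim \<tau>_pos by (simp add: a_def b_def)
      have "w e * (?X1 e z \<xi> + ?X2 e z \<xi> + ?X3 e z \<xi>) + w e * b e * ?X4 e z \<xi> = \<Gamma> e z \<xi> - Fh e z \<xi>" for \<xi>
      proof -
        have "w e * (?X1 e z \<xi> + ?X2 e z \<xi> + ?X3 e z \<xi>) + w e * b e * ?X4 e z \<xi>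
           = (w e * upwind F e z \<xi> + w e * a e * upwind Q e z \<xi> + w e * b e * M\<^sub>\<Gamma> e z \<xi>)
             - (w e + w e * b e) * Fh e z \<xi>
             + w e * W e z \<xi> * (dt e / 2 - a e * e - b e * (\<tau> * e))"
          by (simp add: algebra_simps)
        then show ?thesis using elim by (simp add: ae be)
      qed
      then show ?case by simp
    qed
  qed
qed

lemma dd_W: "agree (dd et W) (dd et (dd et F) \<oplus> xi (dd ex (dd et F)))"
proof -
  have "has_dd et W (dd et (dd et F) \<oplus> xi (dd et (dd ex F)))"
    using has_dd_add[OF of_order_has_dd[OF Ft_order basis(2)]
        has_dd_mult[OF has_dd_param[of et "\<lambda>e \<xi>. \<xi>"] of_order_has_dd[OF Fx_order basis(2)]]]
    by (simp add: W_def[abs_def])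
  from has_dd_imp_dd[OF this] dd_commute[OF F_order UNIV_I basis] show ?thesis
    by eventually_elim auto
qed

text \<open>The one-sided quotient in time is centred at the half time step, and so is the flux difference by
\<open>Gamma_half\<close>; the correction \<open>(h / 2) F_xx\<close> of the backward quotient of \<open>F\<close> cancels against the one
coming from the shift by half a cell.\<close>

lemma L_W_expand: "kin k2 (L \<ominus> W \<ominus> (\<lambda>e. dt e / 2) \<odot> dd et W)"
proof -
  let ?B = "diff_quot ex (\<lambda>e. - h e)"
  let ?E = "\<lambda>e z \<xi>. Fh e z \<xi> - F e z \<xi> - h e / 2 * dd ex F e z \<xi> - dt e / 2 * dd et F e z \<xi>"
  have 1: "kin k2 (diff_quot et dt F \<ominus> dd et F \<ominus> (\<lambda>e. dt e / 2) \<odot> dd et (dd et F))"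
    by (rule of_order_weaken[OF of_order_diff_quot3[OF F_order _ basis(2) dt_lim dt_nz] half_sq_O[OF dt_O]]) simp
  have 2: "kin k2 (?B F \<ominus> dd ex F \<ominus> (\<lambda>e. (- h e) / 2) \<odot> dd ex (dd ex F))"
    by (rule of_order_weaken[OF of_order_diff_quot3[OF F_order _ basis(1) h_neg_lim h_neg_nz] half_sq_O[OF h_neg_O]]) simp
  have "kin k2 (\<lambda>e z \<xi>. (diff_quot et dt F e z \<xi> - dd et F e z \<xi> - dt e / 2 * dd et (dd et F) e z \<xi>)
      + \<xi> * (?B (\<Gamma> \<ominus> Fh) e z \<xi> + ?B ?E e z \<xi>
         + (?B F e z \<xi> - dd ex F e z \<xi> - (- h e) / 2 * dd ex (dd ex F) e z \<xi>)
         + h e / 2 * (?B (dd ex F) e z \<xi> - dd ex (dd ex F) e z \<xi>)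
         + dt e / 2 * (?B (dd et F) e z \<xi> - dd ex (dd et F) e z \<xi>)))" (is "kin _ ?X")
    by (intro of_order_add xi_order 1 2 back_quot Gamma_half Fh_expand kappa_mult_order[OF h_half_O back_quot2[OF Fx_order]]
        kappa_mult_order[OF dt_half_O back_quot2[OF Ft_order]])
  then show ?thesis
  proof (rule of_order_cong)
    have B: "?B (\<Gamma> \<ominus> Fh) e z \<xi> = ?B \<Gamma> e z \<xi> - ?B Fh e z \<xi>"
      "?B ?E e z \<xi>
       = ?B Fh e z \<xi> - ?B F e z \<xi> - h e / 2 * ?B (dd ex F) e z \<xi> - dt e / 2 * ?B (dd et F) e z \<xi>" for e z \<xi>
      by (simp_all add: diff_quot_def algebra_simps diff_divide_distrib add_divide_distrib)
    show "agree ?X (L \<ominus> W \<ominus> (\<lambda>e. dt e / 2) \<odot> dd et W)"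
      using dd_W unfolding B
      by eventually_elim (auto simp: L_def W_def algebra_simps)
  qed
qed

text \<open>Second-order consistency. By \<open>L_W_expand\<close>, \<open>L\<close> is \<open>W\<close> at the half time step, and the factor
\<open>1 - \<Delta> / 2\<close> in \<open>Q_eq\<close> moves it back to the beginning of the step.\<close>

lemma modified_equation: "kin (\<lambda>e. e * (\<kappa> e * \<kappa> e)) (Q \<ominus> (\<lambda>e. e) \<odot> W)"
proof -
  let ?R = "\<lambda>e z \<xi>. L e z \<xi> - W e z \<xi> - dt e / 2 * dd et W e z \<xi>"
  note Wt = of_order_dd[OF W_order basis(2)]
  have 1: "kin k2 (\<Delta> ?R)"
    by (rule of_order_weaken[OF \<Delta>_order[OF L_W_expand]]) (use landau_o.big.mult[OF dt_O1, of k2 k2] in simp)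
  have 2: "kin k2 (\<Delta> W \<ominus> dt \<odot> dd et W)"
    unfolding \<Delta>_def
    by (rule of_order_weaken[OF of_order_Taylor2[OF W_order _ basis(2) dt_lim] half_sq_O[OF dt_O]]) simp
  have "kin \<kappa> (\<Delta> (dd et W))"
    by (rule of_order_weaken[OF \<Delta>_order[OF Wt]]) (use dt_O in simp)
  then have 3: "kin k2 ((\<lambda>e. dt e / 2) \<odot> \<Delta> (dd et W))" by (rule kappa_mult_order[OF dt_half_O])
  have "(\<lambda>e. dt e * (dt e * e)) \<in> O[at_right 0](\<lambda>e. \<kappa> e * (\<kappa> e * e))"
    by (intro landau_o.big.mult dt_O) simp
  then have "(\<lambda>e. dt e * (dt e * e)) \<in> O[at_right 0](\<lambda>e. e * k2 e)" by (simp add: mult_ac)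
  then have "kin (\<lambda>e. e * k2 e) (\<lambda>e z \<xi>. e * (?R e z \<xi> - 1 / 2 * \<Delta> ?R e z \<xi>
      - 1 / 2 * (\<Delta> W e z \<xi> - dt e * dd et W e z \<xi>) - 1 / 2 * (dt e / 2 * \<Delta> (dd et W) e z \<xi>))
      + 1 / 4 * \<Delta> (\<Delta> Q) e z \<xi>)" (is "kin _ ?X")
    by (rule of_order_add[OF of_order_scale[OF of_order_diff[OF of_order_diff[OF of_order_diff[OF L_W_expand
         of_order_cmult[OF 1]] of_order_cmult[OF 2]] of_order_cmult[OF 3]]]
         of_order_cmult[OF of_order_weaken[OF \<Delta>_order[OF \<Delta>_order[OF Q_order]]]]])
  then show ?thesis
  proof (rule of_order_cong)
    have R: "\<Delta> ?R e z \<xi> = \<Delta> L e z \<xi> - \<Delta> W e z \<xi> - dt e / 2 * \<Delta> (dd et W) e z \<xi>" for e z \<xi>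
      by (simp add: \<Delta>_def algebra_simps)
    show "agree ?X (Q \<ominus> (\<lambda>e. e) \<odot> W)"
      using Q_eq unfolding R
    proof eventually_elim
      case (elim ez)
      obtain e z where ez[simp]: "ez = (e, z)" by (cases ez)
      have "Q e z \<xi> = e * (L e z \<xi> - 1 / 2 * \<Delta> L e z \<xi>) + 1 / 4 * \<Delta> (\<Delta> Q) e z \<xi>" for \<xi>
        using elim by simp
      then have "1 / 4 * \<Delta> (\<Delta> Q) e z \<xi> = Q e z \<xi> - e * (L e z \<xi> - 1 / 2 * \<Delta> L e z \<xi>)" for \<xi>
        by (simp add: eq_diff_eq)
      then show ?case by (simp only: ez split_conv) (simp add: field_simps)
    qed
  qed
qed

lemma modified_equation_at: "(\<lambda>e. Q e z0 \<xi> - e * W e z0 \<xi>) \<in> o[at_right 0](\<lambda>e. e ^ 2)"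
proof -
  obtain C where C: "weighted_le 0 C (\<lambda>e. e * (\<kappa> e * \<kappa> e)) (Q \<ominus> (\<lambda>e. e) \<odot> W)"
    using of_order_wbound[OF modified_equation] unfolding wbound_def by blast
  have "(\<lambda>e. Q e z0 \<xi> - e * W e z0 \<xi>) \<in> O[at_right 0](\<lambda>e. e * (\<kappa> e * \<kappa> e))"
    by (rule bigoI[of _ C]) (use eventually_germ_center[OF C] in \<open>eventually_elim, auto\<close>)
  also have "(\<lambda>e. e * (\<kappa> e * \<kappa> e)) \<in> o[at_right 0](\<lambda>e. e * e)"
    using kappa_sq by (intro landau_o.big_small_mult) (simp_all add: \<kappa>_def power2_eq_square)
  finally show ?thesis by (simp add: power2_eq_square)
qed

end

section \<open>Smooth flows\<close>

lemma Ck_on_cong: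
  assumes "open S" "\<And>z. z \<in> S \<Longrightarrow> F z = G z"
  shows "Ck_on k S F \<Longrightarrow> Ck_on k S G"
  using assms(2)
proof (induction k arbitrary: F G)
  case 0
  then show ?case using continuous_on_cong[of S S F G] by simp
next
  case (Suc k)
  have d: "frechet_derivative F (at z) = frechet_derivative G (at z)" "G differentiable (at z)" if "z \<in> S" for z
  proof -
    have F: "F differentiable (at z)" using Suc.prems that by auto
    show "frechet_derivative F (at z) = frechet_derivative G (at z)"
      by (rule frechet_derivative_transform_within_open[OF F assms(1) that]) (use Suc.prems in auto)
    show "G differentiable (at z)"
      using F has_derivative_transform_within_open[OF _ assms(1) that, of F] Suc.prems
      unfolding differentiable_def by blast
  qed
  show ?case unfolding Ck_on.simps
  proof (intro conjI ballI)
    fix b :: 'a assume b: "b \<in> Basis"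
    have "Ck_on k S (\<lambda>z. frechet_derivative F (at z) b)" using Suc.prems b by auto
    then show "Ck_on k S (\<lambda>z. frechet_derivative G (at z) b)" by (rule Suc.IH) (simp add: d)
  qed (use d in auto)
qed

lemma smooth_on_cong: "open S \<Longrightarrow> (\<And>z. z \<in> S \<Longrightarrow> F z = G z) \<Longrightarrow> smooth_on S F \<Longrightarrow> smooth_on S G"
  unfolding smooth_on_def using Ck_on_cong by blast

lemma smooth_on_differentiable: "smooth_on S F \<Longrightarrow> z \<in> S \<Longrightarrow> F differentiable (at z)"
  unfolding smooth_on_def using Ck_on.simps(2)[of 0 S F] by blast

lemma smooth_on_continuous: "smooth_on S F \<Longrightarrow> continuous_on S F"
  unfolding smooth_on_def using Ck_on.simps(1)[of S F] by blast

lemma smooth_on_partial: "smooth_on S F \<Longrightarrow> b \<in> Basis \<Longrightarrow> smooth_on S (\<lambda>z. frechet_derivative F (at z) b)"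
  unfolding smooth_on_def using Ck_on.simps(2) by blast

lemma Basis_real_pair: "Basis = {(1::real, 0::real), (0, 1)}"
  by (auto simp: Basis_prod_def)

lemma DERIV_partials:
  fixes g :: "real \<Rightarrow> real \<Rightarrow> real"
  assumes "(\<lambda>(x, t). g x t) differentiable (at (x, t))"
  shows "((\<lambda>y. g y t) has_real_derivative frechet_derivative (\<lambda>(x, t). g x t) (at (x, t)) (1, 0)) (at x)"
    and "(g x has_real_derivative frechet_derivative (\<lambda>(x, t). g x t) (at (x, t)) (0, 1)) (at t)"
proof -
  let ?D = "frechet_derivative (\<lambda>(x, t). g x t) (at (x, t))"
  have D: "((\<lambda>(x, t). g x t) has_derivative ?D) (at (x, t))"
    using assms by (simp add: frechet_derivative_works[symmetric])
  have lin: "linear ?D" by (rule linear_frechet_derivative[OF assms])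
  have "((\<lambda>y. (y, t)) has_derivative (\<lambda>h. (h, 0))) (at x)" by (auto intro!: derivative_eq_intros)
  from has_derivative_compose[OF this D]
  have 1: "((\<lambda>y. g y t) has_derivative (\<lambda>h. ?D (h, 0))) (at x)" by simp
  have "(\<lambda>h. ?D (h, 0)) = (\<lambda>h. ?D (1, 0) * h)"
  proof
    show "?D (h, 0) = ?D (1, 0) * h" for h using linear_scale[OF lin, of h "(1, 0)"] by simp
  qed
  from 1[unfolded this] show "((\<lambda>y. g y t) has_real_derivative ?D (1, 0)) (at x)" by (simp only: has_field_derivative_def)
  have "((\<lambda>y. (x, y)) has_derivative (\<lambda>h. (0, h))) (at t)" by (auto intro!: derivative_eq_intros)
  from has_derivative_compose[OF this D]
  have 2: "(g x has_derivative (\<lambda>h. ?D (0, h))) (at t)" by simp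
  have "(\<lambda>h. ?D (0, h)) = (\<lambda>h. ?D (0, 1) * h)"
  proof
    show "?D (0, h) = ?D (0, 1) * h" for h using linear_scale[OF lin, of h "(0, 1)"] by simp
  qed
  from 2[unfolded this] show "(g x has_real_derivative ?D (0, 1)) (at t)" by (simp only: has_field_derivative_def)
qed

lemma smooth_on_DERIV:
  assumes "smooth_on S (\<lambda>(x, t). g x t)" "(x, t) \<in> S"
  shows "((\<lambda>y. g y t) has_real_derivative Dx g x t) (at x)" "(g x has_real_derivative Dt g x t) (at t)"
  using DERIV_partials[OF smooth_on_differentiable[OF assms]] by (simp_all add: Dx_def Dt_def DERIV_imp_deriv)

lemma smooth_on_Dx_Dt:
  assumes "smooth_on S (\<lambda>(x, t). g x t)" "open S"
  shows "smooth_on S (\<lambda>(x, t). Dx g x t)" "smooth_on S (\<lambda>(x, t). Dt g x t)"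
proof -
  have eq: "frechet_derivative (\<lambda>(x, t). g x t) (at z) (1, 0) = (case z of (x, t) \<Rightarrow> Dx g x t)"
    "frechet_derivative (\<lambda>(x, t). g x t) (at z) (0, 1) = (case z of (x, t) \<Rightarrow> Dt g x t)" if "z \<in> S" for z
  proof -
    obtain x t where z: "z = (x, t)" by (cases z)
    show "frechet_derivative (\<lambda>(x, t). g x t) (at z) (1, 0) = (case z of (x, t) \<Rightarrow> Dx g x t)"
      "frechet_derivative (\<lambda>(x, t). g x t) (at z) (0, 1) = (case z of (x, t) \<Rightarrow> Dt g x t)"
      using DERIV_partials[OF smooth_on_differentiable[OF assms(1) that, unfolded z]] unfolding z
      by (simp_all add: Dx_def Dt_def DERIV_imp_deriv)
  qed
  show "smooth_on S (\<lambda>(x, t). Dx g x t)"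
    by (rule smooth_on_cong[OF assms(2) _ smooth_on_partial[OF assms(1), of "(1, 0)"]]) (auto simp: eq Basis_real_pair)
  show "smooth_on S (\<lambda>(x, t). Dt g x t)"
    by (rule smooth_on_cong[OF assms(2) _ smooth_on_partial[OF assms(1), of "(0, 1)"]]) (auto simp: eq Basis_real_pair)
qed

lemma Dt_Dx_commute:
  assumes g: "smooth_on S (\<lambda>(x, t). g x t)" and S: "open S" "(x, t) \<in> S"
  shows "Dt (Dx g) x t = Dx (Dt g) x t"
proof -
  obtain r where r: "r > 0" "\<And>z. dist z (x, t) < r \<Longrightarrow> z \<in> S"
    using S unfolding open_dist by blast
  have near: "(x + p, t + q) \<in> S" if "\<bar>p\<bar> < r / 2" "\<bar>q\<bar> < r / 2" for p q
  proof (rule r(2))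
    have "dist (x + p, t + q) (x, t) \<le> \<bar>p\<bar> + \<bar>q\<bar>"
      using norm_Pair_le[of p q] by (simp add: dist_norm)
    then show "dist (x + p, t + q) (x, t) < r" using that by simp
  qed
  note gx = smooth_on_Dx_Dt(1)[OF g S(1)] and gt = smooth_on_Dx_Dt(2)[OF g S(1)]
  have sh: "((\<lambda>p. f (c + p)) has_real_derivative d) (at p)" if "(f has_real_derivative d) (at (c + p))"
    for f :: "real \<Rightarrow> real" and c p d
    using DERIV_shift[of f d p c] that by (simp add: add.commute)
  have cont: "((\<lambda>(p, q). k (x + p) (t + q)) \<longlongrightarrow> k (x + 0) (t + 0)) (nhds (0, 0))"
    if "smooth_on S (\<lambda>(x, t). k x t)" for k :: "real \<Rightarrow> real \<Rightarrow> real"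
  proof -
    have "isCont (\<lambda>(x, t). k x t) (x, t)"
      using smooth_on_continuous[OF that] S continuous_on_eq_continuous_at by blast
    then have "((\<lambda>(x, t). k x t) \<longlongrightarrow> k x t) (nhds (x, t))"
      using tendsto_at_iff_tendsto_nhds[of "\<lambda>(x, t). k x t" "(x, t)"] by (simp add: isCont_def)
    moreover have "((\<lambda>z. (x, t) + z) \<longlongrightarrow> (x, t)) (nhds (0, 0))"
      by (rule tendsto_eq_intros filterlim_ident refl | simp)+
    ultimately have "((\<lambda>z. (\<lambda>(x, t). k x t) ((x, t) + z)) \<longlongrightarrow> k x t) (nhds (0, 0))"
      by (rule filterlim_compose)
    then show ?thesis by (simp add: case_prod_unfold)
  qed
  have "Dt (Dx g) (x + 0) (t + 0) = Dx (Dt g) (x + 0) (t + 0)"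
  proof (rule mixed_partials_eq[where d = "r / 2" and H = "\<lambda>p q. g (x + p) (t + q)"
       and Ha = "\<lambda>p q. Dx g (x + p) (t + q)" and Hb = "\<lambda>p q. Dt g (x + p) (t + q)"
       and Hab = "\<lambda>p q. Dt (Dx g) (x + p) (t + q)" and Hba = "\<lambda>p q. Dx (Dt g) (x + p) (t + q)"])
    fix p q :: real assume pq: "\<bar>p\<bar> < r / 2" "\<bar>q\<bar> < r / 2"
    note n = near[OF pq]
    show "((\<lambda>p. g (x + p) (t + q)) has_real_derivative Dx g (x + p) (t + q)) (at p)"
      by (rule sh[of "\<lambda>y. g y (t + q)"], rule smooth_on_DERIV(1)[OF g n])
    show "((\<lambda>q. g (x + p) (t + q)) has_real_derivative Dt g (x + p) (t + q)) (at q)"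
      by (rule sh, rule smooth_on_DERIV(2)[OF g n])
    show "((\<lambda>q. Dx g (x + p) (t + q)) has_real_derivative Dt (Dx g) (x + p) (t + q)) (at q)"
      by (rule sh, rule smooth_on_DERIV(2)[OF gx n])
    show "((\<lambda>p. Dt g (x + p) (t + q)) has_real_derivative Dx (Dt g) (x + p) (t + q)) (at p)"
      by (rule sh[of "\<lambda>y. Dt g y (t + q)"], rule smooth_on_DERIV(1)[OF gt n])
  next
    show "((\<lambda>(p, q). Dt (Dx g) (x + p) (t + q)) \<longlongrightarrow> Dt (Dx g) (x + 0) (t + 0)) (nhds (0, 0))"
      by (rule cont[OF smooth_on_Dx_Dt(2)[OF gx S(1)]])
    show "((\<lambda>(p, q). Dx (Dt g) (x + p) (t + q)) \<longlongrightarrow> Dx (Dt g) (x + 0) (t + 0)) (nhds (0, 0))"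
      by (rule cont[OF smooth_on_Dx_Dt(1)[OF gt S(1)]])
  qed (use r in simp)
  then show ?thesis by simp
qed

text \<open>All mixed derivatives of a smooth function are smooth; \<open>Dt_iterated\<close> below brings them into the order in
which smoothness of the flow bounds them.\<close>

lemma smooth_on_iterated:
  assumes g: "smooth_on (UNIV \<times> I) (\<lambda>(x, t). g x t)" and I: "open I"
  shows "smooth_on (UNIV \<times> I) (\<lambda>(x, t). (Dx ^^ a) ((Dt ^^ b) g) x t)"
proof -
  have S: "open (UNIV \<times> I :: (real \<times> real) set)" using I by (auto intro: open_Times)
  have "smooth_on (UNIV \<times> I) (\<lambda>(x, t). (Dt ^^ b) g x t)"
    by (induction b) (use g smooth_on_Dx_Dt(2)[OF _ S] in auto)
  then show ?thesis
    by (induction a) (use smooth_on_Dx_Dt(1)[OF _ S] in auto)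
qed

lemma Dt_iterated:
  assumes g: "smooth_on (UNIV \<times> I) (\<lambda>(x, t). g x t)" and I: "open I" "t \<in> I"
  shows "Dt ((Dx ^^ a) ((Dt ^^ b) g)) x t = (Dx ^^ a) ((Dt ^^ Suc b) g) x t"
  using I(2)
proof (induction a arbitrary: x)
  case (Suc a)
  have S: "open (UNIV \<times> I :: (real \<times> real) set)" using I by (auto intro: open_Times)
  have "Dt (Dx ((Dx ^^ a) ((Dt ^^ b) g))) x t = Dx (Dt ((Dx ^^ a) ((Dt ^^ b) g))) x t"
    by (rule Dt_Dx_commute[OF smooth_on_iterated[OF g I(1)] S]) (use I in simp)
  also have "\<dots> = Dx ((Dx ^^ a) ((Dt ^^ Suc b) g)) x t"
    unfolding Dx_def[of "Dt ((Dx ^^ a) ((Dt ^^ b) g))"] Dx_def[of "(Dx ^^ a) ((Dt ^^ Suc b) g)"]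
    using Suc by simp
  finally show ?case by simp
qed simp

text \<open>A derivative is a limit of a sequence of difference quotients.\<close>

lemma measurable_derivative_limit:
  fixes f :: "real \<Rightarrow> real \<Rightarrow> real"
  assumes m: "\<And>y. \<bar>y - yc\<bar> < r \<Longrightarrow> (\<lambda>\<xi>. f \<xi> y) \<in> borel_measurable borel" and "0 < r"
    and d: "\<And>\<xi>. (f \<xi> has_real_derivative f' \<xi>) (at yc)"
  shows "f' \<in> borel_measurable borel"
proof (rule borel_measurable_LIMSEQ_real)
  let ?h = "\<lambda>n::nat. (r / 2) / real (Suc n)"
  have h: "0 < ?h n" "?h n < r" for n
  proof -
    show "0 < ?h n" using \<open>0 < r\<close> by simp
    have "?h n \<le> (r / 2) / 1" by (rule divide_left_mono) (use \<open>0 < r\<close> in auto)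
    also have "\<dots> < r" using \<open>0 < r\<close> by simp
    finally show "?h n < r" .
  qed
  show "(\<lambda>\<xi>. (f \<xi> (yc + ?h n) - f \<xi> yc) / ?h n) \<in> borel_measurable borel" for n
  proof (rule borel_measurable_divide[OF borel_measurable_diff[OF m m] borel_measurable_const])
    show "\<bar>yc + ?h n - yc\<bar> < r" using h[of n] by (simp only: add_diff_cancel_left' abs_of_pos)
  qed (use \<open>0 < r\<close> in simp)
  have lim: "?h \<longlonglongrightarrow> 0"
    using tendsto_mult[OF tendsto_const[of "r / 2"] LIMSEQ_inverse_real_of_nat] by (simp only: divide_inverse mult_zero_right)
  have "filterlim ?h (at 0) sequentially"
  proof -
    have "?h n \<noteq> 0" for n using h(1)[of n] by linarith
    then show ?thesis unfolding filterlim_at using lim by simp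
  qed
  then show "(\<lambda>n. (f \<xi> (yc + ?h n) - f \<xi> yc) / ?h n) \<longlonglongrightarrow> f' \<xi>" for \<xi>
    using d[of \<xi>, unfolded DERIV_def] by (rule filterlim_compose[rotated])
qed

lemma measurable_iterated:
  fixes f :: "real \<Rightarrow> real \<Rightarrow> real \<Rightarrow> real"
  assumes sm: "\<And>\<xi>. smooth_on (UNIV \<times> I) (\<lambda>(x, t). f x \<xi> t)" and I: "open I"
    and m: "\<And>x t. t \<in> I \<Longrightarrow> (\<lambda>\<xi>. f x \<xi> t) \<in> borel_measurable borel"
    and "t \<in> I"
  shows "(\<lambda>\<xi>. (Dx ^^ a) ((Dt ^^ b) (\<lambda>x t. f x \<xi> t)) x t) \<in> borel_measurable borel"
  using \<open>t \<in> I\<close>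
proof (induction a arbitrary: x t)
  case 0
  then show ?case
  proof (induction b arbitrary: x t)
    case (Suc b)
    obtain r where r: "r > 0" "\<And>y. \<bar>y - t\<bar> < r \<Longrightarrow> y \<in> I"
      using I Suc.prems unfolding open_dist dist_real_def by blast
    have "(\<lambda>\<xi>. Dt ((Dt ^^ b) (\<lambda>x t. f x \<xi> t)) x t) \<in> borel_measurable borel"
    proof (rule measurable_derivative_limit[where f = "\<lambda>\<xi> t. (Dt ^^ b) (\<lambda>x t. f x \<xi> t) x t" and yc = t])
      show "(\<lambda>\<xi>. (Dt ^^ b) (\<lambda>x t. f x \<xi> t) x y) \<in> borel_measurable borel" if "\<bar>y - t\<bar> < r" for y
        using Suc.IH[OF r(2)[OF that]] by simp
      show "((Dt ^^ b) (\<lambda>x t. f x \<xi> t) x has_real_derivative Dt ((Dt ^^ b) (\<lambda>x t. f x \<xi> t)) x t) (at t)" for \<xi>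
        using smooth_on_DERIV(2)[OF smooth_on_iterated[OF sm I, of 0 b \<xi>], of x t] Suc.prems by simp
    qed (rule r)
    then show ?case by simp
  qed (use m in simp)
next
  case (Suc a)
  have "(\<lambda>\<xi>. Dx ((Dx ^^ a) ((Dt ^^ b) (\<lambda>x t. f x \<xi> t))) x t) \<in> borel_measurable borel"
  proof (rule measurable_derivative_limit[where f = "\<lambda>\<xi> x. (Dx ^^ a) ((Dt ^^ b) (\<lambda>x t. f x \<xi> t)) x t" and yc = x and r = 1])
    show "((\<lambda>x. (Dx ^^ a) ((Dt ^^ b) (\<lambda>x t. f x \<xi> t)) x t) has_real_derivative Dx ((Dx ^^ a) ((Dt ^^ b) (\<lambda>x t. f x \<xi> t))) x t) (at x)" for \<xi>
      using smooth_on_DERIV(1)[OF smooth_on_iterated[OF sm I, of a b \<xi>], of x t] Suc.prems by simp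
  qed (use Suc in auto)
  then show ?case by simp
qed

lemma DERIV_at_shift0:
  fixes f :: "real \<Rightarrow> real"
  shows "(f has_real_derivative d) (at x) \<Longrightarrow> ((\<lambda>y. f (x + y)) has_real_derivative d) (at 0)"
  using DERIV_shift[of f d 0 x] by (simp add: add.commute)

text \<open>The mixed derivatives \<open>Dx\<^sup>a Dt\<^sup>b f\<close>, with all spatial derivatives taken last, form a class of bounded
families that is closed under differentiation: a further derivative in time may be moved inside.\<close>

lemma smooth_flow_of_order:
  assumes flow: "smooth_flow \<epsilon>\<^sub>0 {0<..<tend} f" and "0 < \<epsilon>\<^sub>0" and s: "s \<in> {0<..<tend}"
  shows "germ.of_order (x0, s) UNIV (\<lambda>_. 1) (\<lambda>e z \<xi>. f e (fst z) \<xi> (snd z))"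
proof -
  interpret germ "(x0, s)" .
  let ?I = "{0<..<tend}"
  let ?P = "\<lambda>a b e (z::real \<times> real) \<xi>. (Dx ^^ a) ((Dt ^^ b) (\<lambda>x t. f e x \<xi> t)) (fst z) (snd z)"
  have I: "open ?I" by simp
  have sm: "smooth_on (UNIV \<times> ?I) (\<lambda>(x, t). f e x \<xi> t)" if "e \<in> {0<..<\<epsilon>\<^sub>0}" for e \<xi>
    using flow that unfolding smooth_flow_def by blast
  have me: "(\<lambda>\<xi>. f e x \<xi> t) \<in> borel_measurable borel" if "e \<in> {0<..<\<epsilon>\<^sub>0}" "t \<in> ?I" for e x t
  proof -
    have "integrable lborel (\<lambda>\<xi>. f e x \<xi> t)" using flow that unfolding smooth_flow_def by blast
    from borel_measurable_integrable[OF this] show ?thesis by simp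
  qed
  define r where "r = min s (tend - s) / 2"
  have r: "0 < r" "r < s" "r < tend - s" using s by (auto simp: r_def min_def)
  have nbhd: "\<bar>fst z - x0\<bar> \<le> dist z (x0, s)" "\<bar>snd z - s\<bar> \<le> dist z (x0, s)" for z
    using dist_fst_le[of z "(x0, s)"] dist_snd_le[of z "(x0, s)"] by (simp_all add: dist_real_def)
  have near: "\<forall>\<^sub>F (e, z) in \<G>. e \<in> {0<..<\<epsilon>\<^sub>0} \<and> \<bar>fst z - x0\<bar> \<le> 1 \<and> \<bar>snd z - s\<bar> \<le> r"
    unfolding eventually_germ
  proof (intro exI[of _ "min \<epsilon>\<^sub>0 (min 1 r)"] conjI allI impI)
    fix e and z :: "real \<times> real" assume "0 < e" "e < min \<epsilon>\<^sub>0 (min 1 r)" "dist z (x0, s) < min \<epsilon>\<^sub>0 (min 1 r)"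
    then show "case (e, z) of (e, z) \<Rightarrow> e \<in> {0<..<\<epsilon>\<^sub>0} \<and> \<bar>fst z - x0\<bar> \<le> 1 \<and> \<bar>snd z - s\<bar> \<le> r"
      using nbhd[of z] by auto
  qed (use r \<open>0 < \<epsilon>\<^sub>0\<close> in auto)
  have inI: "t \<in> ?I" if "\<bar>t - s\<bar> \<le> r" for t using that r by auto
  have wb: "wbound UNIV (\<lambda>_. 1) (?P a b)" for a b
    unfolding wbound_def
  proof (intro conjI ballI)
    fix p :: nat
    let ?K = "{x0 - 1..x0 + 1} \<times> {s - r..s + r}"
    have "compact ?K" by (intro compact_Times) auto
    moreover have "?K \<subseteq> UNIV \<times> ?I" using r by auto
    ultimately obtain C where "\<forall>\<^sub>F e in at_right 0. \<forall>(x, t)\<in>?K. \<forall>\<xi>.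
        \<bar>\<xi>\<bar> ^ p * \<bar>(Dx ^^ a) ((Dt ^^ b) (\<lambda>x t. f e x \<xi> t)) x t\<bar> \<le> C"
      using flow unfolding smooth_flow_def by meson
    from eventually_germ_param[OF this] near
    have "weighted_le p C (\<lambda>_. 1) (?P a b)"
    proof eventually_elim
      case (elim ez)
      obtain e x t where ez: "ez = (e, x, t)" by (cases ez)
      have "(x, t) \<in> ?K" using elim unfolding ez by auto
      then show ?case using elim unfolding ez by auto
    qed
    then show "\<exists>C. weighted_le p C (\<lambda>_. 1) (?P a b)" by blast
  next
    show "near_measurable (?P a b)"
      using near
    proof eventually_elim
      case (elim ez)
      obtain e z where ez: "ez = (e, z)" by (cases ez)
      show ?case unfolding ez split_conv
        by (rule measurable_iterated[OF sm I me]) (use elim inI in \<open>auto simp: ez\<close>)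
    qed
  qed
  show ?thesis
  proof (rule of_orderI[where X = "\<lambda>\<phi>. \<exists>a b. \<phi> = ?P a b"])
    show "\<exists>a b. (\<lambda>e z \<xi>. f e (fst z) \<xi> (snd z)) = ?P a b" by (intro exI[of _ 0]) simp
    fix \<phi> and v :: "real \<times> real" assume "\<exists>a b. \<phi> = ?P a b"
    then obtain a b where \<phi>: "\<phi> = ?P a b" by blast
    show "wbound UNIV (\<lambda>_. 1) \<phi>" unfolding \<phi> by (rule wb)
    assume "v \<in> Basis"
    then consider "v = (1, 0)" | "v = (0, 1)" by (auto simp: Basis_real_pair)
    then show "\<exists>\<psi>. has_dd v \<phi> \<psi> \<and> (\<exists>a b. \<psi> = ?P a b)"
    proof cases
      case 1
      have "has_dd v \<phi> (?P (Suc a) b)"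
        unfolding has_dd_def using near
      proof eventually_elim
        case (elim ez)
        obtain e z where ez: "ez = (e, z)" by (cases ez)
        have z: "e \<in> {0<..<\<epsilon>\<^sub>0}" "snd z \<in> ?I" using elim inI ez by auto
        have "((\<lambda>y. (Dx ^^ a) ((Dt ^^ b) (\<lambda>x t. f e x \<xi> t)) (fst z + y) (snd z)) has_real_derivative ?P (Suc a) b e z \<xi>) (at 0)" for \<xi>
          using smooth_on_DERIV(1)[OF smooth_on_iterated[OF sm[OF z(1), of \<xi>] I], of "fst z" "snd z" a b] z
          by (intro DERIV_at_shift0) (auto simp: mem_Times_iff)
        then show ?case by (simp add: ez \<phi> 1)
      qed
      then show ?thesis by blast
    next
      case 2
      have "has_dd v \<phi> (?P a (Suc b))"
        unfolding has_dd_def using near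
      proof eventually_elim
        case (elim ez)
        obtain e z where ez: "ez = (e, z)" by (cases ez)
        have z: "e \<in> {0<..<\<epsilon>\<^sub>0}" "snd z \<in> ?I" using elim inI ez by auto
        have "((\<lambda>y. (Dx ^^ a) ((Dt ^^ b) (\<lambda>x t. f e x \<xi> t)) (fst z) (snd z + y)) has_real_derivative ?P a (Suc b) e z \<xi>) (at 0)" for \<xi>
          using smooth_on_DERIV(2)[OF smooth_on_iterated[OF sm[OF z(1), of \<xi>] I], of "fst z" "snd z" a b]
            Dt_iterated[OF sm[OF z(1), of \<xi>] I z(2), of a b "fst z"] z
          by (intro DERIV_at_shift0) (auto simp: mem_Times_iff)
        then show ?case by (simp add: ez \<phi> 2)
      qed
      then show ?thesis by blast
    qed
  qed
qed

section \<open>Step sizes, and the scheme at a point of the flow\<close>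

lemma powr_smallo_at_0:
  fixes p q :: real
  assumes "q < p"
  shows "(\<lambda>e. e powr p) \<in> o[at_right 0](\<lambda>e. e powr q)"
proof (rule smalloI_tendsto)
  have "((\<lambda>e::real. e powr (p - q)) \<longlongrightarrow> 0) (at_right 0)"
    by (rule tendsto_zero_powrI[where b = "p - q"])
       (use assms in \<open>auto intro!: tendsto_eq_intros simp: eventually_at_right_less eventually_at_filter\<close>)
  moreover have "\<forall>\<^sub>F e::real in at_right 0. e powr (p - q) = e powr p / e powr q"
    by (simp add: powr_diff)
  ultimately show "((\<lambda>e::real. e powr p / e powr q) \<longlongrightarrow> 0) (at_right 0)"
    by (rule Lim_transform_eventually)
  show "\<forall>\<^sub>F e::real in at_right 0. e powr q \<noteq> 0"
    using eventually_at_right_less[of "0::real"] by eventually_elim auto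
qed

lemma step_tendsto_0:
  assumes "f \<in> \<Theta>[at_right 0](\<lambda>e::real. e powr p)" "0 < p"
  shows "(f \<longlongrightarrow> (0::real)) (at_right 0)"
proof -
  have "f \<in> o[at_right 0](\<lambda>e. e powr 0)"
    by (rule landau_o.big_small_trans[OF bigthetaD1[OF assms(1)] powr_smallo_at_0[OF assms(2)]])
  from smalloD_tendsto[OF this] have "((\<lambda>e. f e / e powr 0) \<longlongrightarrow> 0) (at_right 0)" .
  moreover have "\<forall>\<^sub>F e::real in at_right 0. f e / e powr 0 = f e"
    using eventually_at_right_less[of "0::real"] by eventually_elim simp
  ultimately show ?thesis by (rule Lim_transform_eventually)
qed

text \<open>The time step dominates the Knudsen number because its exponent is less than 1.\<close>

lemma eps_le_step:
  assumes "f \<in> \<Theta>[at_right 0](\<lambda>e::real. e powr p)" "p < 1"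
  shows "(\<lambda>e. e) \<in> O[at_right 0](f :: real \<Rightarrow> real)"
proof -
  have "(\<lambda>e::real. e powr 1) \<in> O[at_right 0](f)"
    by (rule landau_o.big_trans[OF landau_o.small_imp_big[OF powr_smallo_at_0[OF assms(2)]]
          bigthetaD1[OF assms(1)[THEN bigtheta_sym[THEN iffD1]]]])
  moreover have "\<forall>\<^sub>F e::real in at_right 0. e powr 1 = e"
    using eventually_at_right_less[of "0::real"] by eventually_elim simp
  ultimately show ?thesis using landau_o.big.in_cong[of "\<lambda>e. e powr 1" "\<lambda>e. e" "at_right 0" f] by simp
qed

text \<open>Exponents larger than 1/2 make the squares of the steps negligible against the Knudsen number.\<close>

lemma steps_square_smallo:
  assumes "f \<in> \<Theta>[at_right 0](\<lambda>e::real. e powr p)" "1 / 2 < p"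
    and "g \<in> \<Theta>[at_right 0](\<lambda>e::real. e powr q)" "1 / 2 < q"
  shows "(\<lambda>e. (f e + g e :: real)\<^sup>2) \<in> o[at_right 0](\<lambda>e. e)"
proof -
  have "f \<in> o[at_right 0](\<lambda>e. e powr (1/2))" "g \<in> o[at_right 0](\<lambda>e. e powr (1/2))"
    by (rule landau_o.big_small_trans[OF bigthetaD1[OF assms(1)] powr_smallo_at_0[OF assms(2)]])
       (rule landau_o.big_small_trans[OF bigthetaD1[OF assms(3)] powr_smallo_at_0[OF assms(4)]])
  then have "(\<lambda>e. f e + g e) \<in> o[at_right 0](\<lambda>e. e powr (1/2))" by (rule sum_in_smallo)
  then have "(\<lambda>e. (f e + g e) * (f e + g e)) \<in> o[at_right 0](\<lambda>e. e powr (1/2) * e powr (1/2))"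
    by (intro landau_o.small_mult)
  moreover have "\<forall>\<^sub>F e::real in at_right 0. e powr (1/2) * e powr (1/2) = e"
    using eventually_at_right_less[of "0::real"] by eventually_elim (simp flip: powr_add)
  ultimately show ?thesis
    using landau_o.small.cong[of "\<lambda>e::real. e powr (1/2) * e powr (1/2)" "\<lambda>e. e" "at_right 0"]
    by (simp add: power2_eq_square)
qed

text \<open>Apart from unfolding the scheme at the points near \<open>(x0, s)\<close>, what has to be shown is that the density
stays away from zero for all small parameters. At \<open>(x0, s)\<close> it is the same positive number for all of
them, and its derivatives are bounded independently of the parameter.\<close>

lemma dugks_germI:
  fixes f g :: "real \<Rightarrow> real \<Rightarrow> real \<Rightarrow> real \<Rightarrow> real" and \<Delta>t \<Delta>x :: "real \<Rightarrow> real"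
  assumes "0 < \<tau>" and "0 < T" and "0 < \<epsilon>\<^sub>0"
    and alpha: "1 / 2 < \<alpha>" "\<alpha> < 1" and beta: "1 / 2 < \<beta>" "\<beta> < 1"
    and steps_pos: "\<And>e. e \<in> {0<..<\<epsilon>\<^sub>0} \<Longrightarrow> 0 < \<Delta>t e \<and> 0 < \<Delta>x e"
    and time_step: "\<Delta>t \<in> \<Theta>[at_right 0](\<lambda>e. e powr \<alpha>)"
    and cell_size: "\<Delta>x \<in> \<Theta>[at_right 0](\<lambda>e. e powr \<beta>)"
    and scheme: "\<And>e. e \<in> {0<..<\<epsilon>\<^sub>0} \<Longrightarrow>
                   dugks_solution \<tau> T e (\<Delta>t e) (\<Delta>x e) {0<..<tend} (f e) (g e)"
    and smooth: "smooth_flow \<epsilon>\<^sub>0 {0<..<tend} f"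
    and s: "s \<in> {0<..<tend}" and rho0: "\<And>e. e \<in> {0<..<\<epsilon>\<^sub>0} \<Longrightarrow> rho (f e) x0 s = \<rho>0"
  shows "dugks_germ (x0, s) \<tau> T (\<rho>0 / 2) \<Delta>t \<Delta>x (\<lambda>e z \<xi>. f e (fst z) \<xi> (snd z))
           (\<lambda>e z \<xi>. g e (fst z + \<Delta>x e / 2) \<xi> (snd z + \<Delta>t e / 2))"
proof -
  interpret germ "(x0, s)" .
  let ?I = "{0<..<tend}"
  let ?F = "\<lambda>e z \<xi>. f e (fst z) \<xi> (snd z)"
  have \<rho>0: "0 < \<rho>0"
    using smooth rho0[of "\<epsilon>\<^sub>0 / 2"] s \<open>0 < \<epsilon>\<^sub>0\<close> unfolding smooth_flow_def by (auto dest!: bspec[of _ _ "\<epsilon>\<^sub>0 / 2"])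
  have F: "kin (\<lambda>_. 1) ?F" by (rule smooth_flow_of_order[OF smooth \<open>0 < \<epsilon>\<^sub>0\<close> s])
  have mom: "moment ?F e z \<xi> = rho (f e) (fst z) (snd z)" for e z \<xi>
    by (simp add: moment_def rho_def mass_density_def)
  have dt0: "(\<Delta>t \<longlongrightarrow> 0) (at_right 0)" and h0: "(\<Delta>x \<longlongrightarrow> 0) (at_right 0)"
    using step_tendsto_0[OF time_step] step_tendsto_0[OF cell_size] alpha beta by auto
  have eps: "\<forall>\<^sub>F e in at_right 0. e \<in> {0<..<\<epsilon>\<^sub>0}"
    unfolding eventually_at_right_field using \<open>0 < \<epsilon>\<^sub>0\<close> by auto
  have time: "\<forall>\<^sub>F (e, z) in \<G>. snd z \<in> ?I"
    unfolding eventually_germ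
  proof (intro exI[of _ "min s (tend - s)"] conjI allI impI)
    fix e and z :: "real \<times> real" assume "dist z (x0, s) < min s (tend - s)"
    then show "case (e, z) of (e, z) \<Rightarrow> snd z \<in> ?I"
      using dist_snd_le[of z "(x0, s)"] by (auto simp: dist_real_def)
  qed (use s in auto)
  have near: "\<forall>\<^sub>F (e, z) in \<G>. e \<in> {0<..<\<epsilon>\<^sub>0} \<and> snd z \<in> ?I \<and> snd z + \<Delta>t e \<in> ?I"
    using eventually_germ_param[OF eps] time eventually_germ_shift[OF time dt0, of "(0, 1)"]
    by eventually_elim auto
  show ?thesis
  proof (unfold_locales)
    show "0 < \<tau>" "0 < T" "0 < \<rho>0 / 2" using assms(1,2) \<rho>0 by auto
    show "kin (\<lambda>_. 1) ?F" by (rule F)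
    show "\<forall>\<^sub>F e in at_right 0. 0 < \<Delta>t e \<and> 0 < \<Delta>x e"
      using eps by eventually_elim (rule steps_pos)
    show "(\<Delta>t \<longlongrightarrow> 0) (at_right 0)" "(\<Delta>x \<longlongrightarrow> 0) (at_right 0)" by fact+
    show "(\<lambda>e. e) \<in> O[at_right 0](\<Delta>t)" by (rule eps_le_step[OF time_step alpha(2)])
    show "(\<lambda>e. (\<Delta>t e + \<Delta>x e)\<^sup>2) \<in> o[at_right 0](\<lambda>e. e)"
      by (rule steps_square_smallo[OF time_step alpha(1) cell_size beta(1)])
    show "\<forall>\<^sub>F (e, z) in \<G>. \<forall>\<xi>. \<rho>0 / 2 \<le> moment ?F e z \<xi>"
    proof -
      have B: "(1, 0) \<in> (Basis :: (real \<times> real) set)" "(0, 1) \<in> (Basis :: (real \<times> real) set)"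
        by (simp_all add: Basis_real_pair)
      note m = of_order_moment[OF F]
      obtain C1 d1 where d1: "d1 > 0" "\<And>e z y \<xi>. 0 < e \<Longrightarrow> e < d1 \<Longrightarrow> dist z (x0, s) < d1 \<Longrightarrow> \<bar>y\<bar> < d1 \<Longrightarrow>
          \<bar>moment ?F e (z + y *\<^sub>R (1, 0)) \<xi> - moment ?F e z \<xi>\<bar> \<le> C1 * \<bar>1\<bar> * \<bar>y\<bar>"
        using of_order_lipschitz[OF m singletonI B(1)] by blast
      obtain C2 d2 where d2: "d2 > 0" "\<And>e z y \<xi>. 0 < e \<Longrightarrow> e < d2 \<Longrightarrow> dist z (x0, s) < d2 \<Longrightarrow> \<bar>y\<bar> < d2 \<Longrightarrow>
          \<bar>moment ?F e (z + y *\<^sub>R (0, 1)) \<xi> - moment ?F e z \<xi>\<bar> \<le> C2 * \<bar>1\<bar> * \<bar>y\<bar>"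
        using of_order_lipschitz[OF m singletonI B(2)] by blast
      define C where "C = \<bar>C1\<bar> + \<bar>C2\<bar> + 1"
      \<comment> \<open>Within distance \<open>d\<close> the density changes by at most \<open>C d\<close>, half of its value.\<close>
      define d where "d = min (min d1 d2) (min \<epsilon>\<^sub>0 (\<rho>0 / (2 * C)))"
      have C: "C > 0" by (simp add: C_def)
      have d: "d > 0" "d \<le> d1" "d \<le> d2" "d \<le> \<epsilon>\<^sub>0" "d \<le> \<rho>0 / (2 * C)"
        using d1(1) d2(1) \<open>0 < \<epsilon>\<^sub>0\<close> \<rho>0 C by (auto simp: d_def)
      have "\<rho>0 / 2 \<le> moment ?F e z \<xi>" if e: "0 < e" "e < d" and z: "dist z (x0, s) < d" for e z \<xi>
      proof -
        define p q where "p = fst z - x0" and "q = snd z - s"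
        have pq: "\<bar>p\<bar> < d" "\<bar>q\<bar> < d" "z = (x0, s) + p *\<^sub>R (1, 0) + q *\<^sub>R (0, 1)"
          using dist_fst_le[of z "(x0, s)"] dist_snd_le[of z "(x0, s)"] z
          by (auto simp: p_def q_def dist_real_def prod_eq_iff)
        have "\<bar>moment ?F e ((x0, s) + p *\<^sub>R (1, 0)) \<xi> - moment ?F e (x0, s) \<xi>\<bar> \<le> \<bar>C1\<bar> * d"
          using d1(2)[of e "(x0, s)" p \<xi>] e d pq by (auto intro: order_trans[OF _ mult_mono])
        moreover have "dist ((x0, s) + p *\<^sub>R (1, 0)) (x0, s) < d2"
          using pq d by (simp add: dist_norm)
        then have "\<bar>moment ?F e z \<xi> - moment ?F e ((x0, s) + p *\<^sub>R (1, 0)) \<xi>\<bar> \<le> \<bar>C2\<bar> * d"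
          unfolding pq(3) using d2(2)[of e "(x0, s) + p *\<^sub>R (1, 0)" q \<xi>] e d pq(1,2)
          by (auto intro: order_trans[OF _ mult_mono])
        moreover have "moment ?F e (x0, s) \<xi> = \<rho>0" using rho0 e d by (simp add: mom)
        moreover have "\<bar>C1\<bar> * d + \<bar>C2\<bar> * d \<le> \<rho>0 / 2"
        proof -
          have "\<bar>C1\<bar> * d + \<bar>C2\<bar> * d \<le> C * d" using d(1) by (simp add: C_def distrib_right)
          also have "\<dots> \<le> C * (\<rho>0 / (2 * C))" using d(5) C by (intro mult_left_mono) auto
          finally show ?thesis using C by simp
        qed
        ultimately show ?thesis by linarith
      qed
      then show ?thesis unfolding eventually_germ using d(1) by (intro exI[of _ d]) auto
    qed
    show "\<forall>\<^sub>F (e, z) in \<G>. \<forall>\<xi>. g e (fst z + \<Delta>x e / 2) \<xi> (snd z + \<Delta>t e / 2) =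
          (1 / 2 - \<xi> * \<Delta>t e / (2 * \<Delta>x e)) *
             (?F e (z + \<Delta>x e *\<^sub>R (1, 0)) \<xi> + \<Delta>t e / (4 * e) * collision \<tau> T (?F e (z + \<Delta>x e *\<^sub>R (1, 0))) \<xi>)
        + (1 / 2 + \<xi> * \<Delta>t e / (2 * \<Delta>x e)) *
             (?F e z \<xi> + \<Delta>t e / (4 * e) * collision \<tau> T (?F e z) \<xi>)
        + \<Delta>t e / (4 * e) * collision \<tau> T (\<lambda>\<xi>. g e (fst z + \<Delta>x e / 2) \<xi> (snd z + \<Delta>t e / 2)) \<xi>"
      using near
    proof eventually_elim
      case (elim ez)
      obtain e x t where ez: "ez = (e, x, t)" by (cases ez)
      have I: "dugks_interface \<tau> T e (\<Delta>t e) (\<Delta>x e) ?I (f e) (g e)"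
        using scheme[of e] elim ez unfolding dugks_solution_def by auto
      have t: "t \<in> ?I" "t + \<Delta>t e \<in> ?I" using elim ez by auto
      show ?case unfolding ez
        by (simp only: split_conv scaleR_Pair add_Pair real_scaleR_def mult_1_right mult_zero_right add_0_right
              fst_conv snd_conv) (intro allI I[unfolded dugks_interface_def, rule_format] t)
    qed
    show "\<forall>\<^sub>F (e, z) in \<G>. \<forall>\<xi>.
        (?F e (z + \<Delta>t e *\<^sub>R (0, 1)) \<xi> - ?F e z \<xi>) / \<Delta>t e
        + \<xi> * ((g e (fst z + \<Delta>x e / 2) \<xi> (snd z + \<Delta>t e / 2)
             - g e (fst (z + (- \<Delta>x e) *\<^sub>R (1, 0)) + \<Delta>x e / 2) \<xi> (snd (z + (- \<Delta>x e) *\<^sub>R (1, 0)) + \<Delta>t e / 2)) / \<Delta>x e)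
        = 1 / (2 * e) * (collision \<tau> T (?F e z) \<xi> + collision \<tau> T (?F e (z + \<Delta>t e *\<^sub>R (0, 1))) \<xi>)"
      using near
    proof eventually_elim
      case (elim ez)
      obtain e x t where ez: "ez = (e, x, t)" by (cases ez)
      have "dugks_update \<tau> T e (\<Delta>t e) (\<Delta>x e) ?I (f e) (g e)"
        using scheme[of e] elim ez unfolding dugks_solution_def by auto
      then have "(f e x \<xi> (t + \<Delta>t e) - f e x \<xi> t) / \<Delta>t e
        + \<xi> * ((g e (x + \<Delta>x e / 2) \<xi> (t + \<Delta>t e / 2) - g e (x - \<Delta>x e / 2) \<xi> (t + \<Delta>t e / 2)) / \<Delta>x e)
        = 1 / (2 * e) * (collision \<tau> T (\<lambda>\<eta>. f e x \<eta> t) \<xi> + collision \<tau> T (\<lambda>\<eta>. f e x \<eta> (t + \<Delta>t e)) \<xi>)" for \<xi>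
        using elim unfolding dugks_update_def ez by auto
      moreover have "x + - \<Delta>x e + \<Delta>x e / 2 = x - \<Delta>x e / 2" by simp
      ultimately show ?case unfolding ez by simp
    qed
  qed
qed

section \<open>Derivatives along jets\<close>

lemma iter_deriv_eq_Dx: "(deriv ^^ n) (\<lambda>y. k y t) x = (Dx ^^ n) k x t"
proof (induction n arbitrary: x)
  case (Suc n)
  have "(deriv ^^ n) (\<lambda>y. k y t) = (\<lambda>y. (Dx ^^ n) k y t)" using Suc by auto
  then show ?case by (simp add: Dx_def[of "(Dx ^^ n) k"])
qed simp

lemma jet_time_derivative:
  fixes ord :: "'m::finite \<Rightarrow> nat"
  assumes r: "\<And>i. ((\<lambda>t. (Dx ^^ ord i) (rho F) x t) has_real_derivative a i) (at s)"
    and v: "\<And>i. ((\<lambda>t. (Dx ^^ ord i) (vel F) x t) has_real_derivative b i) (at s)"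
  shows "((\<lambda>t. hjet ord F x t) has_derivative (\<lambda>h. h *\<^sub>R (\<chi> i. (a i, b i)))) (at s)"
proof (rule has_derivative_componentwise_within[THEN iffD2], rule ballI)
  fix w :: "(real \<times> real) ^ 'm" assume "w \<in> Basis"
  then obtain i and e :: "real \<times> real" where w: "w = axis i e" "e \<in> Basis" by (auto simp: Basis_vec_def)
  have J: "hjet ord F x t \<bullet> w = ((Dx ^^ ord i) (rho F) x t, (Dx ^^ ord i) (vel F) x t) \<bullet> e" for t
    by (simp add: w jet_def full_jet_def inner_axis iter_deriv_eq_Dx)
  have D: "(h *\<^sub>R (\<chi> i. (a i, b i))) \<bullet> w = h * ((a i, b i) \<bullet> e)" for h
    by (simp add: w inner_axis del: scaleR_Pair)
  show "((\<lambda>t. hjet ord F x t \<bullet> w) has_derivative (\<lambda>h. (h *\<^sub>R (\<chi> i. (a i, b i))) \<bullet> w)) (at s)"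
    unfolding J D using r[of i] v[of i] w(2)
    by (auto simp: Basis_real_pair has_field_derivative_def mult_commute_abs)
qed

text \<open>The chain rule that turns a time derivative into the action of \<open>\<partial>\<^sub>t\<close> on functions of the gradients.\<close>

lemma Dt_along_jet:
  fixes ord :: "'m::finite \<Rightarrow> nat"
  assumes "\<phi> differentiable (at (hjet ord F x s))"
    and J: "((\<lambda>t. hjet ord F x t) has_derivative (\<lambda>h. h *\<^sub>R J)) (at s)"
  shows "Dt (\<lambda>x t. \<phi> (hjet ord F x t)) x s = frechet_derivative \<phi> (at (hjet ord F x s)) J"
proof -
  let ?D = "frechet_derivative \<phi> (at (hjet ord F x s))"
  have D: "(\<phi> has_derivative ?D) (at (hjet ord F x s))"
    using assms(1) by (simp add: frechet_derivative_works[symmetric])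
  have "((\<lambda>t. \<phi> (hjet ord F x t)) has_derivative (\<lambda>h. ?D (h *\<^sub>R J))) (at s)"
    using has_derivative_compose[OF J D] .
  moreover have "(\<lambda>h. ?D (h *\<^sub>R J)) = (\<lambda>h. ?D J * h)"
    using linear_scale[OF linear_frechet_derivative[OF assms(1)]] by (auto simp: mult.commute)
  ultimately have "((\<lambda>t. \<phi> (hjet ord F x t)) has_real_derivative ?D J) (at s)"
    by (simp add: has_field_derivative_def)
  then show ?thesis by (simp add: Dt_def DERIV_imp_deriv)
qed

text \<open>The balance of orders: the coefficients of an expansion up to \<open>o(\<epsilon>\<^sup>2)\<close> of zero vanish.\<close>

lemma quadratic_smallo_zero:
  fixes A B C :: real
  assumes "(\<lambda>e. A + e * B + e ^ 2 * C) \<in> o[at_right 0](\<lambda>e. e ^ 2)"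
  shows "A = 0" "B = 0" "C = 0"
proof -
  have lim: "((\<lambda>e. (A + e * B + e ^ 2 * C) / e ^ 2) \<longlongrightarrow> 0) (at_right 0)"
    using smalloD_tendsto[OF assms] .
  have nz: "\<forall>\<^sub>F e in at_right (0::real). e \<noteq> 0"
    using eventually_at_right_less[of "0::real"] by eventually_elim auto
  have id: "((\<lambda>e::real. e) \<longlongrightarrow> 0) (at_right 0)" by (rule tendsto_ident_at)
  have "((\<lambda>e. (A + e * B + e ^ 2 * C) / e ^ 2 * e ^ 2) \<longlongrightarrow> 0 * 0 ^ 2) (at_right 0)"
    by (intro tendsto_intros lim id)
  moreover have "\<forall>\<^sub>F e in at_right 0. (A + e * B + e ^ 2 * C) / e ^ 2 * e ^ 2 = A + e * B + e ^ 2 * C"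
    using nz by eventually_elim auto
  ultimately have "((\<lambda>e. A + e * B + e ^ 2 * C) \<longlongrightarrow> 0) (at_right 0)" by (simp add: tendsto_cong)
  moreover have "((\<lambda>e. A + e * B + e ^ 2 * C) \<longlongrightarrow> A + 0 * B + 0 ^ 2 * C) (at_right 0)"
    by (intro tendsto_intros id)
  ultimately show A: "A = 0" using tendsto_unique[OF trivial_limit_at_right_real] by fastforce
  have "((\<lambda>e. (A + e * B + e ^ 2 * C) / e ^ 2 * e) \<longlongrightarrow> 0 * 0) (at_right 0)"
    by (intro tendsto_intros lim id)
  moreover have "\<forall>\<^sub>F e in at_right 0. (A + e * B + e ^ 2 * C) / e ^ 2 * e = B + e * C"
    using nz by eventually_elim (auto simp: A field_simps power2_eq_square)
  ultimately have "((\<lambda>e. B + e * C) \<longlongrightarrow> 0) (at_right 0)" by (simp add: tendsto_cong)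
  moreover have "((\<lambda>e. B + e * C) \<longlongrightarrow> B + 0 * C) (at_right 0)" by (intro tendsto_intros id)
  ultimately show B: "B = 0" using tendsto_unique[OF trivial_limit_at_right_real] by fastforce
  have "\<forall>\<^sub>F e in at_right 0. (A + e * B + e ^ 2 * C) / e ^ 2 = C"
    using nz by eventually_elim (auto simp: A B)
  with lim have "((\<lambda>e::real. C) \<longlongrightarrow> 0) (at_right 0)" by (simp add: tendsto_cong)
  then show "C = 0" using tendsto_unique[OF trivial_limit_at_right_real] tendsto_const by blast
qed

lemma dd_uncurried:
  "germ.dd (1, 0) (\<lambda>e z \<xi>. k e (fst z) \<xi> (snd z)) = (\<lambda>e z \<xi>. Dx (\<lambda>x t. k e x \<xi> t) (fst z) (snd z))"
  "germ.dd (0, 1) (\<lambda>e z \<xi>. k e (fst z) \<xi> (snd z)) = (\<lambda>e z \<xi>. Dt (\<lambda>x t. k e x \<xi> t) (fst z) (snd z))"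
  for k :: "real \<Rightarrow> real \<Rightarrow> real \<Rightarrow> real \<Rightarrow> real"
proof -
  show "germ.dd (1, 0) (\<lambda>e z \<xi>. k e (fst z) \<xi> (snd z)) = (\<lambda>e z \<xi>. Dx (\<lambda>x t. k e x \<xi> t) (fst z) (snd z))"
  proof (intro ext)
    fix e \<xi> and z :: "real \<times> real"
    show "germ.dd (1, 0) (\<lambda>e z \<xi>. k e (fst z) \<xi> (snd z)) e z \<xi> = Dx (\<lambda>x t. k e x \<xi> t) (fst z) (snd z)"
      using deriv_shift_0[of "\<lambda>x. k e x \<xi> (snd z)" "fst z"] by (simp add: germ.dd_def Dx_def o_def)
  qed
  show "germ.dd (0, 1) (\<lambda>e z \<xi>. k e (fst z) \<xi> (snd z)) = (\<lambda>e z \<xi>. Dt (\<lambda>x t. k e x \<xi> t) (fst z) (snd z))"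
  proof (intro ext)
    fix e \<xi> and z :: "real \<times> real"
    show "germ.dd (0, 1) (\<lambda>e z \<xi>. k e (fst z) \<xi> (snd z)) e z \<xi> = Dt (\<lambda>x t. k e x \<xi> t) (fst z) (snd z)"
      using deriv_shift_0[of "\<lambda>t. k e (fst z) \<xi> t" "snd z"] by (simp add: germ.dd_def Dt_def o_def)
  qed
qed

text \<open>Hydrodynamic fields of the class are differentiable in time together with their spatial gradients, which
the chain rule along the jets requires.\<close>

lemma field_time_derivative:
  fixes k :: "real \<Rightarrow> real \<Rightarrow> real \<Rightarrow> real"
  assumes k: "germ.of_order (x, s) P r (\<lambda>e z \<xi>. k e (fst z) (snd z))"
  shows "\<forall>\<^sub>F e in at_right 0. ((\<lambda>t. (Dx ^^ i) (k e) x t) has_real_derivative Dt ((Dx ^^ i) (k e)) x s) (at s)"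
proof -
  interpret germ "(x, s)" .
  have B: "(1, 0) \<in> (Basis :: (real \<times> real) set)" "(0, 1) \<in> (Basis :: (real \<times> real) set)"
    by (simp_all add: Basis_real_pair)
  have it: "(dd (1, 0) ^^ i) (\<lambda>e z \<xi>. k e (fst z) (snd z)) = (\<lambda>e z \<xi>. (Dx ^^ i) (k e) (fst z) (snd z))" for i
    by (induction i) (simp_all add: dd_uncurried(1)[of "\<lambda>e x \<xi> t. (Dx ^^ _) (k e) x t"])
  have "has_dd (0, 1) (\<lambda>e z \<xi>. (Dx ^^ i) (k e) (fst z) (snd z)) (dd (0, 1) (\<lambda>e z \<xi>. (Dx ^^ i) (k e) (fst z) (snd z)))"
    using of_order_has_dd[OF of_order_dd_iter[OF k B(1)] B(2), of i] unfolding it .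
  from eventually_germ_center[OF this[unfolded has_dd_def]]
  show ?thesis
  proof eventually_elim
    case (elim e)
    then have "((\<lambda>y. (Dx ^^ i) (k e) x (s + y)) has_real_derivative Dt ((Dx ^^ i) (k e)) x s) (at 0)"
      using fun_cong[OF fun_cong[OF fun_cong[OF dd_uncurried(2)[of "\<lambda>e x \<xi> t. (Dx ^^ i) (k e) x t"]]]]
      by auto
    then show ?case using DERIV_shift[of "(Dx ^^ i) (k e) x" "Dt ((Dx ^^ i) (k e)) x s" 0 s] by (simp add: add.commute)
  qed
qed

text \<open>The expansions of the time derivatives of the single gradients, collected in one limit of vectors to which
linear maps can be applied.\<close>

lemma jet_tendsto:
  fixes ord :: "'m::finite \<Rightarrow> nat" and a b :: "nat \<Rightarrow> real \<Rightarrow> real"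
  assumes a: "\<And>i. (\<lambda>e. a i e - (\<Sum>k\<le>1. e ^ k * (deriv ^^ i) (\<lambda>y. p k y) x)) \<in> o[at_right 0](\<lambda>e. e)"
    and b: "\<And>i. (\<lambda>e. b i e - (\<Sum>k\<le>1. e ^ k * (deriv ^^ i) (\<lambda>y. q k y) x)) \<in> o[at_right 0](\<lambda>e. e)"
  shows "((\<lambda>e. (1 / e) *\<^sub>R ((\<chi> i. (a (ord i) e, b (ord i) e)) - jet ord (p 0) (q 0) x - e *\<^sub>R jet ord (p 1) (q 1) x)) \<longlongrightarrow> 0) (at_right 0)"
proof -
  have eq: "(1 / e) *\<^sub>R ((\<chi> i. (a (ord i) e, b (ord i) e)) - jet ord (p 0) (q 0) x - e *\<^sub>R jet ord (p 1) (q 1) x)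
    = (\<chi> i. ((a (ord i) e - (\<Sum>k\<le>1. e ^ k * (deriv ^^ ord i) (\<lambda>y. p k y) x)) / e,
            (b (ord i) e - (\<Sum>k\<le>1. e ^ k * (deriv ^^ ord i) (\<lambda>y. q k y) x)) / e))" for e
    by (cases "e = 0") (auto simp: vec_eq_iff jet_def full_jet_def zero_prod_def field_simps)
  have "((\<lambda>e. \<chi> i. ((a (ord i) e - (\<Sum>k\<le>1. e ^ k * (deriv ^^ ord i) (\<lambda>y. p k y) x)) / e,
            (b (ord i) e - (\<Sum>k\<le>1. e ^ k * (deriv ^^ ord i) (\<lambda>y. q k y) x)) / e)) \<longlongrightarrow> (\<chi> i. (0, 0))) (at_right 0)"
    by (intro tendsto_vec_lambda tendsto_Pair smalloD_tendsto a b)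
  also have "(\<chi> i. (0, 0)) = (0 :: (real \<times> real) ^ 'm)" by (simp add: vec_eq_iff zero_prod_def)
  finally show ?thesis unfolding eq .
qed

lemma smallo_transform:
  "f \<in> o[F](h) \<Longrightarrow> \<forall>\<^sub>F x in F. f x = g x \<Longrightarrow> g \<in> o[F](h)"
  by (simp add: landau_o.small.in_cong)

lemma linear_smallo:
  fixes l :: "'b::euclidean_space \<Rightarrow> real"
  assumes "linear l"
    and J: "((\<lambda>e. (1 / e) *\<^sub>R (J e - j0 - e *\<^sub>R j1)) \<longlongrightarrow> 0) (at_right 0)"
  shows "(\<lambda>e. l (J e) - (l j0 + e * l j1)) \<in> o[at_right 0](\<lambda>e. e)"
proof (rule smalloI_tendsto)
  have "((\<lambda>e. l ((1 / e) *\<^sub>R (J e - j0 - e *\<^sub>R j1))) \<longlongrightarrow> l 0) (at_right 0)"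
    by (rule bounded_linear.tendsto[OF linear_conv_bounded_linear[THEN iffD1, OF assms(1)] J])
  moreover have "l ((1 / e) *\<^sub>R (J e - j0 - e *\<^sub>R j1)) = (l (J e) - (l j0 + e * l j1)) / e" for e
    by (simp add: linear_scale[OF assms(1)] linear_diff[OF assms(1)] diff_divide_distrib add_divide_distrib)
  ultimately show "((\<lambda>e. (l (J e) - (l j0 + e * l j1)) / e) \<longlongrightarrow> 0) (at_right 0)"
    by (simp add: linear_0[OF assms(1)])
  show "\<forall>\<^sub>F e::real in at_right 0. e \<noteq> 0"
    using eventually_at_right_less[of "0::real"] by eventually_elim auto
qed

section \<open>The balance equations\<close>

theorem theorem1:
  fixes \<tau> T \<alpha> \<beta> \<epsilon>\<^sub>0 tend s :: real
    and \<Delta>t \<Delta>x :: "real \<Rightarrow> real"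
    and f g :: "real \<Rightarrow> real \<Rightarrow> real \<Rightarrow> real \<Rightarrow> real"
    and ord :: "'m::finite \<Rightarrow> nat"
    and U :: "((real \<times> real) ^ 'm) set"
    and c :: "nat \<Rightarrow> real \<Rightarrow> (real \<times> real) ^ 'm \<Rightarrow> real"
    and \<Psi> :: "nat \<Rightarrow> (real \<times> real) ^ 'm \<Rightarrow> real \<times> real"
    and \<rho> u :: "real \<Rightarrow> real"
  assumes "0 < \<tau>" and "0 < T" and "0 < \<epsilon>\<^sub>0"
    and alpha: "1 / 2 < \<alpha>" "\<alpha> < 1" and beta: "1 / 2 < \<beta>" "\<beta> < 1"
    and steps_pos: "\<And>\<epsilon>. \<epsilon> \<in> {0<..<\<epsilon>\<^sub>0} \<Longrightarrow> 0 < \<Delta>t \<epsilon> \<and> 0 < \<Delta>x \<epsilon>"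
    and time_step: "\<Delta>t \<in> \<Theta>[at_right 0](\<lambda>\<epsilon>. \<epsilon> powr \<alpha>)"
    and cell_size: "\<Delta>x \<in> \<Theta>[at_right 0](\<lambda>\<epsilon>. \<epsilon> powr \<beta>)"
    and scheme: "\<And>\<epsilon>. \<epsilon> \<in> {0<..<\<epsilon>\<^sub>0} \<Longrightarrow>
                   dugks_solution \<tau> T \<epsilon> (\<Delta>t \<epsilon>) (\<Delta>x \<epsilon>) {0<..<tend} (f \<epsilon>) (g \<epsilon>)"
    and smooth: "smooth_flow \<epsilon>\<^sub>0 {0<..<tend} f"
    and normal: "normal_form \<epsilon>\<^sub>0 {0<..<tend} f"
    and expansion: "ce_expansion \<epsilon>\<^sub>0 {0<..<tend} U ord f c \<Psi>"
    and fields: "s \<in> {0<..<tend}"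
                "\<And>\<epsilon> x. \<epsilon> \<in> {0<..<\<epsilon>\<^sub>0} \<Longrightarrow> rho (f \<epsilon>) x s = \<rho> x \<and> vel (f \<epsilon>) x s = u x"
  shows "(\<forall>x \<xi>. c 0 \<xi> (jet ord \<rho> u x) = maxwellian T (\<rho> x) (u x) \<xi>) \<and>
         (\<forall>k\<in>{1..2}. \<forall>x \<xi>.
            (\<Sum>j=1..k-1. ce_dt ord \<Psi> j \<rho> u (c (k - j - 1) \<xi>) x)
              + ce_D0 ord \<Psi> \<rho> u \<xi> (c (k - 1) \<xi>) x
            = - (1 / \<tau>) * c k \<xi> (jet ord \<rho> u x))"
proof -
  have eps: "\<forall>\<^sub>F e in at_right 0. e \<in> {0<..<\<epsilon>\<^sub>0}"
    unfolding eventually_at_right_field using \<open>0 < \<epsilon>\<^sub>0\<close> by auto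
  have same: "hjet ord (f e) x s = jet ord \<rho> u x" if "e \<in> {0<..<\<epsilon>\<^sub>0}" for e x
    using fields(2)[OF that] by simp
  have inU: "jet ord \<rho> u x \<in> U" for x
  proof -
    have "\<epsilon>\<^sub>0 / 2 \<in> {0<..<\<epsilon>\<^sub>0}" using \<open>0 < \<epsilon>\<^sub>0\<close> by simp
    then show ?thesis using expansion fields(1) same unfolding ce_expansion_def by metis
  qed
  have diff: "c k \<xi> differentiable (at (jet ord \<rho> u x))" if "k \<le> 2" for k x \<xi>
  proof -
    have "smooth_on U (c k \<xi>)" using expansion that unfolding ce_expansion_def by blast
    then show ?thesis using smooth_on_differentiable inU by blast
  qed
  have balance: "- (1 / \<tau>) * (c 0 \<xi> (jet ord \<rho> u x) - maxwellian T (\<rho> x) (u x) \<xi>) = 0 \<and>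
      - (1 / \<tau>) * c 1 \<xi> (jet ord \<rho> u x) - ce_D0 ord \<Psi> \<rho> u \<xi> (c 0 \<xi>) x = 0 \<and>
      - (1 / \<tau>) * c 2 \<xi> (jet ord \<rho> u x) - (ce_dt ord \<Psi> 1 \<rho> u (c 0 \<xi>) x + ce_D0 ord \<Psi> \<rho> u \<xi> (c 1 \<xi>) x) = 0" for x \<xi>
  proof -
    interpret dugks_germ "(x, s)" \<tau> T "\<rho> x / 2" \<Delta>t \<Delta>x "\<lambda>e z \<xi>. f e (fst z) \<xi> (snd z)"
        "\<lambda>e z \<xi>. g e (fst z + \<Delta>x e / 2) \<xi> (snd z + \<Delta>t e / 2)"
      by (rule dugks_germI[OF assms(1-3) alpha beta steps_pos time_step cell_size scheme smooth fields(1)])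
         (use fields(2) in auto)
    let ?F = "\<lambda>e z \<xi>. f e (fst z) \<xi> (snd z)"
    let ?d = "\<lambda>j k. ce_dt ord \<Psi> j \<rho> u (c k \<xi>) x" and ?y = "\<lambda>k. ce_dx ord \<rho> u (c k \<xi>) x"
    let ?c = "\<lambda>k. c k \<xi> (jet ord \<rho> u x)" and ?M = "maxwellian T (\<rho> x) (u x) \<xi>"
    define Ft where "Ft e = Dt (\<lambda>x t. f e x \<xi> t) x s" for e
    define Fx where "Fx e = Dx (\<lambda>x t. f e x \<xi> t) x s" for e
    define Fv where "Fv e = f e x \<xi> s" for e
    \<comment> \<open>The scheme, up to the order that the three balance equations can see.\<close>
    have me: "(\<lambda>e. - (1 / \<tau>) * (Fv e - ?M) - e * (Ft e + \<xi> * Fx e)) \<in> o[at_right 0](\<lambda>e. e ^ 2)"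
    proof -
      have W: "W e (x, s) \<xi> = Ft e + \<xi> * Fx e" for e
        unfolding W_def dd_uncurried by (simp add: Ft_def Fx_def)
      have Q: "\<forall>\<^sub>F e in at_right 0. Q e (x, s) \<xi> - e * W e (x, s) \<xi> = - (1 / \<tau>) * (Fv e - ?M) - e * (Ft e + \<xi> * Fx e)"
        using eps
      proof eventually_elim
        case (elim e)
        have "Q e (x, s) \<xi> = collision \<tau> T (\<lambda>\<eta>. f e x \<eta> s) \<xi>" using collision_F[of e "(x, s)" \<xi>] by simp
        moreover have "equilibrium T (\<lambda>\<eta>. f e x \<eta> s) \<xi> = ?M"
          using fields(2)[OF elim, of x] by (simp add: equilibrium_def rho_def vel_def)
        ultimately show ?case by (simp add: W collision_def Fv_def)
      qed
      show ?thesis by (rule smallo_transform[OF modified_equation_at Q])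
    qed
    have exp: "(\<lambda>e. (Dx ^^ a) ((Dt ^^ b) (\<lambda>x t. f e x \<xi> t)) x s
            - (\<Sum>k\<le>2. e ^ k * (Dx ^^ a) ((Dt ^^ b) (\<lambda>x t. c k \<xi> (hjet ord (f e) x t))) x s))
        \<in> o[at_right 0](\<lambda>e. e ^ 2)" for a b
      using expansion fields(1) unfolding ce_expansion_def by blast
    have sum2: "(\<Sum>k\<le>2. e ^ k * h k) = h 0 + e * h 1 + e ^ 2 * h 2" for h :: "nat \<Rightarrow> real" and e :: real
      by (simp add: numeral_2_eq_2)
    have Fv: "(\<lambda>e. Fv e - (?c 0 + e * ?c 1 + e ^ 2 * ?c 2)) \<in> o[at_right 0](\<lambda>e. e ^ 2)"
    proof -
      have "\<forall>\<^sub>F e in at_right 0. Fv e - (\<Sum>k\<le>2. e ^ k * c k \<xi> (hjet ord (f e) x s)) = Fv e - (?c 0 + e * ?c 1 + e ^ 2 * ?c 2)"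
        using eps by eventually_elim (simp only: same sum2)
      from landau_o.small.in_cong[OF this] show ?thesis using exp[of 0 0] by (simp add: Fv_def)
    qed
    have Fx: "(\<lambda>e. Fx e - (?y 0 + e * ?y 1 + e ^ 2 * ?y 2)) \<in> o[at_right 0](\<lambda>e. e ^ 2)"
    proof -
      have "\<forall>\<^sub>F e in at_right 0. Fx e - (\<Sum>k\<le>2. e ^ k * Dx (\<lambda>x t. c k \<xi> (hjet ord (f e) x t)) x s)
          = Fx e - (?y 0 + e * ?y 1 + e ^ 2 * ?y 2)"
        using eps
      proof eventually_elim
        case (elim e)
        have "Dx (\<lambda>x t. c k \<xi> (hjet ord (f e) x t)) x s = ?y k" for k
          unfolding Dx_def ce_dx_def by (simp only: same[OF elim])
        then show ?case by (simp only: sum2)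
      qed
      from landau_o.small.in_cong[OF this] show ?thesis using exp[of 1 0] by (simp add: Fx_def)
    qed
    let ?r = "\<lambda>i e. Dt ((Dx ^^ i) (rho (f e))) x s" and ?v = "\<lambda>i e. Dt ((Dx ^^ i) (vel (f e))) x s"
    let ?p = "\<lambda>i k. (deriv ^^ i) (\<lambda>y. fst (\<Psi> k (jet ord \<rho> u y))) x" and ?q = "\<lambda>i k. (deriv ^^ i) (\<lambda>y. snd (\<Psi> k (jet ord \<rho> u y))) x"
    let ?D = "\<lambda>k e. Dt (\<lambda>x t. c k \<xi> (hjet ord (f e) x t)) x s"
    \<comment> \<open>\<open>J\<close> is the time derivative of the jet, and \<open>j k\<close> its contribution of order \<open>k\<close>.\<close>
    define J where "J e = (\<chi> i. (?r (ord i) e, ?v (ord i) e))" for e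
    define j where "j k = jet ord (\<lambda>y. fst (\<Psi> k (jet ord \<rho> u y))) (\<lambda>y. snd (\<Psi> k (jet ord \<rho> u y))) x" for k
    have J: "((\<lambda>e. (1 / e) *\<^sub>R (J e - j 0 - e *\<^sub>R j 1)) \<longlongrightarrow> 0) (at_right 0)"
      unfolding J_def j_def
    proof (rule jet_tendsto)
      fix i
      have E: "(\<lambda>e. ?r i e - (\<Sum>k\<le>1. e ^ k * (deriv ^^ i) (\<lambda>y. fst (\<Psi> k (hjet ord (f e) y s))) x)) \<in> o[at_right 0](\<lambda>e. e)"
        "(\<lambda>e. ?v i e - (\<Sum>k\<le>1. e ^ k * (deriv ^^ i) (\<lambda>y. snd (\<Psi> k (hjet ord (f e) y s))) x)) \<in> o[at_right 0](\<lambda>e. e)"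
        using expansion fields(1) unfolding ce_expansion_def by blast+
      show "(\<lambda>e. ?r i e - (\<Sum>k\<le>1. e ^ k * ?p i k)) \<in> o[at_right 0](\<lambda>e. e)"
        by (rule smallo_transform[OF E(1)]) (use eps in \<open>eventually_elim, simp only: same\<close>)
      show "(\<lambda>e. ?v i e - (\<Sum>k\<le>1. e ^ k * ?q i k)) \<in> o[at_right 0](\<lambda>e. e)"
        by (rule smallo_transform[OF E(2)]) (use eps in \<open>eventually_elim, simp only: same\<close>)
    qed
    have fields_order: "hyd (\<lambda>_. 1) (\<lambda>e z \<xi>. rho (f e) (fst z) (snd z))"
      "hyd (\<lambda>_. 1) (\<lambda>e z \<xi>. vel (f e) (fst z) (snd z))"
    proof -
      have r: "moment ?F = (\<lambda>e z \<xi>. rho (f e) (fst z) (snd z))"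
        by (intro ext) (simp add: moment_def rho_def mass_density_def)
      show "hyd (\<lambda>_. 1) (\<lambda>e z \<xi>. rho (f e) (fst z) (snd z))"
        using rho_order unfolding r .
      have "hyd (\<lambda>_. 1) (\<lambda>e z \<xi>. moment (xi ?F) e z \<xi> * (1 / moment ?F e z \<xi>))"
        by (rule of_order_mult1[OF m_order of_order_inverse[OF rho_order c_pos rho_ge]])
      moreover have "(\<lambda>e z \<xi>. moment (xi ?F) e z \<xi> * (1 / moment ?F e z \<xi>)) = (\<lambda>e z \<xi>. vel (f e) (fst z) (snd z))"
        by (intro ext) (simp add: moment_def vel_def bulk_velocity_def mass_density_def)
      ultimately show "hyd (\<lambda>_. 1) (\<lambda>e z \<xi>. vel (f e) (fst z) (snd z))" by simp
    qed
    have Dtc: "\<forall>\<^sub>F e in at_right 0. ?D k e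
        = frechet_derivative (c k \<xi>) (at (jet ord \<rho> u x)) (J e)" if "k \<le> 2" for k
    proof -
      have "\<forall>\<^sub>F e in at_right 0. \<forall>i\<in>range ord. ((\<lambda>t. (Dx ^^ i) (rho (f e)) x t) has_real_derivative ?r i e) (at s)"
        "\<forall>\<^sub>F e in at_right 0. \<forall>i\<in>range ord. ((\<lambda>t. (Dx ^^ i) (vel (f e)) x t) has_real_derivative ?v i e) (at s)"
        using field_time_derivative[OF fields_order(1)] field_time_derivative[OF fields_order(2)]
        by (subst eventually_ball_finite_distrib; simp)+
      with eps show ?thesis
      proof eventually_elim
        case (elim e)
        have "((\<lambda>t. hjet ord (f e) x t) has_derivative (\<lambda>h. h *\<^sub>R J e)) (at s)"
          unfolding J_def by (rule jet_time_derivative) (use elim in auto)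
        from Dt_along_jet[OF _ this, of "c k \<xi>"] show ?case
          using diff[OF that] unfolding same[OF elim(1)] by blast
      qed
    qed
    have Dtc_exp: "(\<lambda>e. ?D k e - (?d 0 k + e * ?d 1 k)) \<in> o[at_right 0](\<lambda>e. e)" if "k \<le> 2" for k
    proof -
      have "(\<lambda>e. frechet_derivative (c k \<xi>) (at (jet ord \<rho> u x)) (J e) - (?d 0 k + e * ?d 1 k)) \<in> o[at_right 0](\<lambda>e. e)"
        using linear_smallo[OF linear_frechet_derivative[OF diff[OF that]] J] unfolding ce_dt_def j_def .
      moreover have "\<forall>\<^sub>F e in at_right 0. frechet_derivative (c k \<xi>) (at (jet ord \<rho> u x)) (J e) - (?d 0 k + e * ?d 1 k)
          = ?D k e - (?d 0 k + e * ?d 1 k)"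
        using Dtc[OF that] by eventually_elim simp
      ultimately show ?thesis by (rule smallo_transform)
    qed
    \<comment> \<open>\<open>R k\<close> is the error of the two-term expansion of the time derivative of the \<open>k\<close>-th coefficient.\<close>
    define R where "R k e = ?D k e - (?d 0 k + e * ?d 1 k)" for k e
    have R: "R k \<in> o[at_right 0](\<lambda>e. e)" if "k \<le> 2" for k
      using Dtc_exp[OF that] by (simp add: R_def[abs_def])
    have e1: "(\<lambda>e::real. e) \<in> O[at_right 0](\<lambda>_. 1)"
      by (rule bigoI[of _ 1]) (auto simp: eventually_at_right_field intro!: exI[of _ 1])
    have e2: "(\<lambda>e::real. e ^ 2) \<in> O[at_right 0](\<lambda>_. 1)"
      using landau_o.big.mult[OF e1 e1] by (simp add: power2_eq_square)
    have sq: "(\<lambda>e::real. e ^ 2) \<in> o[at_right 0](\<lambda>e. e)"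
    proof (rule smalloI_tendsto)
      show "((\<lambda>e::real. e ^ 2 / e) \<longlongrightarrow> 0) (at_right 0)" by (simp add: power2_eq_square tendsto_ident_at)
      show "\<forall>\<^sub>F e::real in at_right 0. e \<noteq> 0"
        using eventually_at_right_less[of "0::real"] by eventually_elim auto
    qed
    have bounded_sq: "(\<lambda>e. e ^ 2 * (K + e * K')) \<in> o[at_right 0](\<lambda>e. e)" for K K' :: real
    proof -
      have "(\<lambda>e. K + e * K') \<in> O[at_right 0](\<lambda>_. 1)"
        by (intro sum_in_bigo) (use e1 landau_o.big.mult[OF e1, of "\<lambda>_. K'" "\<lambda>_. 1"] in auto)
      from landau_o.small_big_mult[OF sq this] show ?thesis by simp
    qed
    have Ft_exp: "(\<lambda>e. Ft e - (?d 0 0 + e * (?d 1 0 + ?d 0 1))) \<in> o[at_right 0](\<lambda>e. e)"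
    proof -
      have "(\<lambda>e. Ft e - (?D 0 e + e * ?D 1 e + e ^ 2 * ?D 2 e)) \<in> o[at_right 0](\<lambda>e. e)"
        using landau_o.small_trans[OF exp[of 0 1] sq] unfolding sum2 by (simp add: Ft_def)
      note 1 = this
      have 2: "(\<lambda>e. e * R 1 e) \<in> o[at_right 0](\<lambda>e. e)" "(\<lambda>e. e ^ 2 * R 2 e) \<in> o[at_right 0](\<lambda>e. e)"
        using landau_o.big_small_mult[OF e1 R[of 1]] landau_o.big_small_mult[OF e2 R[of 2]] by simp_all
      have "(\<lambda>e. (Ft e - (?D 0 e + e * ?D 1 e + e ^ 2 * ?D 2 e)) + R 0 e + e * R 1 e + e ^ 2 * R 2 e
          + e ^ 2 * ((?d 1 1 + ?d 0 2) + e * ?d 1 2)) \<in> o[at_right 0](\<lambda>e. e)"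
        by (intro sum_in_smallo(1)[OF sum_in_smallo(1)[OF sum_in_smallo(1)[OF sum_in_smallo(1)[OF 1 R] 2(1)] 2(2)] bounded_sq]) simp
      then show ?thesis
        by (rule smallo_transform) (auto intro!: always_eventually simp: R_def algebra_simps power2_eq_square)
    qed
    have Fx_exp: "(\<lambda>e. Fx e - (?y 0 + e * ?y 1)) \<in> o[at_right 0](\<lambda>e. e)"
    proof -
      have "(\<lambda>e. (Fx e - (?y 0 + e * ?y 1 + e ^ 2 * ?y 2)) + e ^ 2 * (?y 2 + e * 0)) \<in> o[at_right 0](\<lambda>e. e)"
        by (intro sum_in_smallo bounded_sq landau_o.small_trans[OF Fx sq])
      then show ?thesis by (rule smallo_transform) (auto intro!: always_eventually)
    qed
    have mult_eps: "(\<lambda>e. e * h e) \<in> o[at_right 0](\<lambda>e. e ^ 2)" if "h \<in> o[at_right 0](\<lambda>e. e)" for h :: "real \<Rightarrow> real"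
      using landau_o.big_small_mult[OF landau_o.big_refl that, of "\<lambda>e. e"] by (simp add: power2_eq_square)
    have cmult: "(\<lambda>e. K * h e) \<in> o[at_right 0](\<lambda>e. e ^ 2)" if "h \<in> o[at_right 0](\<lambda>e. e ^ 2)"
      for h :: "real \<Rightarrow> real" and K :: real
      using landau_o.big_small_mult[OF _ that, of "\<lambda>_. K" "\<lambda>_. 1"] by simp
    \<comment> \<open>Inserting the expansions into the modified equation leaves a polynomial in \<open>e\<close>.\<close>
    have "(\<lambda>e. (- (1 / \<tau>) * (Fv e - ?M) - e * (Ft e + \<xi> * Fx e))
        + (1 / \<tau>) * (Fv e - (?c 0 + e * ?c 1 + e ^ 2 * ?c 2))
        + e * (Ft e - (?d 0 0 + e * (?d 1 0 + ?d 0 1)))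
        + \<xi> * (e * (Fx e - (?y 0 + e * ?y 1)))) \<in> o[at_right 0](\<lambda>e. e ^ 2)"
      by (intro sum_in_smallo(1) cmult[OF Fv] cmult[OF mult_eps[OF Fx_exp]] me mult_eps[OF Ft_exp])
    then have "(\<lambda>e. (- (1 / \<tau>) * (?c 0 - ?M)) + e * (- (1 / \<tau>) * ?c 1 - ce_D0 ord \<Psi> \<rho> u \<xi> (c 0 \<xi>) x)
        + e ^ 2 * (- (1 / \<tau>) * ?c 2 - (?d 1 0 + ce_D0 ord \<Psi> \<rho> u \<xi> (c 1 \<xi>) x))) \<in> o[at_right 0](\<lambda>e. e ^ 2)"
      by (rule smallo_transform)
         (auto intro!: always_eventually simp: ce_D0_def algebra_simps power2_eq_square add_divide_distrib diff_divide_distrib)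
    from quadratic_smallo_zero[OF this] show ?thesis by blast
  qed
  show ?thesis
  proof (intro conjI allI ballI)
    show "c 0 \<xi> (jet ord \<rho> u x) = maxwellian T (\<rho> x) (u x) \<xi>" for x \<xi>
      using balance[of \<xi> x] \<open>0 < \<tau>\<close> by simp
    fix k :: nat and x \<xi> assume "k \<in> {1..2}"
    then consider "k = 1" | "k = 2" by fastforce
    then show "(\<Sum>j=1..k-1. ce_dt ord \<Psi> j \<rho> u (c (k - j - 1) \<xi>) x)
              + ce_D0 ord \<Psi> \<rho> u \<xi> (c (k - 1) \<xi>) x
            = - (1 / \<tau>) * c k \<xi> (jet ord \<rho> u x)"
    proof cases
      case 1
      then show ?thesis using balance[of \<xi> x] by simp
    next
      case 2
      then show ?thesis using balance[of \<xi> x] by simp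
    qed
  qed
qed

end
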